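(* Let $\lambda\ge0$. Suppose that $1\le p<\infty$ and $f$ is $\lambda$-analytic in $\mathbb{D}$. Then $f\in A^p_\lambda(\mathbb{D})$ if and only if $(1-|z|^2)D_z\left(zf(z)\right)\in L^p_\lambda(\mathbb{D})$. Moreover $$\|f\|_{A^p_\lambda}\asymp\left\|(1-|z|^2)D_z\left(zf(z)\right)\right\|_{L^p_\lambda(\mathbb{D})},$$ i.e. each side is bounded by a positive constant, independent of $f$, times the other.
   Context: Fix $\lambda\ge0$; $\mathbb{D}$ is the open unit disk in $\mathbb{C}$. For a complex-valued function $f$ put $$D_zf(z)=\partial_zf(z)+\lambda\frac{f(z)-f(\bar z)}{z-\bar z},\qquad D_{\bar z}f(z)=\partial_{\bar z}f(z)-\lambda\frac{f(z)-f(\bar z)}{z-\bar z},\qquad z=x+iy$$ (at real points the quotient is read as its limit $-i\,\partial_y f$). $D_z(zf(z))$ means $D_z$ applied to the function $z\mapsto zf(z)$. A $C^2$ (real sense) function $f:\mathbb{D}\to\mathbb{C}$ is $\lambda$-analytic if $D_{\bar z}f=0$ in $\mathbb{D}$. $d\sigma_\lambda(z)=c_\lambda|y|^{2\lambda}dx\,dy$, $z=x+iy$, with $c_\lambda=\frac{\Gamma(\lambda+2)}{\Gamma(\lambda+1/2)\Gamma(1/2)}$. $L^p_\lambda(\mathbb{D})=L^p(\mathbb{D};d\sigma_\lambda)$ with norm $\left(\int_{\mathbb{D}}|f|^pd\sigma_\lambda\right)^{1/p}$, and $A^p_\lambda(\mathbb{D})$ is the subspace of $\lambda$-analytic functions in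 $L^p_\lambda(\mathbb{D})$, whose norm is denoted $\|\cdot\|_{A^p_\lambda}$. *)

theory Defs
  imports "HOL-Analysis.Analysis"
begin

abbreviation unit_disk :: "complex set" where
  "unit_disk \<equiv> ball 0 1"

definition partial_x :: "(complex \<Rightarrow> complex) \<Rightarrow> complex \<Rightarrow> complex" where
  "partial_x f z = vector_derivative (\<lambda>t. f (Complex t (Im z))) (at (Re z))"

definition partial_y :: "(complex \<Rightarrow> complex) \<Rightarrow> complex \<Rightarrow> complex" where
  "partial_y f z = vector_derivative (\<lambda>t. f (Complex (Re z) t)) (at (Im z))"

text \<open>The following two predicates are meant for open sets \<open>S\<close>. Differentiability is in the
  real (Frechet) sense, so that the partial derivatives above are genuine derivatives.\<close>

definition C1_on :: "complex set \<Rightarrow> (complex \<Rightarrow> complex) \<Rightarrow> bool" where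
  "C1_on S f \<longleftrightarrow> f differentiable_on S \<and>
     continuous_on S (partial_x f) \<and> continuous_on S (partial_y f)"

definition C2_on :: "complex set \<Rightarrow> (complex \<Rightarrow> complex) \<Rightarrow> bool" where
  "C2_on S f \<longleftrightarrow> C1_on S f \<and> C1_on S (partial_x f) \<and> C1_on S (partial_y f)"

definition wirtinger_z :: "(complex \<Rightarrow> complex) \<Rightarrow> complex \<Rightarrow> complex" where
  "wirtinger_z f z = (partial_x f z - \<i> * partial_y f z) / 2"

definition wirtinger_zbar :: "(complex \<Rightarrow> complex) \<Rightarrow> complex \<Rightarrow> complex" where
  "wirtinger_zbar f z = (partial_x f z + \<i> * partial_y f z) / 2"

text \<open>On the real axis the difference quotient is replaced by its limit
  \<open>- \<i> \<partial>\<^sub>y f\<close>.\<close>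

definition conj_quotient :: "(complex \<Rightarrow> complex) \<Rightarrow> complex \<Rightarrow> complex" where
  "conj_quotient f z =
     (if Im z = 0 then - \<i> * partial_y f z else (f z - f (cnj z)) / (z - cnj z))"

definition D_z :: "real \<Rightarrow> (complex \<Rightarrow> complex) \<Rightarrow> complex \<Rightarrow> complex" where
  "D_z lam f z = wirtinger_z f z + of_real lam * conj_quotient f z"

definition D_zbar :: "real \<Rightarrow> (complex \<Rightarrow> complex) \<Rightarrow> complex \<Rightarrow> complex" where
  "D_zbar lam f z = wirtinger_zbar f z - of_real lam * conj_quotient f z"

text \<open>Functions on the disk are total functions of which only the values on the disk matter.\<close>

definition lambda_analytic :: "real \<Rightarrow> (complex \<Rightarrow> complex) \<Rightarrow> bool" where
  "lambda_analytic lam f \<longleftrightarrow> C2_on unit_disk f \<and> (\<forall>z\<in>unit_disk. D_zbar lam f z = 0)"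

definition c_const :: "real \<Rightarrow> real" where
  "c_const lam = Gamma (lam + 2) / (Gamma (lam + 1 / 2) * Gamma (1 / 2))"

text \<open>For \<open>lam = 0\<close> the convention \<open>0 powr 0 = 0\<close> makes the density vanish on the real axis
  instead of being constant; the real axis is a null set.\<close>

definition sigma_measure :: "real \<Rightarrow> complex measure" where
  "sigma_measure lam =
     density (lebesgue_on unit_disk) (\<lambda>z. ennreal (c_const lam * \<bar>Im z\<bar> powr (2 * lam)))"

definition Lp_space :: "real \<Rightarrow> real \<Rightarrow> (complex \<Rightarrow> complex) set" where
  "Lp_space lam p = {f. f \<in> borel_measurable (sigma_measure lam) \<and>
     integrable (sigma_measure lam) (\<lambda>z. norm (f z) powr p)}"

text \<open>Meaningful only for members of \<open>Lp_space lam p\<close>: the Bochner integral of a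
  non-integrable function is 0.\<close>

definition Lp_norm :: "real \<Rightarrow> real \<Rightarrow> (complex \<Rightarrow> complex) \<Rightarrow> real" where
  "Lp_norm lam p f = (LINT z|sigma_measure lam. norm (f z) powr p) powr (1 / p)"

definition Ap_space :: "real \<Rightarrow> real \<Rightarrow> (complex \<Rightarrow> complex) set" where
  "Ap_space lam p = {f. lambda_analytic lam f \<and> f \<in> Lp_space lam p}"

end

theory Submission
  imports Defs
begin

text \<open>
  On a solution of \<open>D\<^sub>z\<^sub>b\<^sub>a\<^sub>r f = 0\<close> the operator \<open>D\<^sub>z\<close> acts as \<open>\<partial>\<^sub>x\<close>, and \<open>D\<^sub>z (z f)\<close> is
  \<open>G = (r \<partial>\<^sub>r + 1 + \<lambda>) f = f(z) + \<lambda> f(cnj z) + z \<partial>\<^sub>x f(z)\<close>. So the theorem compares \<open>f\<close> with a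
  first-order radial derivative of \<open>f\<close>, damped by the distance to the boundary.

  Write \<open>f\<close> as a combination of two solutions of the form \<open>a + i c\<close>, where \<open>a\<close> and \<open>c\<close> are real,
  \<open>a\<close> is even and \<open>c\<close> is odd in \<open>y\<close>. For these the equation becomes the system
  \<open>a\<^sub>y = - c\<^sub>x\<close>, \<open>c\<^sub>y = a\<^sub>x - 2 \<lambda> c / y\<close>. It says that \<open>(a, - c)\<close> is the gradient of an axially
  symmetric harmonic function in dimension \<open>2 \<lambda> + 2\<close>, and \<open>|y|\<^sup>2\<^sup>\<lambda> dx dy\<close> is Lebesgue measure of that
  dimension in meridian coordinates. Everything follows from the divergence theorem for this weight on a disc of
  radius \<open>\<rho>\<close>, with powers of \<open>w = \<rho>\<^sup>2 - |z|\<^sup>2\<close> as cut-off functions and with powers of the regularized energy \<open>s = a\<^sup>2 + c\<^sup>2 + \<epsilon>\<close>, which are smooth.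

  The central fact is that the gradient of \<open>s / 2\<close> has the squared Hessian \<open>H\<close> of the harmonic function as
  its divergence, and that its own square is at most \<open>\<kappa> H s\<close> with a constant \<open>\<kappa> < 1\<close>
  (\<open>kato_inequality\<close>). As in the theory of Stein and Weiss, \<open>\<kappa> < 1\<close> makes \<open>s\<^sup>q\<close> subharmonic, with
  a margin, down to \<open>q = 1/2\<close>, which covers \<open>p = 2 q = 1\<close>. There are two consequences.

  For \<open>\<parallel>f\<parallel> \<le> C \<parallel>w G\<parallel>\<close> (\<open>hardy_estimate\<close>) the radial vector field \<open>w s\<^sup>q z\<close> is integrated. Its
  divergence expresses the integral of \<open>s\<^sup>q\<close>, up to a term that subharmonicity shows to have a sign, by
  the radial derivative of \<open>s\<^sup>q\<close> and hence by \<open>G\<close>.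

  For \<open>\<parallel>w \<partial>\<^sub>x f\<parallel> \<le> C \<parallel>f\<parallel>\<close> the margin gives the Caccioppoli inequality, which bounds the integral of
  \<open>w\<^sup>2 |f|\<^sup>p\<^sup>-\<^sup>2 |\<partial>\<^sub>x f|\<^sup>2\<close> by that of \<open>|f|\<^sup>p\<close>. For \<open>p \<le> 2\<close> this suffices, because
  \<open>t\<^sup>p \<le> t\<^sup>2 u\<^sup>p\<^sup>-\<^sup>2 + u\<^sup>p\<close>. For \<open>p > 2\<close> one \<open>x\<close>-derivative is moved off
  \<open>|\<partial>\<^sub>x f|\<^sup>p\<close> by an integration by parts, and the second derivatives that appear are absorbed by the
  Caccioppoli inequality for \<open>\<partial>\<^sub>x f\<close>.

  These arguments differentiate \<open>f\<close> up to three times in \<open>x\<close>. Averaging over short horizontal segments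
  preserves the equation and supplies these derivatives. The average length then tends to \<open>0\<close> and \<open>\<rho>\<close>
  tends to \<open>1\<close>; all constants are independent of both.
\<close>

section \<open>Integrals over the plane by slices\<close>

lemma continuous_on_Complex [continuous_intros]:
  assumes "continuous_on S f" "continuous_on S g"
  shows "continuous_on S (\<lambda>x. Complex (f x) (g x))"
  unfolding Complex_eq by (intro continuous_intros assms)

lemma measurable_Complex_pair [measurable]:
  "(\<lambda>(x, y). Complex x y) \<in> borel_measurable (lborel \<Otimes>\<^sub>M lborel)"
  unfolding lborel_prod measurable_lborel2 case_prod_beta
  by (intro borel_measurable_continuous_onI continuous_intros)

text \<open>Carries Fubini's theorem from a product of two lines to the complex plane.\<close>
lemma lborel_complex_eq_distr:
  "(lborel :: complex measure) = distr (lborel \<Otimes>\<^sub>M lborel) borel (\<lambda>(x, y). Complex x y)"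
proof (rule lborel_eqI)
  fix l u :: complex
  assume le: "\<And>b. b \<in> Basis \<Longrightarrow> l \<bullet> b \<le> u \<bullet> b"
  have le': "Re l \<le> Re u" "Im l \<le> Im u"
    using le[of 1] le[of \<i>] by (auto simp: Basis_complex_def inner_complex_def)
  have "(\<lambda>(x, y). Complex x y) -` box l u \<inter> space (lborel \<Otimes>\<^sub>M lborel)
      = {Re l <..< Re u} \<times> {Im l <..< Im u}"
    by (auto simp: in_box_complex_iff space_pair_measure)
  then have "emeasure (distr (lborel \<Otimes>\<^sub>M lborel) borel (\<lambda>(x, y). Complex x y)) (box l u)
     = emeasure (lborel \<Otimes>\<^sub>M lborel) ({Re l <..< Re u} \<times> {Im l <..< Im u})"
    by (simp add: emeasure_distr)
  also have "\<dots> = ennreal (Re u - Re l) * ennreal (Im u - Im l)"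
    using le' by (subst lborel.emeasure_pair_measure_Times) auto
  also have "\<dots> = (\<Prod>b\<in>Basis. (u - l) \<bullet> b)"
    using le' by (simp add: Basis_complex_def inner_complex_def ennreal_mult complex_eq_iff)
  finally show "emeasure (distr (lborel \<Otimes>\<^sub>M lborel) borel (\<lambda>(x, y). Complex x y)) (box l u)
    = (\<Prod>b\<in>Basis. (u - l) \<bullet> b)" .
qed simp

lemma integrable_complex_iff_pair:
  fixes g :: "complex \<Rightarrow> real"
  assumes "g \<in> borel_measurable borel"
  shows "integrable lborel g \<longleftrightarrow> integrable (lborel \<Otimes>\<^sub>M lborel) (\<lambda>(x, y). g (Complex x y))"
  using assms by (subst lborel_complex_eq_distr, subst integrable_distr_eq) (auto simp: case_prod_unfold)

lemma integral_complex_eq_pair: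
  fixes g :: "complex \<Rightarrow> real"
  assumes "g \<in> borel_measurable borel"
  shows "integral\<^sup>L lborel g = integral\<^sup>L (lborel \<Otimes>\<^sub>M lborel) (\<lambda>(x, y). g (Complex x y))"
  using assms by (subst lborel_complex_eq_distr, subst integral_distr) (auto simp: case_prod_unfold)

text \<open>Only almost every row of an integrable function is integrable. The row on the real axis is left out as well,
  because the \<open>y\<close>-equations of the system below say nothing there.\<close>
lemma integral_zero_if_rows_zero:
  fixes g :: "complex \<Rightarrow> real"
  assumes g: "integrable lborel g"
    and rows: "\<And>y. y \<noteq> 0 \<Longrightarrow> integrable lborel (\<lambda>x. g (Complex x y)) \<Longrightarrow>
                 (LINT x|lborel. g (Complex x y)) = 0"
  shows "integral\<^sup>L lborel g = 0"
proof -
  have [measurable]: "g \<in> borel_measurable borel" using borel_measurable_integrable[OF g] by simp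
  have *: "integrable (lborel \<Otimes>\<^sub>M lborel) (\<lambda>(x, y). g (Complex x y))"
    using g integrable_complex_iff_pair[of g] by simp
  have "integral\<^sup>L lborel g = (LINT y|lborel. LINT x|lborel. g (Complex x y))"
    using lborel_pair.integral_snd[OF *] integral_complex_eq_pair[of g] by simp
  also have "\<dots> = (LINT y|(lborel::real measure). 0)"
  proof (rule integral_cong_AE)
    show "AE y in lborel. (LINT x|lborel. g (Complex x y)) = 0"
      using lborel_pair.AE_integrable_snd[OF *] AE_lborel_singleton[of "0::real"]
      by eventually_elim (use rows in auto)
  qed (use lborel_pair.integrable_snd[OF *] in auto)
  finally show ?thesis by simp
qed

lemma integral_zero_if_columns_zero:
  fixes g :: "complex \<Rightarrow> real"
  assumes g: "integrable lborel g"
    and cols: "\<And>x. integrable lborel (\<lambda>y. g (Complex x y)) \<Longrightarrow>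
                 (LINT y|lborel. g (Complex x y)) = 0"
  shows "integral\<^sup>L lborel g = 0"
proof -
  have [measurable]: "g \<in> borel_measurable borel" using borel_measurable_integrable[OF g] by simp
  have *: "integrable (lborel \<Otimes>\<^sub>M lborel) (\<lambda>(x, y). g (Complex x y))"
    using g integrable_complex_iff_pair[of g] by simp
  have "integral\<^sup>L lborel g = (LINT x|lborel. LINT y|lborel. g (Complex x y))"
    using lborel_pair.integral_fst[OF *] integral_complex_eq_pair[of g] by simp
  also have "\<dots> = (LINT x|(lborel::real measure). 0)"
  proof (rule integral_cong_AE)
    show "AE x in lborel. (LINT y|lborel. g (Complex x y)) = 0"
      using lborel_pair.AE_integrable_fst[OF *]
      by eventually_elim (use cols in auto)
  qed (use lborel_pair.integrable_fst[OF *] in auto)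
  finally show ?thesis by simp
qed

text \<open>The finite exceptional set will be \<open>{0}\<close>, where \<open>|y|\<^sup>2\<^sup>\<lambda>\<close> is in general not differentiable.\<close>
lemma integral_derivative_eq_zero:
  fixes F F' :: "real \<Rightarrow> real"
  assumes "0 < Y" "finite S" and cont: "continuous_on {-Y..Y} F" and "F (-Y) = 0" "F Y = 0"
    and der: "\<And>t. t \<in> {-Y<..<Y} - S \<Longrightarrow> (F has_real_derivative F' t) (at t)"
    and int: "integrable lborel (\<lambda>t. indicator {-Y<..<Y} t * F' t)"
  shows "(LINT t|lborel. indicator {-Y<..<Y} t * F' t) = 0"
proof -
  have "(F' has_integral (F Y - F (-Y))) {-Y..Y}"
    by (rule fundamental_theorem_of_calculus_interior_strong[OF assms(2)])
      (use assms in \<open>auto simp: has_real_derivative_iff_has_vector_derivative\<close>)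
  then have "(F' has_integral 0) {-Y<..<Y}"
    using assms has_integral_open_interval[of F' 0 "-Y" Y] by (simp add: box_real)
  then have "((\<lambda>t. indicator {-Y<..<Y} t * F' t) has_integral 0) UNIV"
    by (subst (asm) has_integral_restrict_UNIV[symmetric])
      (erule has_integral_eq[rotated], simp add: indicator_def)
  with has_integral_integral_lborel[OF int] show ?thesis
    using has_integral_unique by blast
qed

text \<open>For integral \<open>2 \<lambda>\<close> this is, up to a factor, the volume on a ball of dimension \<open>2 \<lambda> + 2\<close> pushed
  forward to the coordinate \<open>x\<close> along an axis and the distance \<open>|y|\<close> from it.\<close>
definition axial_measure :: "real \<Rightarrow> real \<Rightarrow> complex measure" where
  "axial_measure lam \<rho> =
     density (restrict_space lborel (ball 0 \<rho>)) (\<lambda>z. ennreal (\<bar>Im z\<bar> powr (2 * lam)))"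

lemma space_axial_measure [simp]: "space (axial_measure lam \<rho>) = ball 0 \<rho>"
  by (simp add: axial_measure_def space_restrict_space)

lemma sets_axial_measure: "sets (axial_measure lam \<rho>) = sets (restrict_space borel (ball 0 \<rho>))"
  by (simp add: axial_measure_def sets_restrict_space)

lemma measurable_axial_measure:
  "f \<in> borel_measurable (axial_measure lam \<rho>) \<longleftrightarrow> f \<in> borel_measurable (restrict_space borel (ball 0 \<rho>))"
  by (rule arg_cong[where f="\<lambda>A. f \<in> A"], rule measurable_cong_sets) (auto simp: sets_axial_measure)

lemma borel_measurable_axial_continuous:
  "continuous_on (ball 0 \<rho>) f \<Longrightarrow> f \<in> borel_measurable (axial_measure lam \<rho>)"
  unfolding measurable_axial_measure by (rule borel_measurable_continuous_on_restrict)

lemma measurable_axial_weight [measurable]: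
  "(\<lambda>z. ennreal (\<bar>Im z\<bar> powr (2 * lam))) \<in> borel_measurable (restrict_space lborel (ball 0 \<rho>))"
  "(\<lambda>z. \<bar>Im z\<bar> powr (2 * lam)) \<in> borel_measurable (restrict_space lborel (ball 0 \<rho>))"
  by (rule measurable_restrict_space1, measurable)+

lemma nn_integral_axial_measure:
  assumes "f \<in> borel_measurable (axial_measure lam \<rho>)"
  shows "nn_integral (axial_measure lam \<rho>) f =
    (\<integral>\<^sup>+z. ennreal (\<bar>Im z\<bar> powr (2 * lam)) * f z * indicator (ball 0 \<rho>) z \<partial>lborel)"
proof -
  have [measurable]: "f \<in> borel_measurable (restrict_space lborel (ball 0 \<rho>))"
    using assms by (simp add: axial_measure_def)
  show ?thesis
    unfolding axial_measure_def
    by (subst nn_integral_density) (auto simp: nn_integral_restrict_space)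
qed

lemma integrable_axial_measure:
  fixes f :: "complex \<Rightarrow> real"
  assumes "f \<in> borel_measurable (axial_measure lam \<rho>)"
  shows "integrable (axial_measure lam \<rho>) f \<longleftrightarrow>
    integrable lborel (\<lambda>z. indicator (ball 0 \<rho>) z * (\<bar>Im z\<bar> powr (2 * lam) * f z))"
proof -
  have [measurable]: "f \<in> borel_measurable (restrict_space lborel (ball 0 \<rho>))"
    using assms by (simp add: axial_measure_def)
  show ?thesis
    unfolding axial_measure_def
    by (subst integrable_density) (auto simp: integrable_restrict_space intro!: measurable_restrict_space1)
qed

lemma integral_axial_measure:
  fixes f :: "complex \<Rightarrow> real"
  assumes "f \<in> borel_measurable (axial_measure lam \<rho>)"
  shows "integral\<^sup>L (axial_measure lam \<rho>) f =
    (LINT z|lborel. indicator (ball 0 \<rho>) z * (\<bar>Im z\<bar> powr (2 * lam) * f z))"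
proof -
  have [measurable]: "f \<in> borel_measurable (restrict_space lborel (ball 0 \<rho>))"
    using assms by (simp add: axial_measure_def)
  show ?thesis
    unfolding axial_measure_def
    by (subst integral_density) (auto simp: integral_restrict_space intro!: measurable_restrict_space1)
qed

lemma finite_measure_axial:
  assumes "lam \<ge> 0"
  shows "finite_measure (axial_measure lam \<rho>)"
proof
  have "emeasure (axial_measure lam \<rho>) (space (axial_measure lam \<rho>))
      = (\<integral>\<^sup>+z. 1 \<partial>axial_measure lam \<rho>)" by simp
  also have "\<dots> = (\<integral>\<^sup>+z. ennreal (\<bar>Im z\<bar> powr (2 * lam)) * 1 * indicator (ball 0 \<rho>) z \<partial>lborel)"
    by (rule nn_integral_axial_measure) simp
  also have "\<dots> \<le> (\<integral>\<^sup>+z. ennreal (\<bar>\<rho>\<bar> powr (2 * lam)) * indicator (ball 0 \<rho>) (z::complex) \<partial>lborel)"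
  proof (rule nn_integral_mono)
    fix z :: complex
    show "ennreal (\<bar>Im z\<bar> powr (2 * lam)) * 1 * indicator (ball 0 \<rho>) z
        \<le> ennreal (\<bar>\<rho>\<bar> powr (2 * lam)) * indicator (ball 0 \<rho>) z"
    proof (cases "z \<in> ball 0 \<rho>")
      case True
      then have "\<bar>Im z\<bar> \<le> \<bar>\<rho>\<bar>" using abs_Im_le_cmod[of z] by auto
      then have "\<bar>Im z\<bar> powr (2 * lam) \<le> \<bar>\<rho>\<bar> powr (2 * lam)"
        using assms by (intro powr_mono2) auto
      then show ?thesis using True by (simp add: ennreal_leI)
    qed simp
  qed
  also have "\<dots> = ennreal (\<bar>\<rho>\<bar> powr (2 * lam)) * emeasure lborel (ball (0::complex) \<rho>)"
    by (simp add: nn_integral_cmult_indicator)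
  also have "\<dots> < \<infinity>"
    using emeasure_bounded_finite[of "ball (0::complex) \<rho>"] by (simp add: ennreal_mult_less_top)
  finally show "emeasure (axial_measure lam \<rho>) (space (axial_measure lam \<rho>)) \<noteq> \<infinity>" by simp
qed

lemma norm_Complex_less_iff: 
  assumes "0 < \<rho>"
  shows "cmod (Complex x y) < \<rho> \<longleftrightarrow> x\<^sup>2 + y\<^sup>2 < \<rho>\<^sup>2"
  using assms by (metis complex_norm less_imp_le power2_eq_iff_nonneg real_less_lsqrt real_sqrt_less_iff real_sqrt_unique norm_ge_zero power_mono_iff abs_of_nonneg not_less real_sqrt_abs)

lemma norm_Complex_le_iff: 
  assumes "0 < \<rho>"
  shows "cmod (Complex x y) \<le> \<rho> \<longleftrightarrow> x\<^sup>2 + y\<^sup>2 \<le> \<rho>\<^sup>2"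
  using assms by (metis complex_norm less_imp_le real_sqrt_le_iff real_sqrt_abs abs_of_nonneg)

section \<open>The divergence theorem for the axial measure\<close>

lemma has_real_derivative_abs_powr:
  fixes r y :: real
  assumes "y \<noteq> 0"
  shows "((\<lambda>t. \<bar>t\<bar> powr r) has_real_derivative \<bar>y\<bar> powr r * (r / y)) (at y)"
proof (cases "y > 0")
  case True
  have "((\<lambda>t. t powr r) has_real_derivative \<bar>y\<bar> powr r * (r / y)) (at y)"
    using True by (auto intro!: derivative_eq_intros simp: powr_diff)
  then show ?thesis
    by (rule has_field_derivative_transform_within[where d=y]) (use True in \<open>auto simp: dist_real_def\<close>)
next
  case False
  then have "y < 0" using assms by simp
  have "((\<lambda>t. (- t) powr r) has_real_derivative \<bar>y\<bar> powr r * (r / y)) (at y)"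
    using \<open>y < 0\<close> by (auto intro!: derivative_eq_intros simp: powr_diff)
  then show ?thesis
    by (rule has_field_derivative_transform_within[where d="-y"]) (use \<open>y < 0\<close> in \<open>auto simp: dist_real_def\<close>)
qed

text \<open>The value of \<open>F\<close> at \<open>0\<close> matters when \<open>r = 0\<close>: by the convention \<open>0 powr 0 = 0\<close> the weight then
  jumps at \<open>0\<close>.\<close>
lemma continuous_on_weighted:
  fixes F :: "real \<Rightarrow> real"
  assumes "0 \<le> r" "continuous_on S F" "F 0 = 0"
  shows "continuous_on S (\<lambda>t. \<bar>t\<bar> powr r * F t)"
proof (cases "r = 0")
  case True
  then have "(\<lambda>t. \<bar>t\<bar> powr r * F t) = F" using assms(3) by (auto simp: fun_eq_iff)
  then show ?thesis using assms(2) by metis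
next
  case False
  then show ?thesis using assms by (intro continuous_on_mult continuous_on_powr' continuous_intros) auto
qed

text \<open>\<open>Y\<close> is half the length of the chord that a horizontal or vertical line cuts out of a disc.\<close>
lemma chord:
  assumes "y\<^sup>2 < \<rho>\<^sup>2" "0 < \<rho>"
  defines "Y \<equiv> sqrt (\<rho>\<^sup>2 - y\<^sup>2)"
  shows "0 < Y" "x\<^sup>2 + y\<^sup>2 < \<rho>\<^sup>2 \<longleftrightarrow> -Y < x \<and> x < Y" "x\<^sup>2 + y\<^sup>2 \<le> \<rho>\<^sup>2 \<longleftrightarrow> -Y \<le> x \<and> x \<le> Y"
    "Y\<^sup>2 + y\<^sup>2 = \<rho>\<^sup>2"
proof -
  show "0 < Y" using assms by (simp add: Y_def)
  have Y2: "Y\<^sup>2 = \<rho>\<^sup>2 - y\<^sup>2" using assms by (simp add: Y_def)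
  then show "Y\<^sup>2 + y\<^sup>2 = \<rho>\<^sup>2" by simp
  have "x\<^sup>2 < Y\<^sup>2 \<longleftrightarrow> -Y < x \<and> x < Y"
    using \<open>0 < Y\<close> abs_square_less_1 power2_less_eq_zero_iff
    by (metis abs_less_iff abs_le_square_iff abs_of_pos linorder_not_less minus_less_iff)
  then show "x\<^sup>2 + y\<^sup>2 < \<rho>\<^sup>2 \<longleftrightarrow> -Y < x \<and> x < Y" using Y2 by auto
  have "x\<^sup>2 \<le> Y\<^sup>2 \<longleftrightarrow> -Y \<le> x \<and> x \<le> Y"
    using \<open>0 < Y\<close> by (metis abs_le_iff abs_le_square_iff abs_of_pos minus_le_iff)
  then show "x\<^sup>2 + y\<^sup>2 \<le> \<rho>\<^sup>2 \<longleftrightarrow> -Y \<le> x \<and> x \<le> Y" using Y2 by auto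
qed

lemma integral_x_derivative_eq_zero:
  assumes \<rho>: "0 < \<rho>"
    and cont: "continuous_on (cball 0 \<rho>) P"
    and bdry: "\<And>z. norm z = \<rho> \<Longrightarrow> P z = 0"
    and der: "\<And>z. norm z < \<rho> \<Longrightarrow> Im z \<noteq> 0 \<Longrightarrow>
           ((\<lambda>t. P (Complex t (Im z))) has_real_derivative Px z) (at (Re z))"
    and int: "integrable (axial_measure lam \<rho>) Px"
  shows "(LINT z|axial_measure lam \<rho>. Px z) = 0"
proof -
  let ?g = "\<lambda>z. indicator (ball 0 \<rho>) z * (\<bar>Im z\<bar> powr (2 * lam) * Px z)"
  have meas: "Px \<in> borel_measurable (axial_measure lam \<rho>)" using int by auto
  have "integrable lborel ?g" using int integrable_axial_measure[OF meas] by simp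
  then have "integral\<^sup>L lborel ?g = 0"
  proof (rule integral_zero_if_rows_zero)
    fix y :: real assume y: "y \<noteq> 0" and i: "integrable lborel (\<lambda>x. ?g (Complex x y))"
    show "(LINT x|lborel. ?g (Complex x y)) = 0"
    proof (cases "y\<^sup>2 < \<rho>\<^sup>2")
      case False
      then have "indicator (ball 0 \<rho>) (Complex x y) = (0::real)" for x
        using norm_Complex_less_iff[OF \<rho>, of x y] zero_le_power2[of x]
        by (auto simp: indicator_def simp del: zero_le_power2)
      then show ?thesis by simp
    next
      case True
      define Y where "Y = sqrt (\<rho>\<^sup>2 - y\<^sup>2)"
      note ch = chord[OF True \<rho>, folded Y_def]
      have ind: "?g (Complex x y) = indicator {-Y<..<Y} x * (\<bar>y\<bar> powr (2 * lam) * Px (Complex x y))" for x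
        using norm_Complex_less_iff[OF \<rho>, of x y] ch(2)[of x] by (auto simp: indicator_def)
      show ?thesis unfolding ind
      proof (rule integral_derivative_eq_zero[where S="{}" and F="\<lambda>x. \<bar>y\<bar> powr (2 * lam) * P (Complex x y)"])
        show "continuous_on {- Y..Y} (\<lambda>x. \<bar>y\<bar> powr (2 * lam) * P (Complex x y))"
          using norm_Complex_le_iff[OF \<rho>] ch(3)
          by (intro continuous_intros continuous_on_compose2[OF cont]) auto
        have "norm (Complex (-Y) y) = \<rho>" "norm (Complex Y y) = \<rho>"
          using ch(4) \<rho> by (auto simp: complex_norm)
        then show "\<bar>y\<bar> powr (2 * lam) * P (Complex (-Y) y) = 0" "\<bar>y\<bar> powr (2 * lam) * P (Complex Y y) = 0"
          using bdry by auto
        fix t assume "t \<in> {-Y<..<Y} - {}"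
        then have "norm (Complex t y) < \<rho>" using norm_Complex_less_iff[OF \<rho>, of t y] ch(2)[of t] by auto
        from der[OF this] y show "((\<lambda>x. \<bar>y\<bar> powr (2 * lam) * P (Complex x y)) has_real_derivative
            \<bar>y\<bar> powr (2 * lam) * Px (Complex t y)) (at t)"
          by (auto intro!: DERIV_cmult)
      qed (use ch(1) i[unfolded ind] in auto)
    qed
  qed
  then show ?thesis using integral_axial_measure[OF meas] by simp
qed

text \<open>\<open>Q\<^sub>y + 2 \<lambda> Q / y\<close> is \<open>|y|\<^sup>-\<^sup>2\<^sup>\<lambda> \<partial>\<^sub>y (|y|\<^sup>2\<^sup>\<lambda> Q)\<close>, so that every column integrates to
  \<open>0\<close> by the fundamental theorem of calculus on the whole chord. No boundary term arises at the axis because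
  \<open>|y|\<^sup>2\<^sup>\<lambda> Q\<close> is continuous across it.\<close>
lemma integral_y_divergence_eq_zero:
  assumes \<rho>: "0 < \<rho>" and lam: "0 \<le> lam"
    and cont: "continuous_on (cball 0 \<rho>) Q"
    and bdry: "\<And>z. norm z = \<rho> \<Longrightarrow> Q z = 0"
    and axis: "\<And>z. norm z < \<rho> \<Longrightarrow> Im z = 0 \<Longrightarrow> Q z = 0"
    and der: "\<And>z. norm z < \<rho> \<Longrightarrow> Im z \<noteq> 0 \<Longrightarrow>
           ((\<lambda>t. Q (Complex (Re z) t)) has_real_derivative Qy z) (at (Im z))"
    and int: "integrable (axial_measure lam \<rho>) (\<lambda>z. Qy z + 2 * lam * (Q z / Im z))"
  shows "(LINT z|axial_measure lam \<rho>. Qy z + 2 * lam * (Q z / Im z)) = 0"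
proof -
  let ?h = "\<lambda>z. Qy z + 2 * lam * (Q z / Im z)"
  let ?g = "\<lambda>z. indicator (ball 0 \<rho>) z * (\<bar>Im z\<bar> powr (2 * lam) * ?h z)"
  have meas: "?h \<in> borel_measurable (axial_measure lam \<rho>)" using int by auto
  have "integrable lborel ?g" using int integrable_axial_measure[OF meas] by simp
  then have "integral\<^sup>L lborel ?g = 0"
  proof (rule integral_zero_if_columns_zero)
    fix x :: real assume i: "integrable lborel (\<lambda>y. ?g (Complex x y))"
    show "(LINT y|lborel. ?g (Complex x y)) = 0"
    proof (cases "x\<^sup>2 < \<rho>\<^sup>2")
      case False
      then have "indicator (ball 0 \<rho>) (Complex x y) = (0::real)" for y
        using norm_Complex_less_iff[OF \<rho>, of x y] zero_le_power2[of y]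
        by (auto simp: indicator_def simp del: zero_le_power2)
      then show ?thesis by simp
    next
      case True
      define Y where "Y = sqrt (\<rho>\<^sup>2 - x\<^sup>2)"
      note ch = chord[OF True \<rho>, folded Y_def]
      have ind: "?g (Complex x y) = indicator {-Y<..<Y} y * (\<bar>y\<bar> powr (2 * lam) * ?h (Complex x y))" for y
        using norm_Complex_less_iff[OF \<rho>, of x y] ch(2)[of y] by (auto simp: indicator_def add.commute)
      show ?thesis unfolding ind
      proof (rule integral_derivative_eq_zero[where S="{0}" and F="\<lambda>y. \<bar>y\<bar> powr (2 * lam) * Q (Complex x y)"])
        show "continuous_on {- Y..Y} (\<lambda>y. \<bar>y\<bar> powr (2 * lam) * Q (Complex x y))"
          using norm_Complex_le_iff[OF \<rho>] ch(3) lam axis[of "Complex x 0"] norm_Complex_less_iff[OF \<rho>, of x 0] True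
          by (intro continuous_on_weighted continuous_intros continuous_on_compose2[OF cont]) (auto simp: add.commute)
        have "norm (Complex x (-Y)) = \<rho>" "norm (Complex x Y) = \<rho>"
          using ch(4) \<rho> by (auto simp: complex_norm add.commute)
        then show "\<bar>-Y\<bar> powr (2 * lam) * Q (Complex x (-Y)) = 0" "\<bar>Y\<bar> powr (2 * lam) * Q (Complex x Y) = 0"
          using bdry by auto
        fix t assume t: "t \<in> {-Y<..<Y} - {0}"
        then have "norm (Complex x t) < \<rho>" using norm_Complex_less_iff[OF \<rho>, of x t] ch(2)[of t] by (auto simp: add.commute)
        from der[OF this] t have "((\<lambda>y. Q (Complex x y)) has_real_derivative Qy (Complex x t)) (at t)" by auto
        from DERIV_mult[OF has_real_derivative_abs_powr[of t "2 * lam"] this] t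
        show "((\<lambda>y. \<bar>y\<bar> powr (2 * lam) * Q (Complex x y)) has_real_derivative
            \<bar>t\<bar> powr (2 * lam) * ?h (Complex x t)) (at t)"
          by (simp add: algebra_simps)
      qed (use ch(1) i[unfolded ind] in auto)
    qed
  qed
  then show ?thesis using integral_axial_measure[OF meas] by simp
qed

text \<open>Bounded measurable functions are closed under arithmetic, so the integrability of the long integrands below can
  be read off from their shape, including quotients by \<open>y\<close> that are discontinuous at the axis.\<close>
definition bounded_measurable :: "real \<Rightarrow> (complex \<Rightarrow> real) \<Rightarrow> bool" where
  "bounded_measurable \<rho> F \<longleftrightarrow>
     F \<in> borel_measurable (restrict_space borel (ball 0 \<rho>)) \<and> (\<exists>K. \<forall>z\<in>ball 0 \<rho>. \<bar>F z\<bar> \<le> K)"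

lemma bounded_measurable_integrable:
  assumes "0 \<le> lam" "bounded_measurable \<rho> F"
  shows "integrable (axial_measure lam \<rho>) F"
proof -
  interpret finite_measure "axial_measure lam \<rho>" by (rule finite_measure_axial[OF assms(1)])
  obtain K where K: "\<forall>z\<in>ball 0 \<rho>. \<bar>F z\<bar> \<le> K" using assms by (auto simp: bounded_measurable_def)
  show ?thesis
  proof (rule integrable_const_bound[where B=K])
    show "AE x in axial_measure lam \<rho>. norm (F x) \<le> K"
      using K by (intro AE_I2) auto
  qed (use assms in \<open>simp add: bounded_measurable_def measurable_axial_measure\<close>)
qed

named_theorems bm_intros

lemma bounded_measurable_continuous:
  assumes "continuous_on (cball 0 \<rho>) F"
  shows "bounded_measurable \<rho> F"
proof -
  have "bounded (F ` cball 0 \<rho>)"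
    by (rule compact_imp_bounded[OF compact_continuous_image[OF assms compact_cball]])
  then obtain K where "\<forall>z\<in>cball 0 \<rho>. \<bar>F z\<bar> \<le> K" by (auto simp: bounded_iff)
  moreover have "continuous_on (ball 0 \<rho>) F"
    by (rule continuous_on_subset[OF assms ball_subset_cball])
  ultimately show ?thesis
    unfolding bounded_measurable_def using ball_subset_cball
    by (blast intro: borel_measurable_continuous_on_restrict)
qed

lemma bounded_measurable_const [bm_intros]: "bounded_measurable \<rho> (\<lambda>z. c)"
  by (auto simp: bounded_measurable_def)

lemma bounded_measurable_add [bm_intros]:
  assumes "bounded_measurable \<rho> F" "bounded_measurable \<rho> G"
  shows "bounded_measurable \<rho> (\<lambda>z. F z + G z)"
proof -
  obtain K L where "\<forall>z\<in>ball 0 \<rho>. \<bar>F z\<bar> \<le> K" "\<forall>z\<in>ball 0 \<rho>. \<bar>G z\<bar> \<le> L"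
    using assms by (auto simp: bounded_measurable_def)
  then have "\<forall>z\<in>ball 0 \<rho>. \<bar>F z + G z\<bar> \<le> K + L" by (metis abs_triangle_ineq add_mono order_trans)
  then show ?thesis using assms by (auto simp: bounded_measurable_def)
qed

lemma bounded_measurable_mult [bm_intros]:
  assumes "bounded_measurable \<rho> F" "bounded_measurable \<rho> G"
  shows "bounded_measurable \<rho> (\<lambda>z. F z * G z)"
proof -
  obtain K L where KL: "\<forall>z\<in>ball 0 \<rho>. \<bar>F z\<bar> \<le> K" "\<forall>z\<in>ball 0 \<rho>. \<bar>G z\<bar> \<le> L"
    using assms by (auto simp: bounded_measurable_def)
  have "\<forall>z\<in>ball 0 \<rho>. \<bar>F z * G z\<bar> \<le> K * L"
    using KL by (auto simp: abs_mult intro!: mult_mono order_trans[OF abs_ge_zero])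
  then show ?thesis using assms by (auto simp: bounded_measurable_def)
qed

lemma bounded_measurable_uminus [bm_intros]:
  "bounded_measurable \<rho> F \<Longrightarrow> bounded_measurable \<rho> (\<lambda>z. - F z)"
  by (auto simp: bounded_measurable_def)

lemma bounded_measurable_diff [bm_intros]:
  "bounded_measurable \<rho> F \<Longrightarrow> bounded_measurable \<rho> G \<Longrightarrow> bounded_measurable \<rho> (\<lambda>z. F z - G z)"
  using bounded_measurable_add[OF _ bounded_measurable_uminus] by simp

lemma bounded_measurable_power [bm_intros]:
  "bounded_measurable \<rho> F \<Longrightarrow> bounded_measurable \<rho> (\<lambda>z. F z ^ n)"
  by (induction n) (auto intro: bm_intros)

lemma bounded_measurable_divide_Im:
  assumes "bounded_measurable \<rho> F" "\<And>z. z \<in> ball 0 \<rho> \<Longrightarrow> \<bar>F z\<bar> \<le> K * \<bar>Im z\<bar>"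
  shows "bounded_measurable \<rho> (\<lambda>z. F z / Im z)"
proof -
  have "\<bar>F z / Im z\<bar> \<le> \<bar>K\<bar>" if "z \<in> ball 0 \<rho>" for z
  proof (cases "Im z = 0")
    case False
    then have "\<bar>F z / Im z\<bar> \<le> K" using assms(2)[OF that] by (simp add: divide_le_eq)
    then show ?thesis by simp
  qed simp
  moreover have [measurable]: "Im \<in> borel_measurable (restrict_space borel (ball 0 \<rho>))"
    by (rule measurable_restrict_space1) simp
  ultimately show ?thesis using assms(1) unfolding bounded_measurable_def by (blast intro: borel_measurable_divide)
qed

lemma bounded_measurable_cong:
  assumes "\<And>z. z \<in> ball 0 \<rho> \<Longrightarrow> F z = G z"
  shows "bounded_measurable \<rho> F \<longleftrightarrow> bounded_measurable \<rho> G"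
proof -
  have "F \<in> borel_measurable (restrict_space borel (ball 0 \<rho>)) \<longleftrightarrow>
    G \<in> borel_measurable (restrict_space borel (ball 0 \<rho>))"
    by (rule measurable_cong) (use assms in \<open>simp add: space_restrict_space\<close>)
  then show ?thesis using assms by (simp add: bounded_measurable_def)
qed

section \<open>The generalized Cauchy-Riemann system\<close>

text \<open>For \<open>f = a + i c\<close> with real \<open>a\<close> even and real \<open>c\<close> odd in \<open>y\<close>, this is the equation
  \<open>D\<^sub>z\<^sub>b\<^sub>a\<^sub>r f = 0\<close>, with \<open>ax\<close> and \<open>cx\<close> for the \<open>x\<close>-derivatives; equivalently, \<open>(a, - c)\<close> is the
  gradient of an axially symmetric harmonic function \<open>\<phi>\<close>. Derivatives are
  taken along coordinate lines, which is the form in which the divergence theorem uses them. The equations in \<open>y\<close> are stated off the axis,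
  where they make sense; the last clause controls \<open>c / y\<close> near the axis.\<close>
definition axial_pair ::
  "real \<Rightarrow> real \<Rightarrow> (complex \<Rightarrow> real) \<Rightarrow> (complex \<Rightarrow> real) \<Rightarrow> (complex \<Rightarrow> real) \<Rightarrow> (complex \<Rightarrow> real) \<Rightarrow> bool"
  where
  "axial_pair lam R a c ax cx \<longleftrightarrow>
     continuous_on (ball 0 R) a \<and> continuous_on (ball 0 R) c \<and>
     continuous_on (ball 0 R) ax \<and> continuous_on (ball 0 R) cx \<and>
     (\<forall>z\<in>ball 0 R.
        ((\<lambda>t. a (Complex t (Im z))) has_real_derivative ax z) (at (Re z)) \<and>
        ((\<lambda>t. c (Complex t (Im z))) has_real_derivative cx z) (at (Re z))) \<and>
     (\<forall>z\<in>ball 0 R. Im z \<noteq> 0 \<longrightarrow>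
        ((\<lambda>t. a (Complex (Re z) t)) has_real_derivative - cx z) (at (Im z)) \<and>
        ((\<lambda>t. c (Complex (Re z) t)) has_real_derivative ax z - 2 * lam * (c z / Im z)) (at (Im z))) \<and>
     (\<forall>z\<in>ball 0 R. Im z = 0 \<longrightarrow> c z = 0) \<and>
     (\<forall>r<R. \<exists>K. \<forall>z\<in>ball 0 r. \<bar>c z\<bar> \<le> K * \<bar>Im z\<bar>)"

lemma axial_pairD:
  assumes "axial_pair lam R a c ax cx"
  shows "continuous_on (ball 0 R) a" "continuous_on (ball 0 R) c"
    "continuous_on (ball 0 R) ax" "continuous_on (ball 0 R) cx"
    "\<And>z. norm z < R \<Longrightarrow> ((\<lambda>t. a (Complex t (Im z))) has_real_derivative ax z) (at (Re z))"
    "\<And>z. norm z < R \<Longrightarrow> ((\<lambda>t. c (Complex t (Im z))) has_real_derivative cx z) (at (Re z))"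
    "\<And>z. norm z < R \<Longrightarrow> Im z \<noteq> 0 \<Longrightarrow> ((\<lambda>t. a (Complex (Re z) t)) has_real_derivative - cx z) (at (Im z))"
    "\<And>z. norm z < R \<Longrightarrow> Im z \<noteq> 0 \<Longrightarrow>
       ((\<lambda>t. c (Complex (Re z) t)) has_real_derivative ax z - 2 * lam * (c z / Im z)) (at (Im z))"
    "\<And>z. norm z < R \<Longrightarrow> Im z = 0 \<Longrightarrow> c z = 0"
    "\<And>r. r < R \<Longrightarrow> \<exists>K. \<forall>z\<in>ball 0 r. \<bar>c z\<bar> \<le> K * \<bar>Im z\<bar>"
  using assms unfolding axial_pair_def by auto

definition disc_weight :: "real \<Rightarrow> complex \<Rightarrow> real" where
  "disc_weight \<rho> z = \<rho>\<^sup>2 - (Re z)\<^sup>2 - (Im z)\<^sup>2"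

definition energy :: "(complex \<Rightarrow> real) \<Rightarrow> (complex \<Rightarrow> real) \<Rightarrow> real \<Rightarrow> complex \<Rightarrow> real" where
  "energy a c \<epsilon> z = (a z)\<^sup>2 + (c z)\<^sup>2 + \<epsilon>"

text \<open>\<open>energy_x\<close> and \<open>energy_y\<close> are half the partial derivatives of the energy; in the second one the
  \<open>y\<close>-derivatives have been replaced by means of the system.\<close>
definition energy_x where
  "energy_x a c ax cx z = a z * ax z + c z * (cx z :: real)"

definition energy_y where
  "energy_y lam a c ax cx z = c z * (ax z - 2 * lam * (c z / Im z)) - a z * (cx z :: real)"

text \<open>The squared Hilbert-Schmidt norm of the Hessian of \<open>\<phi>\<close> in dimension \<open>2 \<lambda> + 2\<close>: the meridian plane
  contributes the first three terms, and each of the \<open>2 \<lambda>\<close> directions orthogonal to it has the eigenvalue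
  \<open>\<phi>\<^sub>y / y = - c / y\<close>.\<close>
definition hessian_sq where
  "hessian_sq lam c ax cx z =
     (ax z)\<^sup>2 + 2 * (cx z)\<^sup>2 + (ax z - 2 * lam * (c z / Im z))\<^sup>2 + 2 * lam * (c z / Im z :: real)\<^sup>2"

lemma disc_weight_eq: "disc_weight \<rho> z = \<rho>\<^sup>2 - (norm z)\<^sup>2"
  by (simp add: disc_weight_def cmod_power2)

lemma disc_weight_pos: "norm z < \<rho> \<Longrightarrow> 0 < disc_weight \<rho> z"
  unfolding disc_weight_eq by (simp add: power_strict_mono)

lemma disc_weight_nonneg: "norm z \<le> \<rho> \<Longrightarrow> 0 \<le> disc_weight \<rho> z"
  unfolding disc_weight_eq by (simp add: power_mono)

lemma disc_weight_sphere: "norm z = \<rho> \<Longrightarrow> disc_weight \<rho> z = 0"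
  unfolding disc_weight_eq by simp

lemma continuous_on_disc_weight [continuous_intros]: "continuous_on S (disc_weight \<rho>)"
  unfolding disc_weight_def[abs_def] by (intro continuous_intros)

lemma disc_weight_le_1: "0 \<le> \<rho> \<Longrightarrow> \<rho> \<le> 1 \<Longrightarrow> disc_weight \<rho> z \<le> 1"
  unfolding disc_weight_eq using power_mono[of \<rho> 1 2] zero_le_power2[of "norm z"]
  unfolding power_one by linarith

lemma disc_weight_x:
  "((\<lambda>t. disc_weight \<rho> (Complex t (Im z))) has_real_derivative - 2 * Re z) (at (Re z))"
  unfolding disc_weight_def by (auto intro!: derivative_eq_intros)

lemma disc_weight_y:
  "((\<lambda>t. disc_weight \<rho> (Complex (Re z) t)) has_real_derivative - 2 * Im z) (at (Im z))"
  unfolding disc_weight_def by (auto intro!: derivative_eq_intros)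

lemma energy_pos: "0 < \<epsilon> \<Longrightarrow> 0 < energy a c \<epsilon> z"
  unfolding energy_def by (simp add: add_nonneg_pos)

lemma energy_derivative_x:
  assumes "axial_pair lam R a c ax cx" "norm z < R"
  shows "((\<lambda>t. energy a c \<epsilon> (Complex t (Im z))) has_real_derivative 2 * energy_x a c ax cx z) (at (Re z))"
  unfolding energy_def energy_x_def
  by (auto intro!: derivative_eq_intros axial_pairD(5,6)[OF assms])

lemma energy_derivative_y:
  assumes "axial_pair lam R a c ax cx" "norm z < R" "Im z \<noteq> 0"
  shows "((\<lambda>t. energy a c \<epsilon> (Complex (Re z) t)) has_real_derivative 2 * energy_y lam a c ax cx z) (at (Im z))"
  unfolding energy_def energy_y_def
  by (auto intro!: derivative_eq_intros axial_pairD(7,8)[OF assms] simp: algebra_simps)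

lemma energy_x_derivative:
  assumes "axial_pair lam R a c ax cx" "axial_pair lam R ax cx axx cxx" "norm z < R"
  shows "((\<lambda>t. energy_x a c ax cx (Complex t (Im z))) has_real_derivative
     (ax z)\<^sup>2 + (cx z)\<^sup>2 + a z * axx z + c z * cxx z) (at (Re z))"
  unfolding energy_x_def
  by (auto intro!: derivative_eq_intros axial_pairD(5,6)[OF assms(1,3)] axial_pairD(5,6)[OF assms(2,3)]
      simp: power2_eq_square algebra_simps)

text \<open>The term \<open>- 2 \<lambda> energy_y / y\<close> is split off because it cancels in the weighted divergence. Together with
  \<open>energy_x_derivative\<close> the second derivatives of \<open>a\<close> and \<open>c\<close> cancel too, and the divergence of the
  half gradient is \<open>hessian_sq\<close>.\<close>
lemma energy_y_derivative:
  assumes "axial_pair lam R a c ax cx" "axial_pair lam R ax cx axx cxx" "norm z < R" "Im z \<noteq> 0"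
  shows "((\<lambda>t. energy_y lam a c ax cx (Complex (Re z) t)) has_real_derivative
     (ax z - 2 * lam * (c z / Im z))\<^sup>2 + (cx z)\<^sup>2 + 2 * lam * (c z / Im z)\<^sup>2 - c z * cxx z - a z * axx z
     - 2 * lam * (energy_y lam a c ax cx z / Im z)) (at (Im z))"
  unfolding energy_y_def using assms(4)
  by (auto intro!: derivative_eq_intros axial_pairD(7,8)[OF assms(1,3,4)] axial_pairD(7,8)[OF assms(2,3,4)]
      simp: field_simps power2_eq_square)

text \<open>For integral \<open>m\<close> the Hessian has trace \<open>0\<close> in dimension \<open>m + 2\<close>, with an \<open>m\<close>-fold eigenvalue \<open>- e\<close>. Given its
  eigenvalue \<open>\<mu>\<close> of largest modulus, the others have sum \<open>- \<mu>\<close> and therefore contribute at least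
  \<open>\<mu>\<^sup>2 / (m + 1)\<close> to the squared norm, so \<open>(m + 2) \<mu>\<^sup>2 \<le> (m + 1) H\<close>. The proof is an identity of
  polynomials: with \<open>\<beta>\<close> and \<open>\<gamma>\<close> the entries of the planar Hessian for the vector \<open>(a, - c)\<close> and
  its rotation, the difference of the two sides is a sum of squares after multiplication by \<open>a\<^sup>2 + c\<^sup>2\<close>.\<close>
lemma kato_inequality:
  fixes a c A C e m :: real
  assumes "m \<ge> 0"
  defines "D \<equiv> A - m * e"
  defines "H \<equiv> A\<^sup>2 + 2 * C\<^sup>2 + D\<^sup>2 + m * e\<^sup>2"
  shows "(2 + m) * ((a * A + c * C)\<^sup>2 + (c * D - a * C)\<^sup>2) \<le> (1 + m) * H * (a\<^sup>2 + c\<^sup>2)"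
proof -
  define \<beta> where "\<beta> = c * (a * A + c * C) + a * (c * D - a * C)"
  define \<gamma> where "\<gamma> = c\<^sup>2 * A - 2 * a * c * C - a\<^sup>2 * D"
  have "(a\<^sup>2 + c\<^sup>2) * ((1 + m) * H * (a\<^sup>2 + c\<^sup>2) - (2 + m) * ((a * A + c * C)\<^sup>2 + (c * D - a * C)\<^sup>2))
     = m * ((a\<^sup>2 + c\<^sup>2) * e + \<gamma>)\<^sup>2 + m * \<beta>\<^sup>2"
    unfolding \<beta>_def \<gamma>_def H_def D_def by algebra
  then have *: "0 \<le> (a\<^sup>2 + c\<^sup>2) * ((1 + m) * H * (a\<^sup>2 + c\<^sup>2) - (2 + m) * ((a * A + c * C)\<^sup>2 + (c * D - a * C)\<^sup>2))"
    using assms(1) by simp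
  show ?thesis
  proof (cases "a\<^sup>2 + c\<^sup>2 = 0")
    case True
    then show ?thesis by (simp add: sum_power2_eq_zero_iff)
  next
    case False
    then have "0 < a\<^sup>2 + c\<^sup>2" by (metis sum_power2_gt_zero_iff sum_power2_eq_zero_iff)
    then show ?thesis using * by (simp add: zero_le_mult_iff)
  qed
qed

text \<open>The factor is written as \<open>1 - \<delta>\<close> because the proofs below live on the margin \<open>\<delta>\<close>.\<close>
lemma energy_gradient_le:
  assumes "0 \<le> lam" "0 < \<epsilon>"
  shows "(energy_x a c ax cx z)\<^sup>2 + (energy_y lam a c ax cx z)\<^sup>2
     \<le> (1 - 1 / (2 + 2 * lam)) * hessian_sq lam c ax cx z * energy a c \<epsilon> z"
proof -
  let ?V = "(energy_x a c ax cx z)\<^sup>2 + (energy_y lam a c ax cx z)\<^sup>2"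
  let ?H = "hessian_sq lam c ax cx z"
  have "(2 + 2 * lam) * ?V \<le> (1 + 2 * lam) * ?H * ((a z)\<^sup>2 + (c z)\<^sup>2)"
    using kato_inequality[of "2 * lam" "a z" "ax z" "c z" "cx z" "c z / Im z"] assms(1)
    unfolding energy_x_def energy_y_def hessian_sq_def by simp
  also have "\<dots> \<le> (1 + 2 * lam) * ?H * energy a c \<epsilon> z"
    using assms by (intro mult_left_mono) (auto simp: energy_def hessian_sq_def)
  finally have *: "(2 + 2 * lam) * ?V \<le> (1 + 2 * lam) * ?H * energy a c \<epsilon> z" .
  have "?V = (2 + 2 * lam) * ?V / (2 + 2 * lam)" using assms by simp
  also have "\<dots> \<le> (1 + 2 * lam) * ?H * energy a c \<epsilon> z / (2 + 2 * lam)"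
    using * assms by (intro divide_right_mono) auto
  also have "\<dots> = (1 - 1 / (2 + 2 * lam)) * ?H * energy a c \<epsilon> z"
    using assms by (simp add: divide_simps)
  finally show ?thesis .
qed

lemma hessian_sq_nonneg: "0 \<le> lam \<Longrightarrow> 0 \<le> hessian_sq lam c ax cx z"
  unfolding hessian_sq_def by simp

lemma hessian_sq_ge: "0 \<le> lam \<Longrightarrow> (ax z)\<^sup>2 + (cx z)\<^sup>2 \<le> hessian_sq lam c ax cx z"
  unfolding hessian_sq_def by simp

lemma axial_pair_bounded_measurable:
  assumes "axial_pair lam R a c ax cx" "\<rho> < R"
  shows "bounded_measurable \<rho> a" "bounded_measurable \<rho> c" "bounded_measurable \<rho> ax" "bounded_measurable \<rho> cx"
    "bounded_measurable \<rho> (\<lambda>z. c z / Im z)"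
    "bounded_measurable \<rho> (energy_x a c ax cx)" "bounded_measurable \<rho> (energy_y lam a c ax cx)"
    "bounded_measurable \<rho> (hessian_sq lam c ax cx)"
proof -
  have sub: "cball 0 \<rho> \<subseteq> ball (0::complex) R" using assms by auto
  show *: "bounded_measurable \<rho> a" "bounded_measurable \<rho> c" "bounded_measurable \<rho> ax" "bounded_measurable \<rho> cx"
    by (intro bounded_measurable_continuous continuous_on_subset[OF _ sub] axial_pairD(1-4)[OF assms(1)])+
  obtain K where "\<forall>z\<in>ball 0 \<rho>. \<bar>c z\<bar> \<le> K * \<bar>Im z\<bar>" using axial_pairD(10)[OF assms] by auto
  with * show e: "bounded_measurable \<rho> (\<lambda>z. c z / Im z)"
    by (intro bounded_measurable_divide_Im) auto
  show "bounded_measurable \<rho> (energy_x a c ax cx)" "bounded_measurable \<rho> (energy_y lam a c ax cx)"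
    "bounded_measurable \<rho> (hessian_sq lam c ax cx)"
    unfolding energy_x_def[abs_def] energy_y_def[abs_def] hessian_sq_def[abs_def]
    by (intro bm_intros * e)+
qed

lemma axial_pair_continuous_cball:
  assumes "axial_pair lam R a c ax cx" "\<rho> < R"
  shows "continuous_on (cball 0 \<rho>) a" "continuous_on (cball 0 \<rho>) c"
    "continuous_on (cball 0 \<rho>) ax" "continuous_on (cball 0 \<rho>) cx"
    "continuous_on (cball 0 \<rho>) (energy a c \<epsilon>)"
    "continuous_on (cball 0 \<rho>) (energy_x a c ax cx)"
proof -
  have sub: "cball 0 \<rho> \<subseteq> ball (0::complex) R" using assms by auto
  show *: "continuous_on (cball 0 \<rho>) a" "continuous_on (cball 0 \<rho>) c"
    "continuous_on (cball 0 \<rho>) ax" "continuous_on (cball 0 \<rho>) cx"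
    by (intro continuous_on_subset[OF _ sub] axial_pairD(1-4)[OF assms(1)])+
  show "continuous_on (cball 0 \<rho>) (energy a c \<epsilon>)" "continuous_on (cball 0 \<rho>) (energy_x a c ax cx)"
    unfolding energy_def[abs_def] energy_x_def[abs_def] by (intro continuous_intros *)+
qed

text \<open>Only boundedness of \<open>c / y\<close> near the axis is known, but \<open>c (c / y)\<close> is bounded by a multiple of
  \<open>|c|\<close> and tends to \<open>0\<close> there.\<close>
lemma axial_pair_continuous_energy_y:
  assumes P: "axial_pair lam R a c ax cx" and "\<rho> < R"
  shows "continuous_on (cball 0 \<rho>) (energy_y lam a c ax cx)"
proof -
  obtain r where r: "\<rho> < r" "r < R" using dense[OF assms(2)] by auto
  obtain K where "\<forall>z\<in>ball 0 r. \<bar>c z\<bar> \<le> K * \<bar>Im z\<bar>" using axial_pairD(10)[OF P r(2)] by auto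
  then have K: "\<bar>c z\<bar> \<le> K * \<bar>Im z\<bar>" if "z \<in> ball 0 r" for z using that by blast
  have c: "continuous_on (ball 0 r) c"
    by (rule continuous_on_subset[OF axial_pairD(2)[OF P]]) (use r in auto)
  have "continuous_on (ball 0 r) (\<lambda>z. c z * (c z / Im z))"
  proof (clarsimp simp: continuous_on_eq_continuous_at)
    fix z :: complex assume z: "norm z < r"
    then have cz: "isCont c z" using c by (simp add: continuous_on_eq_continuous_at)
    show "isCont (\<lambda>z. c z * c z / Im z) z"
    proof (cases "Im z = 0")
      case False
      moreover have "isCont Im z" using continuous_on_Im[OF continuous_on_id, of UNIV]
        by (auto simp: continuous_on_eq_continuous_at id_def)
      ultimately show ?thesis by (intro continuous_intros cz)
    next
      case True
      then have c0: "c z = 0" using axial_pairD(9)[OF P, of z] z r by auto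
      have "(\<lambda>x. c x * c x / Im x) \<midarrow>z\<rightarrow> 0"
      proof (rule tendsto_rabs_zero_cancel, rule tendsto_sandwich[of "\<lambda>_. 0" _ _ "\<lambda>x. \<bar>K\<bar> * \<bar>c x\<bar>"])
        have "eventually (\<lambda>x. x \<in> ball 0 r) (at z)"
          by (rule eventually_at_in_open') (use z in auto)
        then show "eventually (\<lambda>x. \<bar>c x * c x / Im x\<bar> \<le> \<bar>K\<bar> * \<bar>c x\<bar>) (at z)"
        proof eventually_elim
          case (elim x)
          show ?case
          proof (cases "Im x = 0")
            case False
            have "\<bar>c x\<bar> * \<bar>c x\<bar> \<le> (K * \<bar>Im x\<bar>) * \<bar>c x\<bar>" by (intro mult_right_mono K elim) simp
            then have "\<bar>c x * c x / Im x\<bar> \<le> K * \<bar>c x\<bar>"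
              using False by (simp add: abs_mult divide_le_eq mult_ac)
            also have "\<dots> \<le> \<bar>K\<bar> * \<bar>c x\<bar>" by (intro mult_right_mono) auto
            finally show ?thesis .
          qed simp
        qed
        show "(\<lambda>x. \<bar>K\<bar> * \<bar>c x\<bar>) \<midarrow>z\<rightarrow> 0"
          using cz c0 by (auto simp: isCont_def intro!: tendsto_mult_right_zero tendsto_rabs_zero)
      qed auto
      then show ?thesis using c0 by (simp add: isCont_def)
    qed
  qed
  then have "continuous_on (cball 0 \<rho>) (\<lambda>z. c z * (c z / Im z))"
    by (rule continuous_on_subset) (use r in auto)
  note cc = continuous_on_mult[OF continuous_on_const this]
  note * = axial_pair_continuous_cball[OF assms]
  have "continuous_on (cball 0 \<rho>) (\<lambda>z. c z * ax z - 2 * lam * (c z * (c z / Im z)) - a z * cx z)"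
    by (rule continuous_on_diff[OF continuous_on_diff[OF continuous_on_mult[OF *(2,3)] cc]
          continuous_on_mult[OF *(1,4)]])
  also have "(\<lambda>z. c z * ax z - 2 * lam * (c z * (c z / Im z)) - a z * cx z) = energy_y lam a c ax cx"
    by (auto simp: energy_y_def fun_eq_iff algebra_simps)
  finally show ?thesis .
qed

text \<open>For \<open>k = 0\<close> the power is \<open>1\<close> inside the disc but \<open>0\<close> on its boundary, so continuity on the closed disc
  cannot be used.\<close>
lemma bounded_measurable_weight_powr:
  assumes "0 \<le> k"
  shows "bounded_measurable \<rho> (\<lambda>z. disc_weight \<rho> z powr k)"
proof (cases "k = 0")
  case True
  have "bounded_measurable \<rho> (\<lambda>z. disc_weight \<rho> z powr k) \<longleftrightarrow> bounded_measurable \<rho> (\<lambda>z. 1)"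
    by (rule bounded_measurable_cong) (use True disc_weight_pos in fastforce)
  then show ?thesis by (simp add: bm_intros)
next
  case False
  then show ?thesis
    using assms disc_weight_nonneg
    by (intro bounded_measurable_continuous continuous_on_powr' continuous_intros) auto
qed

lemma bounded_measurable_energy_powr:
  assumes "axial_pair lam R a c ax cx" "\<rho> < R" "0 < \<epsilon>"
  shows "bounded_measurable \<rho> (\<lambda>z. energy a c \<epsilon> z powr q)"
  using energy_pos[OF assms(3)]
  by (intro bounded_measurable_continuous continuous_on_powr continuous_intros axial_pair_continuous_cball[OF assms(1,2)])
    (auto simp: less_imp_neq[symmetric])

lemma bounded_measurable_Re_Im [bm_intros]: "bounded_measurable \<rho> Re" "bounded_measurable \<rho> Im"
  by (intro bounded_measurable_continuous continuous_intros)+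

section \<open>The energy identity and the Caccioppoli inequality\<close>

text \<open>\<open>Z\<close> is the weighted divergence of the field \<open>(0, Q)\<close>. Requiring boundedness of \<open>Z\<close> rather than of
  its two summands lets their singularities at the axis cancel first.\<close>
lemma divergence_theorem_disc:
  assumes "0 < \<rho>" "0 \<le> lam"
    and "continuous_on (cball 0 \<rho>) P" "continuous_on (cball 0 \<rho>) Q"
    and "\<And>z. norm z = \<rho> \<Longrightarrow> P z = 0 \<and> Q z = 0"
    and "\<And>z. norm z < \<rho> \<Longrightarrow> Im z = 0 \<Longrightarrow> Q z = 0"
    and "\<And>z. norm z < \<rho> \<Longrightarrow> Im z \<noteq> 0 \<Longrightarrow>
           ((\<lambda>t. P (Complex t (Im z))) has_real_derivative Px z) (at (Re z))"
    and Qy: "\<And>z. norm z < \<rho> \<Longrightarrow> Im z \<noteq> 0 \<Longrightarrow>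
           ((\<lambda>t. Q (Complex (Re z) t)) has_real_derivative Z z - 2 * lam * (Q z / Im z)) (at (Im z))"
    and "bounded_measurable \<rho> Px" "bounded_measurable \<rho> Z"
  shows "(LINT z|axial_measure lam \<rho>. Px z + Z z) = 0"
proof -
  note int = bounded_measurable_integrable[OF assms(2)]
  have "(LINT z|axial_measure lam \<rho>. Px z) = 0"
    by (rule integral_x_derivative_eq_zero[where P=P]) (use assms int in auto)
  moreover have "(LINT z|axial_measure lam \<rho>. Z z) = 0"
    using integral_y_divergence_eq_zero[of \<rho> lam Q "\<lambda>z. Z z - 2 * lam * (Q z / Im z)"] assms int by simp
  ultimately show ?thesis using int assms(9,10) by simp
qed

text \<open>Test the equation \<open>div (V\<^sub>1, V\<^sub>2) = H\<close> with \<open>w\<^sup>k s\<^sup>q\<^sup>-\<^sup>1\<close>. The gradient of \<open>w\<close> is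
  \<open>- 2 (x, y)\<close>, and that of \<open>s\<close> is \<open>2 (V\<^sub>1, V\<^sub>2)\<close>.\<close>
lemma energy_identity:
  assumes P1: "axial_pair lam R a c ax cx" and P2: "axial_pair lam R ax cx axx cxx"
    and \<rho>: "0 < \<rho>" "\<rho> < R" and lam: "0 \<le> lam" and \<epsilon>: "0 < \<epsilon>" and k: "1 \<le> k"
  defines "s \<equiv> energy a c \<epsilon>" and "w \<equiv> disc_weight \<rho>"
    and "V\<^sub>1 \<equiv> energy_x a c ax cx" and "V\<^sub>2 \<equiv> energy_y lam a c ax cx" and "H \<equiv> hessian_sq lam c ax cx"
  shows "(LINT z|axial_measure lam \<rho>.
      w z powr k * s z powr (q - 1) * H z
      - 2 * k * w z powr (k - 1) * s z powr (q - 1) * (Re z * V\<^sub>1 z + Im z * V\<^sub>2 z)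
      + 2 * (q - 1) * w z powr k * s z powr (q - 2) * ((V\<^sub>1 z)\<^sup>2 + (V\<^sub>2 z)\<^sup>2)) = 0"
proof -
  note bm = axial_pair_bounded_measurable[OF P1 \<rho>(2)] axial_pair_bounded_measurable[OF P2 \<rho>(2)]
    bounded_measurable_weight_powr bounded_measurable_energy_powr[OF P1 \<rho>(2) \<epsilon>]
  have w0: "0 < w z" if "norm z < \<rho>" for z unfolding w_def using that by (rule disc_weight_pos)
  have s0: "0 < s z" for z unfolding s_def using \<epsilon> by (rule energy_pos)
  define P where "P = (\<lambda>z. w z powr k * (s z powr (q - 1) * V\<^sub>1 z))"
  define Q where "Q = (\<lambda>z. w z powr k * (s z powr (q - 1) * V\<^sub>2 z))"
  define Px where "Px = (\<lambda>z. w z powr k * (s z powr (q - 1) * ((ax z)\<^sup>2 + (cx z)\<^sup>2 + a z * axx z + c z * cxx z))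
      - 2 * k * (w z powr (k - 1) * (s z powr (q - 1) * (Re z * V\<^sub>1 z)))
      + 2 * (q - 1) * (w z powr k * (s z powr (q - 2) * (V\<^sub>1 z)\<^sup>2)))"
  define Z where "Z = (\<lambda>z. w z powr k * (s z powr (q - 1) *
       ((ax z - 2 * lam * (c z / Im z))\<^sup>2 + (cx z)\<^sup>2 + 2 * lam * (c z / Im z)\<^sup>2 - c z * cxx z - a z * axx z))
      - 2 * k * (w z powr (k - 1) * (s z powr (q - 1) * (Im z * V\<^sub>2 z)))
      + 2 * (q - 1) * (w z powr k * (s z powr (q - 2) * (V\<^sub>2 z)\<^sup>2)))"
  have "(LINT z|axial_measure lam \<rho>. Px z + Z z) = 0"
  proof (rule divergence_theorem_disc[where P=P and Q=Q])
    have cw: "continuous_on (cball 0 \<rho>) (\<lambda>z. w z powr k)"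
      using k disc_weight_nonneg unfolding w_def by (intro continuous_on_powr' continuous_intros) auto
    have cs: "continuous_on (cball 0 \<rho>) (\<lambda>z. s z powr (q - 1))"
      unfolding s_def using energy_pos[OF \<epsilon>]
      by (intro continuous_on_powr continuous_intros axial_pair_continuous_cball[OF P1 \<rho>(2)])
        (auto simp: less_imp_neq[symmetric])
    show "continuous_on (cball 0 \<rho>) P" unfolding P_def V\<^sub>1_def
      by (intro continuous_on_mult cw cs axial_pair_continuous_cball[OF P1 \<rho>(2)])
    show "continuous_on (cball 0 \<rho>) Q" unfolding Q_def V\<^sub>2_def
      by (intro continuous_on_mult cw cs axial_pair_continuous_energy_y[OF P1 \<rho>(2)])
    show "P z = 0 \<and> Q z = 0" if "norm z = \<rho>" for z
      using k disc_weight_sphere[OF that] by (simp add: P_def Q_def w_def)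
    show "Q z = 0" if "norm z < \<rho>" "Im z = 0" for z
      using axial_pairD(9)[OF P1, of z] axial_pairD(9)[OF P2, of z] that \<rho>
      by (simp add: Q_def V\<^sub>2_def energy_y_def)
    show "bounded_measurable \<rho> Px" unfolding Px_def s_def w_def V\<^sub>1_def
      by (intro bm_intros bm) (use k in auto)
    show "bounded_measurable \<rho> Z" unfolding Z_def s_def w_def V\<^sub>2_def
      by (intro bm_intros bm) (use k in auto)
    fix z :: complex assume z: "norm z < \<rho>" and y: "Im z \<noteq> 0"
    have zR: "norm z < R" using z \<rho> by simp
    have s2: "s z powr (q - 1 - 1) = s z powr (q - 2)" by (simp add: diff_diff_eq)
    have d: "((\<lambda>t. w (Complex t (Im z)) powr k) has_real_derivative
         k * w z powr (k - 1) * (- 2 * Re z)) (at (Re z))"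
      using DERIV_fun_powr[OF disc_weight_x, of \<rho> z k] w0[OF z] by (simp add: w_def)
    have e: "((\<lambda>t. s (Complex t (Im z)) powr (q - 1)) has_real_derivative
         (q - 1) * s z powr (q - 1 - 1) * (2 * V\<^sub>1 z)) (at (Re z))"
      using DERIV_fun_powr[OF energy_derivative_x[OF P1 zR], of \<epsilon> "q - 1"] s0[of z] by (simp add: s_def V\<^sub>1_def)
    have "(P \<circ> (\<lambda>t. Complex t (Im z)) has_real_derivative Px z) (at (Re z))"
      unfolding P_def Px_def o_def V\<^sub>1_def
      by (rule DERIV_cong[OF DERIV_mult[OF d DERIV_mult[OF e energy_x_derivative[OF P1 P2 zR]]]])
        (simp add: s2 V\<^sub>1_def algebra_simps power2_eq_square)
    then show "((\<lambda>t. P (Complex t (Im z))) has_real_derivative Px z) (at (Re z))" by (simp add: o_def)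
    have d: "((\<lambda>t. w (Complex (Re z) t) powr k) has_real_derivative
         k * w z powr (k - 1) * (- 2 * Im z)) (at (Im z))"
      using DERIV_fun_powr[OF disc_weight_y, of \<rho> z k] w0[OF z] by (simp add: w_def)
    have e: "((\<lambda>t. s (Complex (Re z) t) powr (q - 1)) has_real_derivative
         (q - 1) * s z powr (q - 1 - 1) * (2 * V\<^sub>2 z)) (at (Im z))"
      using DERIV_fun_powr[OF energy_derivative_y[OF P1 zR y], of \<epsilon> "q - 1"] s0[of z] by (simp add: s_def V\<^sub>2_def)
    show "((\<lambda>t. Q (Complex (Re z) t)) has_real_derivative Z z - 2 * lam * (Q z / Im z)) (at (Im z))"
      unfolding Q_def Z_def V\<^sub>2_def
      by (rule DERIV_cong[OF DERIV_mult[OF d DERIV_mult[OF e energy_y_derivative[OF P1 P2 zR y]]]])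
        (simp add: s2 V\<^sub>2_def algebra_simps power2_eq_square)
  qed (use \<rho> lam in auto)
  moreover have "Px z + Z z = w z powr k * s z powr (q - 1) * H z
      - 2 * k * w z powr (k - 1) * s z powr (q - 1) * (Re z * V\<^sub>1 z + Im z * V\<^sub>2 z)
      + 2 * (q - 1) * w z powr k * s z powr (q - 2) * ((V\<^sub>1 z)\<^sup>2 + (V\<^sub>2 z)\<^sup>2)" for z
    unfolding Px_def Z_def H_def hessian_sq_def by (simp add: algebra_simps)
  ultimately show ?thesis by simp
qed

text \<open>The integrand of \<open>energy_identity\<close> after division by \<open>w\<^sup>k\<^sup>-\<^sup>2 s\<^sup>q\<^sup>-\<^sup>1\<close>. As \<open>2 (q - 1) \<ge> - 1\<close>, the
  last term costs at most \<open>(1 - \<delta>) w\<^sup>2 H\<close>; half of the remaining \<open>\<delta> w\<^sup>2 H\<close> pays for the cross term.\<close>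
lemma caccioppoli_pointwise:
  fixes w s H v\<^sub>1 v\<^sub>2 x y k q \<delta> :: real
  assumes "0 \<le> w" "0 < s" "0 \<le> H" "0 < \<delta>" "x\<^sup>2 + y\<^sup>2 \<le> 1" "1 / 2 \<le> q" "0 \<le> k"
    and grad: "v\<^sub>1\<^sup>2 + v\<^sub>2\<^sup>2 \<le> (1 - \<delta>) * H * s"
  shows "\<delta> / 2 * w\<^sup>2 * H - 2 * k\<^sup>2 / \<delta> * s
      \<le> w\<^sup>2 * H - 2 * k * w * (x * v\<^sub>1 + y * v\<^sub>2) + 2 * (q - 1) * w\<^sup>2 * (v\<^sub>1\<^sup>2 + v\<^sub>2\<^sup>2) / s"
proof -
  define G where "G = (v\<^sub>1\<^sup>2 + v\<^sub>2\<^sup>2) / s"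
  have G: "0 \<le> G" "G \<le> (1 - \<delta>) * H"
    using assms by (auto simp: G_def divide_le_eq)
  have GH: "G \<le> H" using G(2) assms(3,4) by (simp add: left_diff_distrib) (smt (verit) mult_nonneg_nonneg)
  \<comment> \<open>Completing squares with this scaling gives the cross term the coefficient \<open>\<delta> / 2\<close> below.\<close>
  have "2 * (w * v\<^sub>1) * (2 * k * s * x / \<delta>) \<le> (w * v\<^sub>1)\<^sup>2 + (2 * k * s * x / \<delta>)\<^sup>2"
    "2 * (w * v\<^sub>2) * (2 * k * s * y / \<delta>) \<le> (w * v\<^sub>2)\<^sup>2 + (2 * k * s * y / \<delta>)\<^sup>2"
    by (rule sum_squares_bound)+
  then have "2 * w * (2 * k * s / \<delta>) * (x * v\<^sub>1 + y * v\<^sub>2)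
      \<le> w\<^sup>2 * (v\<^sub>1\<^sup>2 + v\<^sub>2\<^sup>2) + (2 * k * s / \<delta>)\<^sup>2 * (x\<^sup>2 + y\<^sup>2)"
    by (simp add: algebra_simps power_mult_distrib power_divide add_divide_distrib)
  also have "\<dots> \<le> w\<^sup>2 * (v\<^sub>1\<^sup>2 + v\<^sub>2\<^sup>2) + (2 * k * s / \<delta>)\<^sup>2 * 1"
    by (intro add_left_mono mult_left_mono assms) auto
  finally have "(\<delta> / (2 * s)) * (2 * w * (2 * k * s / \<delta>) * (x * v\<^sub>1 + y * v\<^sub>2))
     \<le> (\<delta> / (2 * s)) * (w\<^sup>2 * (v\<^sub>1\<^sup>2 + v\<^sub>2\<^sup>2) + (2 * k * s / \<delta>)\<^sup>2)"
    using assms by (intro mult_left_mono) auto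
  moreover have "(\<delta> / (2 * s)) * (2 * w * (2 * k * s / \<delta>) * (x * v\<^sub>1 + y * v\<^sub>2)) = 2 * k * w * (x * v\<^sub>1 + y * v\<^sub>2)"
    using assms by (simp add: field_simps)
  moreover have "(\<delta> / (2 * s)) * (w\<^sup>2 * (v\<^sub>1\<^sup>2 + v\<^sub>2\<^sup>2) + (2 * k * s / \<delta>)\<^sup>2) = \<delta> / 2 * w\<^sup>2 * G + 2 * k\<^sup>2 / \<delta> * s"
    using assms by (simp add: G_def field_simps power2_eq_square)
  ultimately have 1: "2 * k * w * (x * v\<^sub>1 + y * v\<^sub>2) \<le> \<delta> / 2 * w\<^sup>2 * G + 2 * k\<^sup>2 / \<delta> * s" by simp
  have 2: "\<delta> / 2 * w\<^sup>2 * G \<le> \<delta> / 2 * w\<^sup>2 * H" using GH assms by (intro mult_left_mono) auto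
  have "- (w\<^sup>2 * G) \<le> 2 * (q - 1) * (w\<^sup>2 * G)"
    using mult_right_mono[of "-1" "2 * (q - 1)" "w\<^sup>2 * G"] assms G by simp
  moreover have "w\<^sup>2 * G \<le> w\<^sup>2 * ((1 - \<delta>) * H)" using G by (intro mult_left_mono) auto
  ultimately have 3: "- (w\<^sup>2 * ((1 - \<delta>) * H)) \<le> 2 * (q - 1) * w\<^sup>2 * (v\<^sub>1\<^sup>2 + v\<^sub>2\<^sup>2) / s"
    by (simp add: G_def mult.assoc)
  have "\<delta> / 2 * w\<^sup>2 * H - 2 * k\<^sup>2 / \<delta> * s =
     w\<^sup>2 * H - (\<delta> / 2 * w\<^sup>2 * H + 2 * k\<^sup>2 / \<delta> * s) - w\<^sup>2 * ((1 - \<delta>) * H)"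
    by (simp add: field_simps)
  then show ?thesis using 1 2 3 by linarith
qed

text \<open>Integrates \<open>caccioppoli_pointwise\<close>. Each derivative costs one factor \<open>w\<close>, as it does for
  \<open>(1 - |z|\<^sup>2) \<partial>\<^sub>x f\<close> in the theorem; larger \<open>k\<close> allow weighted functions on the right.\<close>
lemma caccioppoli:
  assumes P1: "axial_pair lam R a c ax cx" and P2: "axial_pair lam R ax cx axx cxx"
    and \<rho>: "0 < \<rho>" "\<rho> < R" "\<rho> \<le> 1" and lam: "0 \<le> lam" and \<epsilon>: "0 < \<epsilon>" and k: "2 \<le> k" and q: "1 / 2 \<le> q"
  defines "s \<equiv> energy a c \<epsilon>" and "w \<equiv> disc_weight \<rho>" and "H \<equiv> hessian_sq lam c ax cx"
  shows "(LINT z|axial_measure lam \<rho>. w z powr k * s z powr (q - 1) * H z)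
     \<le> 4 * k\<^sup>2 * (2 + 2 * lam)\<^sup>2 * (LINT z|axial_measure lam \<rho>. w z powr (k - 2) * s z powr q)"
proof -
  define \<delta> where "\<delta> = 1 / (2 + 2 * lam)"
  have \<delta>: "0 < \<delta>" using lam by (simp add: \<delta>_def)
  let ?M = "axial_measure lam \<rho>"
  let ?V1 = "energy_x a c ax cx" and ?V2 = "energy_y lam a c ax cx"
  let ?T = "\<lambda>z. w z powr k * s z powr (q - 1) * H z"
  let ?S = "\<lambda>z. w z powr (k - 2) * s z powr q"
  let ?I = "\<lambda>z. ?T z - 2 * k * w z powr (k - 1) * s z powr (q - 1) * (Re z * ?V1 z + Im z * ?V2 z)
      + 2 * (q - 1) * w z powr k * s z powr (q - 2) * ((?V1 z)\<^sup>2 + (?V2 z)\<^sup>2)"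
  note bm = axial_pair_bounded_measurable[OF P1 \<rho>(2)]
    bounded_measurable_weight_powr bounded_measurable_energy_powr[OF P1 \<rho>(2) \<epsilon>]
  note int = bounded_measurable_integrable[OF lam]
  have iT: "integrable ?M ?T" and iS: "integrable ?M ?S" and iI: "integrable ?M ?I"
    unfolding w_def s_def H_def by (rule int, (intro bm_intros bm; use k in simp))+
  have "(LINT z|?M. \<delta> / 2 * ?T z - 2 * k\<^sup>2 / \<delta> * ?S z) \<le> (LINT z|?M. ?I z)"
  proof (rule integral_mono)
    fix z assume "z \<in> space ?M"
    then have z: "norm z < \<rho>" by simp
    have w0: "0 < w z" unfolding w_def using z by (rule disc_weight_pos)
    have s0: "0 < s z" unfolding s_def using \<epsilon> by (rule energy_pos)
    have xy: "(Re z)\<^sup>2 + (Im z)\<^sup>2 \<le> 1"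
      using z \<rho> power_mono[of "norm z" 1 2] by (simp add: cmod_power2[symmetric])
    have "\<delta> / 2 * (w z)\<^sup>2 * H z - 2 * k\<^sup>2 / \<delta> * s z
      \<le> (w z)\<^sup>2 * H z - 2 * k * w z * (Re z * ?V1 z + Im z * ?V2 z) + 2 * (q - 1) * (w z)\<^sup>2 * ((?V1 z)\<^sup>2 + (?V2 z)\<^sup>2) / s z"
      using energy_gradient_le[OF lam \<epsilon>, of a c ax cx z] hessian_sq_nonneg[OF lam, of c ax cx z] w0 s0 k q \<delta> xy
      by (intro caccioppoli_pointwise) (auto simp: s_def H_def \<delta>_def)
    then have le: "(w z powr (k - 2) * s z powr (q - 1)) * (\<delta> / 2 * (w z)\<^sup>2 * H z - 2 * k\<^sup>2 / \<delta> * s z)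
      \<le> (w z powr (k - 2) * s z powr (q - 1)) * ((w z)\<^sup>2 * H z - 2 * k * w z * (Re z * ?V1 z + Im z * ?V2 z)
         + 2 * (q - 1) * (w z)\<^sup>2 * ((?V1 z)\<^sup>2 + (?V2 z)\<^sup>2) / s z)"
      by (intro mult_left_mono) auto
    have e: "w z powr k = w z powr (k - 2) * (w z)\<^sup>2" "w z powr (k - 1) = w z powr (k - 2) * w z"
      "s z powr q = s z powr (q - 1) * s z" "s z powr (q - 2) = s z powr (q - 1) / s z"
      using w0 s0 powr_add[of "w z" "k - 2" 2] powr_add[of "w z" "k - 2" 1] powr_add[of "s z" "q - 1" 1]
        powr_diff[of "s z" "q - 1" 1] by auto
    have "\<delta> / 2 * ?T z - 2 * k\<^sup>2 / \<delta> * ?S z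
       = (w z powr (k - 2) * s z powr (q - 1)) * (\<delta> / 2 * (w z)\<^sup>2 * H z - 2 * k\<^sup>2 / \<delta> * s z)"
      unfolding e by (simp add: algebra_simps)
    moreover have "?I z = (w z powr (k - 2) * s z powr (q - 1)) * ((w z)\<^sup>2 * H z
         - 2 * k * w z * (Re z * ?V1 z + Im z * ?V2 z) + 2 * (q - 1) * (w z)\<^sup>2 * ((?V1 z)\<^sup>2 + (?V2 z)\<^sup>2) / s z)"
      unfolding e by (simp add: algebra_simps add_divide_distrib diff_divide_distrib)
    ultimately show "\<delta> / 2 * ?T z - 2 * k\<^sup>2 / \<delta> * ?S z \<le> ?I z"
      using le by linarith
  qed (use iT iS iI in auto)
  also have "\<dots> = 0"
    using energy_identity[OF P1 P2 \<rho>(1,2) lam \<epsilon>, of k q] k unfolding w_def s_def H_def by simp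
  finally have "\<delta> / 2 * (LINT z|?M. ?T z) \<le> 2 * k\<^sup>2 / \<delta> * (LINT z|?M. ?S z)"
    using iT iS by simp
  then have "(2 / \<delta>) * (\<delta> / 2 * (LINT z|?M. ?T z)) \<le> (2 / \<delta>) * (2 * k\<^sup>2 / \<delta> * (LINT z|?M. ?S z))"
    using \<delta> by (intro mult_left_mono) auto
  moreover have "(2 / \<delta>) * (\<delta> / 2 * X) = X" "(2 / \<delta>) * (2 * k\<^sup>2 / \<delta> * X) = 4 * k\<^sup>2 * (1 / \<delta>)\<^sup>2 * X" for X
    using \<delta> by (simp_all add: power2_eq_square)
  moreover have "1 / \<delta> = 2 + 2 * lam" by (simp add: \<delta>_def)
  ultimately show ?thesis by metis
qed

section \<open>The radial derivative bounds the function\<close>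

text \<open>\<open>euler_re\<close> and \<open>euler_im\<close> are the components of \<open>(r \<partial>\<^sub>r + 1 + \<lambda>) (a + i c)\<close>, with the
  \<open>y\<close>-derivatives replaced by means of the system; this removes the quotient \<open>c / y\<close>.\<close>
definition euler_re where
  "euler_re lam a ax cx z = Re z * ax z - Im z * cx z + (1 + lam) * (a z :: real)"

definition euler_im where
  "euler_im lam c ax cx z = Re z * cx z + Im z * ax z + (1 - lam) * (c z :: real)"

lemma radial_derivative_energy:
  assumes "axial_pair lam R a c ax cx" "norm z < R"
  shows "Re z * energy_x a c ax cx z + Im z * energy_y lam a c ax cx z
    = a z * euler_re lam a ax cx z + c z * euler_im lam c ax cx z - (1 + lam) * ((a z)\<^sup>2 + (c z)\<^sup>2)"
proof (cases "Im z = 0")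
  case True
  then show ?thesis using axial_pairD(9)[OF assms]
    by (simp add: energy_x_def energy_y_def euler_re_def euler_im_def algebra_simps power2_eq_square)
next
  case False
  then show ?thesis
    by (simp add: energy_x_def energy_y_def euler_re_def euler_im_def field_simps power2_eq_square)
qed

text \<open>The divergence theorem for the field \<open>w s\<^sup>q (x, y)\<close>; the field \<open>(x, y)\<close> has the weighted divergence
  \<open>2 + 2 \<lambda>\<close>, and \<open>|z|\<^sup>2 = \<rho>\<^sup>2 - w\<close>.\<close>
lemma radial_identity:
  assumes P1: "axial_pair lam R a c ax cx"
    and \<rho>: "0 < \<rho>" "\<rho> < R" and lam: "0 \<le> lam" and \<epsilon>: "0 < \<epsilon>"
  defines "s \<equiv> energy a c \<epsilon>" and "w \<equiv> disc_weight \<rho>"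
    and "V\<^sub>1 \<equiv> energy_x a c ax cx" and "V\<^sub>2 \<equiv> energy_y lam a c ax cx"
  shows "(LINT z|axial_measure lam \<rho>. s z powr q * ((4 + 2 * lam) * w z - 2 * \<rho>\<^sup>2)
      + 2 * q * (w z * s z powr (q - 1) * (Re z * V\<^sub>1 z + Im z * V\<^sub>2 z))) = 0"
proof -
  note bm = axial_pair_bounded_measurable[OF P1 \<rho>(2)]
    bounded_measurable_continuous[OF continuous_on_disc_weight] bounded_measurable_energy_powr[OF P1 \<rho>(2) \<epsilon>]
  have s0: "0 < s z" for z unfolding s_def using \<epsilon> by (rule energy_pos)
  define P where "P = (\<lambda>z. w z * (Re z * s z powr q))"
  define Q where "Q = (\<lambda>z. w z * (Im z * s z powr q))"
  define Px where "Px = (\<lambda>z. s z powr q * (w z - 2 * (Re z)\<^sup>2) + 2 * q * (w z * (s z powr (q - 1) * (Re z * V\<^sub>1 z))))"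
  define Z where "Z = (\<lambda>z. s z powr q * ((1 + 2 * lam) * w z - 2 * (Im z)\<^sup>2) + 2 * q * (w z * (s z powr (q - 1) * (Im z * V\<^sub>2 z))))"
  have "(LINT z|axial_measure lam \<rho>. Px z + Z z) = 0"
  proof (rule divergence_theorem_disc[where P=P and Q=Q])
    have cs: "continuous_on (cball 0 \<rho>) (\<lambda>z. s z powr q)"
      unfolding s_def using energy_pos[OF \<epsilon>]
      by (intro continuous_on_powr continuous_intros axial_pair_continuous_cball[OF P1 \<rho>(2)])
        (auto simp: less_imp_neq[symmetric])
    show "continuous_on (cball 0 \<rho>) P" "continuous_on (cball 0 \<rho>) Q" unfolding P_def Q_def w_def
      by (intro continuous_on_mult cs continuous_intros)+
    show "P z = 0 \<and> Q z = 0" if "norm z = \<rho>" for z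
      using disc_weight_sphere[OF that] by (simp add: P_def Q_def w_def)
    show "Q z = 0" if "norm z < \<rho>" "Im z = 0" for z using that by (simp add: Q_def)
    show "bounded_measurable \<rho> Px" unfolding Px_def s_def w_def V\<^sub>1_def
      by (intro bm_intros bm)
    show "bounded_measurable \<rho> Z" unfolding Z_def s_def w_def V\<^sub>2_def
      by (intro bm_intros bm)
    fix z :: complex assume z: "norm z < \<rho>" and y: "Im z \<noteq> 0"
    have zR: "norm z < R" using z \<rho> by simp
    have d: "((\<lambda>t. w (Complex t (Im z))) has_real_derivative (- 2 * Re z)) (at (Re z))"
      using disc_weight_x by (simp add: w_def)
    have i: "((\<lambda>t. Re (Complex t (Im z))) has_real_derivative 1) (at (Re z))"
      by simp
    have e: "((\<lambda>t. s (Complex t (Im z)) powr q) has_real_derivative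
         q * s z powr (q - 1) * (2 * V\<^sub>1 z)) (at (Re z))"
      using DERIV_fun_powr[OF energy_derivative_x[OF P1 zR], of \<epsilon> q] s0[of z] by (simp add: s_def V\<^sub>1_def)
    show "((\<lambda>t. P (Complex t (Im z))) has_real_derivative Px z) (at (Re z))"
      unfolding P_def Px_def
      by (rule DERIV_cong[OF DERIV_mult[OF d DERIV_mult[OF i e]]])
        (simp add: algebra_simps power2_eq_square)
    have d: "((\<lambda>t. w (Complex (Re z) t)) has_real_derivative (- 2 * Im z)) (at (Im z))"
      using disc_weight_y by (simp add: w_def)
    have i: "((\<lambda>t. Im (Complex (Re z) t)) has_real_derivative 1) (at (Im z))"
      by simp
    have e: "((\<lambda>t. s (Complex (Re z) t) powr q) has_real_derivative
         q * s z powr (q - 1) * (2 * V\<^sub>2 z)) (at (Im z))"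
      using DERIV_fun_powr[OF energy_derivative_y[OF P1 zR y], of \<epsilon> q] s0[of z] by (simp add: s_def V\<^sub>2_def)
    show "((\<lambda>t. Q (Complex (Re z) t)) has_real_derivative Z z - 2 * lam * (Q z / Im z)) (at (Im z))"
      unfolding Q_def Z_def using y
      by (intro DERIV_cong[OF DERIV_mult[OF d DERIV_mult[OF i e]]])
        (simp add: algebra_simps power2_eq_square)
  qed (use \<rho> lam in auto)
  moreover have "Px z + Z z = s z powr q * ((4 + 2 * lam) * w z - 2 * \<rho>\<^sup>2)
      + 2 * q * (w z * s z powr (q - 1) * (Re z * V\<^sub>1 z + Im z * V\<^sub>2 z))" for z
  proof -
    have r: "\<rho>\<^sup>2 = w z + (Re z)\<^sup>2 + (Im z)\<^sup>2" by (simp add: w_def disc_weight_def)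
    show ?thesis unfolding Px_def Z_def r by (simp add: algebra_simps)
  qed
  ultimately show ?thesis by simp
qed

text \<open>This is subharmonicity of \<open>s\<^sup>q\<close> tested with \<open>w\<^sup>2\<close>, whose gradient is \<open>- 4 w (x, y)\<close>: the means of
  \<open>s\<^sup>q\<close> over circles increase with the radius. In \<open>energy_identity\<close> for \<open>k = 2\<close> the first and the
  last term have a nonnegative sum.\<close>
lemma radial_flux_nonneg:
  assumes P1: "axial_pair lam R a c ax cx" and P2: "axial_pair lam R ax cx axx cxx"
    and \<rho>: "0 < \<rho>" "\<rho> < R" and lam: "0 \<le> lam" and \<epsilon>: "0 < \<epsilon>" and q: "1 / 2 \<le> q"
  defines "s \<equiv> energy a c \<epsilon>" and "w \<equiv> disc_weight \<rho>"
    and "V\<^sub>1 \<equiv> energy_x a c ax cx" and "V\<^sub>2 \<equiv> energy_y lam a c ax cx"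
  shows "0 \<le> (LINT z|axial_measure lam \<rho>. w z * s z powr (q - 1) * (Re z * V\<^sub>1 z + Im z * V\<^sub>2 z))"
proof -
  let ?M = "axial_measure lam \<rho>" and ?H = "hessian_sq lam c ax cx"
  let ?A = "\<lambda>z. w z powr 2 * s z powr (q - 1) * ?H z"
  let ?B = "\<lambda>z. w z powr 1 * s z powr (q - 1) * (Re z * V\<^sub>1 z + Im z * V\<^sub>2 z)"
  let ?C = "\<lambda>z. 2 * (q - 1) * w z powr 2 * s z powr (q - 2) * ((V\<^sub>1 z)\<^sup>2 + (V\<^sub>2 z)\<^sup>2)"
  note bm = axial_pair_bounded_measurable[OF P1 \<rho>(2)]
    bounded_measurable_weight_powr bounded_measurable_energy_powr[OF P1 \<rho>(2) \<epsilon>]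
  note int = bounded_measurable_integrable[OF lam]
  have i: "integrable ?M ?A" "integrable ?M ?B" "integrable ?M ?C"
    unfolding w_def s_def V\<^sub>1_def V\<^sub>2_def by (rule int, (intro bm_intros bm; simp))+
  have "(LINT z|?M. ?A z - 4 * ?B z + ?C z) = 0"
    using energy_identity[OF P1 P2 \<rho> lam \<epsilon>, of 2 q] unfolding w_def s_def V\<^sub>1_def V\<^sub>2_def
    by (simp add: mult.assoc)
  then have "4 * (LINT z|?M. ?B z) = (LINT z|?M. ?A z + ?C z)"
    using i by simp
  also have "\<dots> \<ge> 0"
  proof (rule Bochner_Integration.integral_nonneg)
    fix z
    let ?V = "(V\<^sub>1 z)\<^sup>2 + (V\<^sub>2 z)\<^sup>2"
    have s0: "0 < s z" unfolding s_def using \<epsilon> by (rule energy_pos)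
    have H0: "0 \<le> ?H z" by (rule hessian_sq_nonneg[OF lam])
    have "?V \<le> (1 - 1 / (2 + 2 * lam)) * ?H z * s z"
      using energy_gradient_le[OF lam \<epsilon>] by (simp add: V\<^sub>1_def V\<^sub>2_def s_def)
    also have "\<dots> \<le> 1 * ?H z * s z" using lam H0 s0 by (intro mult_right_mono) auto
    finally have V: "?V / s z \<le> ?H z" using s0 by (simp add: divide_le_eq)
    have "(-1) * (?V / s z) \<le> 2 * (q - 1) * (?V / s z)"
      using q s0 by (intro mult_right_mono) auto
    with V have "0 \<le> ?H z + 2 * (q - 1) * (?V / s z)" by linarith
    then have "0 \<le> (w z powr 2 * s z powr (q - 1)) * (?H z + 2 * (q - 1) * (?V / s z))" by simp
    also have "\<dots> = ?A z + ?C z"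
    proof -
      have e: "s z powr (q - 2) = s z powr (q - 1) / s z" using s0 powr_diff[of "s z" "q - 1" 1] by simp
      show ?thesis unfolding e by (simp add: algebra_simps add_divide_distrib diff_divide_distrib)
    qed
    finally show "0 \<le> ?A z + ?C z" .
  qed
  finally have "0 \<le> (LINT z|?M. ?B z)" by simp
  also have "(LINT z|?M. ?B z) = (LINT z|?M. w z * s z powr (q - 1) * (Re z * V\<^sub>1 z + Im z * V\<^sub>2 z))"
    by (rule Bochner_Integration.integral_cong) (auto simp: w_def disc_weight_pos abs_of_pos)
  finally show ?thesis .
qed

lemma le_if_le_add_small:
  fixes X Y K :: real
  assumes "\<And>e. 0 < e \<Longrightarrow> e \<le> 1 \<Longrightarrow> X \<le> Y + K * e"
  shows "X \<le> Y"
proof (rule field_le_epsilon)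
  fix d :: real assume d: "0 < d"
  define e where "e = min 1 (d / (\<bar>K\<bar> + 1))"
  have e: "0 < e" "e \<le> 1" "e \<le> d / (\<bar>K\<bar> + 1)" using d by (auto simp: e_def)
  have "K * e \<le> (\<bar>K\<bar> + 1) * e" using e by (intro mult_right_mono) auto
  also have "\<dots> \<le> d" using e(3) by (simp add: le_divide_eq mult.commute)
  finally show "X \<le> Y + d" using assms[OF e(1,2)] by simp
qed

text \<open>Either \<open>u\<close> is at most \<open>\<delta>\<^sup>1\<^sup>/\<^sup>m t\<close>, and the first term dominates, or the second one does. This replaces
  Hoelder's inequality throughout, since all integrals that are absorbed are known to be finite.\<close>
lemma young_powr:
  fixes t u \<delta> r m :: real
  assumes "0 \<le> t" "0 \<le> u" "0 < \<delta>" "0 \<le> r" "0 < m"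
  shows "t powr r * u powr m \<le> \<delta> * t powr (r + m) + \<delta> powr (- r / m) * u powr (r + m)"
proof (cases "u \<le> \<delta> powr (1 / m) * t")
  case True
  then have "u powr m \<le> (\<delta> powr (1 / m) * t) powr m" using assms by (intro powr_mono2) auto
  also have "\<dots> = \<delta> * t powr m" using assms by (simp add: powr_mult powr_powr)
  finally have "t powr r * u powr m \<le> t powr r * (\<delta> * t powr m)" by (intro mult_left_mono) auto
  also have "\<dots> = \<delta> * t powr (r + m)" by (simp add: powr_add)
  finally show ?thesis by (smt (verit) mult_nonneg_nonneg powr_ge_zero)
next
  case False
  then have "t \<le> u * \<delta> powr (- 1 / m)" using assms by (simp add: powr_minus field_simps)
  then have "t powr r \<le> (u * \<delta> powr (- 1 / m)) powr r" using assms by (intro powr_mono2) auto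
  also have "\<dots> = \<delta> powr (- r / m) * u powr r" using assms by (simp add: powr_mult powr_powr)
  finally have "t powr r * u powr m \<le> \<delta> powr (- r / m) * u powr r * u powr m" by (intro mult_right_mono) auto
  also have "\<dots> = \<delta> powr (- r / m) * u powr (r + m)" by (simp add: powr_add)
  finally show ?thesis using assms by (smt (verit) mult_nonneg_nonneg powr_ge_zero)
qed

lemma inner_le_sqrt:
  fixes a b c d :: real
  shows "a * c + b * d \<le> sqrt (a\<^sup>2 + b\<^sup>2) * sqrt (c\<^sup>2 + d\<^sup>2)" "\<bar>a * c + b * d\<bar> \<le> sqrt (a\<^sup>2 + b\<^sup>2) * sqrt (c\<^sup>2 + d\<^sup>2)"
proof -
  have "(a * c + b * d)\<^sup>2 \<le> (a\<^sup>2 + b\<^sup>2) * (c\<^sup>2 + d\<^sup>2)"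
    using zero_le_power2[of "a * d - b * c"] by (simp add: power2_eq_square algebra_simps)
  then have "\<bar>a * c + b * d\<bar> \<le> sqrt ((a\<^sup>2 + b\<^sup>2) * (c\<^sup>2 + d\<^sup>2))" using real_le_rsqrt by (simp add: real_le_rsqrt)
  then show "\<bar>a * c + b * d\<bar> \<le> sqrt (a\<^sup>2 + b\<^sup>2) * sqrt (c\<^sup>2 + d\<^sup>2)" by (simp add: real_sqrt_mult)
  then show "a * c + b * d \<le> sqrt (a\<^sup>2 + b\<^sup>2) * sqrt (c\<^sup>2 + d\<^sup>2)" by linarith
qed

lemma sqrt_powr: "0 \<le> x \<Longrightarrow> sqrt x powr p = x powr (p / 2)"
  by (simp add: powr_half_sqrt[symmetric] powr_powr)

lemma bounded_measurable_powr:
  assumes "continuous_on (cball 0 \<rho>) F" "\<And>z. 0 \<le> F z" "0 < q"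
  shows "bounded_measurable \<rho> (\<lambda>z. F z powr q)"
  using assms by (intro bounded_measurable_continuous continuous_on_powr' continuous_intros) auto

lemma integrable_weighted_powr:
  assumes "continuous_on (cball 0 \<rho>) g" "\<And>z. 0 \<le> g z" "0 < p" "0 \<le> lam"
  shows "integrable (axial_measure lam \<rho>) (\<lambda>z. (disc_weight \<rho> z * g z) powr p)"
  by (intro bounded_measurable_integrable assms bounded_measurable_continuous continuous_on_powr' continuous_intros)
    (use assms disc_weight_nonneg in auto)

text \<open>Let \<open>N\<close>, \<open>W\<close> and \<open>J\<close> be the integrals of \<open>s\<^sup>q\<close>, \<open>w s\<^sup>q\<close> and of the radial flux. The identity
  \<open>2 \<rho>\<^sup>2 N = (4 + 2 \<lambda>) W + p J\<close> with \<open>W, J \<ge> 0\<close> bounds \<open>N\<close> by \<open>8 p (J + (1 + \<lambda>) W)\<close>, and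
  this combination of \<open>J\<close> and \<open>W\<close> is an integral involving \<open>r \<partial>\<^sub>r + 1 + \<lambda>\<close>
  (\<open>radial_derivative_energy\<close>), hence \<open>g\<close>, up to an error that vanishes with \<open>\<epsilon>\<close>. The sign of
  \<open>J\<close> is what makes the weight \<open>w\<close>, which is not small at the origin, harmless when \<open>p\<close> is small.\<close>
lemma hardy_estimate:
  assumes P1: "axial_pair lam R a c ax cx" and P2: "axial_pair lam R ax cx axx cxx"
    and \<rho>: "1 / 2 \<le> \<rho>" "\<rho> < R" "\<rho> \<le> 1" and lam: "0 \<le> lam" and p: "1 \<le> p"
  defines "g \<equiv> \<lambda>z. sqrt ((euler_re lam a ax cx z)\<^sup>2 + (euler_im lam c ax cx z)\<^sup>2)"
  shows "(LINT z|axial_measure lam \<rho>. ((a z)\<^sup>2 + (c z)\<^sup>2) powr (p / 2))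
    \<le> 20 * p * (20 * p) powr (p - 1) * (LINT z|axial_measure lam \<rho>. (disc_weight \<rho> z * g z) powr p)"
proof (rule le_if_le_add_small)
  let ?M = "axial_measure lam \<rho>" and ?w = "disc_weight \<rho>"
  define q where "q = p / 2"
  define K where "K = 20 * p * (1 + lam) * (LINT z|?M. energy a c 1 z powr (q - 1 / 2))"
  fix e :: real assume e: "0 < e" "e \<le> 1"
  \<comment> \<open>The regularization error is of order \<open>sqrt \<epsilon>\<close>, so it is linear in \<open>e\<close>.\<close>
  define \<epsilon> where "\<epsilon> = e\<^sup>2"
  have \<epsilon>: "0 < \<epsilon>" "\<epsilon> \<le> 1" "sqrt \<epsilon> = e" using e by (auto simp: \<epsilon>_def power_le_one)
  have \<rho>0: "0 < \<rho>" using \<rho> by simp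
  define s where "s = energy a c \<epsilon>"
  have s0: "0 < s z" for z unfolding s_def using \<epsilon> by (simp add: energy_pos)
  let ?rad = "\<lambda>z. Re z * energy_x a c ax cx z + Im z * energy_y lam a c ax cx z"
  note bm = axial_pair_bounded_measurable[OF P1 \<rho>(2)]
    bounded_measurable_continuous[OF continuous_on_disc_weight] bounded_measurable_energy_powr[OF P1 \<rho>(2) \<epsilon>(1)]
    bounded_measurable_energy_powr[OF P1 \<rho>(2) zero_less_one]
  note int = bounded_measurable_integrable[OF lam]
  have cg: "continuous_on (cball 0 \<rho>) g" unfolding g_def euler_re_def euler_im_def
    by (intro continuous_intros axial_pair_continuous_cball[OF P1 \<rho>(2)])
  have g0: "0 \<le> g z" for z by (simp add: g_def)
  have ig: "integrable ?M (\<lambda>z. (?w z * g z) powr p)"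
    using p by (intro integrable_weighted_powr cg g0 lam) auto
  have i1: "integrable ?M (\<lambda>z. s z powr q)" unfolding s_def by (rule int) (intro bm)
  have i2: "integrable ?M (\<lambda>z. ?w z * s z powr q)" unfolding s_def by (rule int) (intro bm_intros bm)
  have i3: "integrable ?M (\<lambda>z. ?w z * s z powr (q - 1) * ?rad z)" unfolding s_def by (rule int) (intro bm_intros bm)
  have i4: "integrable ?M (\<lambda>z. energy a c 1 z powr (q - 1 / 2))" by (rule int) (intro bm)
  let ?N = "LINT z|?M. s z powr q" and ?W = "LINT z|?M. ?w z * s z powr q"
    and ?J = "LINT z|?M. ?w z * s z powr (q - 1) * ?rad z"
  have "(LINT z|?M. (4 + 2 * lam) * (?w z * s z powr q) - 2 * \<rho>\<^sup>2 * s z powr q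
      + p * (?w z * s z powr (q - 1) * ?rad z)) = 0"
    using radial_identity[OF P1 \<rho>0 \<rho>(2) lam \<epsilon>(1), of q] by (simp add: s_def q_def algebra_simps)
  then have N: "2 * \<rho>\<^sup>2 * ?N = (4 + 2 * lam) * ?W + p * ?J"
    using i1 i2 i3 by simp
  have J: "0 \<le> ?J"
    using radial_flux_nonneg[OF P1 P2 \<rho>0 \<rho>(2) lam \<epsilon>(1), of q] p by (simp add: s_def q_def)
  have W: "0 \<le> ?W"
    by (rule integral_nonneg_AE, rule AE_I2) (auto intro!: mult_nonneg_nonneg simp: less_imp_le disc_weight_pos)
  have "?J + (1 + lam) * ?W = (LINT z|?M. ?w z * s z powr (q - 1) * ?rad z + (1 + lam) * (?w z * s z powr q))"
    using i2 i3 by simp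
  also have "\<dots> \<le> (LINT z|?M. (1 / (20 * p)) * s z powr q + (20 * p) powr (p - 1) * (?w z * g z) powr p
       + (1 + lam) * e * energy a c 1 z powr (q - 1 / 2))"
  proof (rule integral_mono)
    fix z assume "z \<in> space ?M"
    then have z: "norm z < \<rho>" by simp
    have w: "0 < ?w z" "?w z \<le> 1" using disc_weight_pos[OF z] disc_weight_le_1 \<rho> by auto
    have sq: "s z powr q = s z powr (q - 1) * s z" using s0[of z] powr_add[of "s z" "q - 1" 1] by simp
    have U: "(a z)\<^sup>2 + (c z)\<^sup>2 = s z - \<epsilon>" by (simp add: s_def energy_def)
    have rad: "?rad z = a z * euler_re lam a ax cx z + c z * euler_im lam c ax cx z - (1 + lam) * (s z - \<epsilon>)"
      using radial_derivative_energy[OF P1, of z] z \<rho> unfolding U by simp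
    have "?w z * s z powr (q - 1) * ?rad z + (1 + lam) * (?w z * s z powr q)
      = ?w z * s z powr (q - 1) * (a z * euler_re lam a ax cx z + c z * euler_im lam c ax cx z)
        + (1 + lam) * (?w z * (\<epsilon> * s z powr (q - 1)))"
      unfolding sq rad by (simp add: algebra_simps)
    also have "\<dots> \<le> ?w z * s z powr (q - 1) * (sqrt (s z) * g z)
        + (1 + lam) * (1 * (e * energy a c 1 z powr (q - 1 / 2)))"
    proof -
      have "a z * euler_re lam a ax cx z + c z * euler_im lam c ax cx z \<le> sqrt ((a z)\<^sup>2 + (c z)\<^sup>2) * g z"
        unfolding g_def by (rule inner_le_sqrt)
      also have "\<dots> \<le> sqrt (s z) * g z"
        using \<epsilon> g0 by (intro mult_right_mono) (auto simp: s_def energy_def)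
      finally have F1: "a z * euler_re lam a ax cx z + c z * euler_im lam c ax cx z \<le> sqrt (s z) * g z" .
      have "\<epsilon> * s z powr (q - 1) = (sqrt \<epsilon> * sqrt \<epsilon>) * s z powr (q - 1)" using \<epsilon>(1) by simp
      then have "\<epsilon> * s z powr (q - 1) = sqrt \<epsilon> * (sqrt \<epsilon> * s z powr (q - 1))" by (simp only: mult.assoc)
      also have "\<dots> \<le> sqrt \<epsilon> * (sqrt (s z) * s z powr (q - 1))"
        using \<epsilon> by (intro mult_left_mono mult_right_mono) (auto simp: s_def energy_def)
      also have "sqrt (s z) * s z powr (q - 1) = s z powr (q - 1 / 2)"
        using s0[of z] by (simp add: powr_half_sqrt[symmetric] powr_add[symmetric])
      also have "sqrt \<epsilon> * s z powr (q - 1 / 2) \<le> sqrt \<epsilon> * energy a c 1 z powr (q - 1 / 2)"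
        using p \<epsilon> s0[of z] by (intro mult_left_mono powr_mono2) (auto simp: q_def s_def energy_def)
      finally have "\<epsilon> * s z powr (q - 1) \<le> e * energy a c 1 z powr (q - 1 / 2)"
        using \<epsilon>(3) by simp
      then have F2: "?w z * (\<epsilon> * s z powr (q - 1)) \<le> 1 * (e * energy a c 1 z powr (q - 1 / 2))"
        by (rule mult_mono[OF w(2)]) (use \<epsilon> w in auto)
      show ?thesis
        by (rule add_mono[OF mult_left_mono[OF F1] mult_left_mono[OF F2]]) (use w lam in auto)
    qed
    also have "?w z * s z powr (q - 1) * (sqrt (s z) * g z) = sqrt (s z) powr (p - 1) * (?w z * g z) powr 1"
    proof -
      have "s z powr (q - 1) * sqrt (s z) = sqrt (s z) powr (p - 1)"
        using s0[of z] by (simp add: powr_half_sqrt[symmetric] powr_add[symmetric] powr_powr q_def field_simps)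
      then show ?thesis using w g0[of z] by (simp add: mult_ac)
    qed
    \<comment> \<open>The factor \<open>1 / (20 p)\<close> leaves \<open>N\<close> with a coefficient that the left-hand side can absorb.\<close>
    also have "\<dots> \<le> (1 / (20 * p)) * sqrt (s z) powr (p - 1 + 1)
        + (1 / (20 * p)) powr (- (p - 1) / 1) * (?w z * g z) powr (p - 1 + 1)"
      using w g0[of z] p s0[of z] by (intro young_powr) auto
    also have "sqrt (s z) powr (p - 1 + 1) = s z powr q"
      using s0[of z] by (simp add: sqrt_powr q_def)
    also have "(1 / (20 * p)) powr (- (p - 1) / 1) = (20 * p) powr (p - 1)"
      using p powr_minus_divide[of "20 * p" "1 - p"] by (simp add: powr_divide)
    finally show "?w z * s z powr (q - 1) * ?rad z + (1 + lam) * (?w z * s z powr q)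
       \<le> (1 / (20 * p)) * s z powr q + (20 * p) powr (p - 1) * (?w z * g z) powr p
       + (1 + lam) * e * energy a c 1 z powr (q - 1 / 2)" by (simp add: mult.assoc)
  qed (use i1 i2 i3 i4 ig in auto)
  also have "\<dots> = (1 / (20 * p)) * ?N + (20 * p) powr (p - 1) * (LINT z|?M. (?w z * g z) powr p)
       + (1 + lam) * e * (LINT z|?M. energy a c 1 z powr (q - 1 / 2))"
    using i1 i4 ig by simp
  finally have "20 * p * (?J + (1 + lam) * ?W) \<le> 20 * p * \<dots>" using p by (intro mult_left_mono) auto
  also have "\<dots> = ?N + 20 * p * (20 * p) powr (p - 1) * (LINT z|?M. (?w z * g z) powr p) + K * e"
    using p by (simp add: K_def algebra_simps)
  finally have A: "20 * p * (?J + (1 + lam) * ?W) - ?N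
      \<le> 20 * p * (20 * p) powr (p - 1) * (LINT z|?M. (?w z * g z) powr p) + K * e" by linarith
  have "(1 / 2)\<^sup>2 \<le> \<rho>\<^sup>2" using \<rho> by (intro power_mono) auto
  moreover have N0: "0 \<le> ?N" by simp
  ultimately have "2 * (1 / 2)\<^sup>2 * ?N \<le> 2 * \<rho>\<^sup>2 * ?N" by (intro mult_right_mono) auto
  then have "?N \<le> 2 * ((4 + 2 * lam) * ?W + p * ?J)" using N by (simp add: power2_eq_square)
  also have "\<dots> \<le> 2 * (4 * p * (1 + lam) * ?W + 4 * p * ?J)"
  proof (intro mult_left_mono add_mono mult_right_mono W J)
    have "4 + 2 * lam \<le> 4 * (1 + lam)" using lam by simp
    also have "\<dots> \<le> 4 * p * (1 + lam)" using p lam by (intro mult_right_mono) auto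
    finally show "4 + 2 * lam \<le> 4 * p * (1 + lam)" .
  qed (use p in auto)
  finally have "?N \<le> 8 * (p * (?J + (1 + lam) * ?W))" by (simp add: algebra_simps)
  moreover have "0 \<le> p * (?J + (1 + lam) * ?W)" using p J W lam by simp
  ultimately have "?N \<le> 20 * p * (20 * p) powr (p - 1) * (LINT z|?M. (?w z * g z) powr p) + K * e"
    using A by linarith
  moreover have "(LINT z|?M. ((a z)\<^sup>2 + (c z)\<^sup>2) powr (p / 2)) \<le> ?N"
  proof (rule integral_mono)
    show "integrable ?M (\<lambda>z. ((a z)\<^sup>2 + (c z)\<^sup>2) powr (p / 2))"
      using p axial_pair_continuous_cball[OF P1 \<rho>(2)]
      by (intro int bounded_measurable_powr continuous_intros) auto
    show "((a z)\<^sup>2 + (c z)\<^sup>2) powr (p / 2) \<le> s z powr q" for z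
      unfolding q_def s_def energy_def using p \<epsilon> by (intro powr_mono2) auto
  qed (rule i1)
  ultimately show "(LINT z|?M. ((a z)\<^sup>2 + (c z)\<^sup>2) powr (p / 2))
      \<le> 20 * p * (20 * p) powr (p - 1) * (LINT z|?M. (?w z * g z) powr p) + K * e" by linarith
qed

section \<open>The function bounds its derivative\<close>

lemma integral_energy_powr_tendsto:
  assumes P1: "axial_pair lam R a c ax cx" and \<rho>: "\<rho> < R" and lam: "0 \<le> lam" and q: "0 < q"
  shows "(\<lambda>n. LINT z|axial_measure lam \<rho>. energy a c (1 / Suc n) z powr q)
    \<longlonglongrightarrow> (LINT z|axial_measure lam \<rho>. ((a z)\<^sup>2 + (c z)\<^sup>2) powr q)"
proof (rule integral_dominated_convergence[where w="\<lambda>z. energy a c 1 z powr q"])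
  note int = bounded_measurable_integrable[OF lam]
  have i: "integrable (axial_measure lam \<rho>) (\<lambda>z. energy a c \<epsilon> z powr q)" if "0 < \<epsilon>" for \<epsilon>
    by (rule int[OF bounded_measurable_energy_powr[OF P1 \<rho> that]])
  show "(\<lambda>z. energy a c (1 / Suc n) z powr q) \<in> borel_measurable (axial_measure lam \<rho>)" for n
    by (rule borel_measurable_integrable[OF i]) simp
  show "integrable (axial_measure lam \<rho>) (\<lambda>z. energy a c 1 z powr q)" by (rule i) simp
  have "integrable (axial_measure lam \<rho>) (\<lambda>z. ((a z)\<^sup>2 + (c z)\<^sup>2) powr q)"
    using q axial_pair_continuous_cball[OF P1 \<rho>]
    by (intro int bounded_measurable_powr continuous_intros) auto
  then show "(\<lambda>z. ((a z)\<^sup>2 + (c z)\<^sup>2) powr q) \<in> borel_measurable (axial_measure lam \<rho>)" by auto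
  show "AE z in axial_measure lam \<rho>. (\<lambda>n. energy a c (1 / Suc n) z powr q) \<longlonglongrightarrow> ((a z)\<^sup>2 + (c z)\<^sup>2) powr q"
  proof (rule AE_I2)
    fix z
    have "(\<lambda>n. energy a c (1 / Suc n) z) \<longlonglongrightarrow> (a z)\<^sup>2 + (c z)\<^sup>2 + 0"
      unfolding energy_def using LIMSEQ_inverse_real_of_nat by (intro tendsto_intros) (simp add: inverse_eq_divide)
    then show "(\<lambda>n. energy a c (1 / Suc n) z powr q) \<longlonglongrightarrow> ((a z)\<^sup>2 + (c z)\<^sup>2) powr q"
      using q by (intro tendsto_powr') (auto simp: energy_def intro!: always_eventually)
  qed
  show "AE z in axial_measure lam \<rho>. norm (energy a c (1 / Suc n) z powr q) \<le> energy a c 1 z powr q" for n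
    using q by (intro AE_I2) (auto simp: energy_def intro!: powr_mono2)
qed

text \<open>With \<open>t = w\<^sup>2 (ax\<^sup>2 + cx\<^sup>2)\<close> and \<open>q = p / 2 \<le> 1\<close>, \<open>t\<^sup>q \<le> t s\<^sup>q\<^sup>-\<^sup>1 + s\<^sup>q\<close> holds because one of the
  two terms on the right dominates. The Caccioppoli inequality for \<open>k = 2\<close> bounds the first of them.\<close>
lemma derivative_estimate_small_p:
  assumes P1: "axial_pair lam R a c ax cx" and P2: "axial_pair lam R ax cx axx cxx"
    and \<rho>: "0 < \<rho>" "\<rho> < R" "\<rho> \<le> 1" and lam: "0 \<le> lam" and p: "1 \<le> p" "p \<le> 2"
  shows "(LINT z|axial_measure lam \<rho>. (disc_weight \<rho> z * sqrt ((ax z)\<^sup>2 + (cx z)\<^sup>2)) powr p)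
    \<le> (16 * (2 + 2 * lam)\<^sup>2 + 1) * (LINT z|axial_measure lam \<rho>. ((a z)\<^sup>2 + (c z)\<^sup>2) powr (p / 2))"
proof -
  let ?M = "axial_measure lam \<rho>" and ?w = "disc_weight \<rho>" and ?H = "hessian_sq lam c ax cx"
  let ?L = "LINT z|?M. (?w z * sqrt ((ax z)\<^sup>2 + (cx z)\<^sup>2)) powr p"
  let ?C = "16 * (2 + 2 * lam)\<^sup>2 + 1"
  define q where "q = p / 2"
  have q: "1 / 2 \<le> q" "q \<le> 1" using p by (auto simp: q_def)
  note int = bounded_measurable_integrable[OF lam]
  have iL: "integrable ?M (\<lambda>z. (?w z * sqrt ((ax z)\<^sup>2 + (cx z)\<^sup>2)) powr p)"
    using p by (intro integrable_weighted_powr lam continuous_intros axial_pair_continuous_cball[OF P1 \<rho>(2)]) auto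
  have bound: "?L \<le> ?C * (LINT z|?M. energy a c \<epsilon> z powr q)" if \<epsilon>: "0 < \<epsilon>" for \<epsilon>
  proof -
    let ?s = "energy a c \<epsilon>"
    note bm = axial_pair_bounded_measurable[OF P1 \<rho>(2)]
      bounded_measurable_weight_powr bounded_measurable_energy_powr[OF P1 \<rho>(2) \<epsilon>]
    have i1: "integrable ?M (\<lambda>z. ?w z powr 2 * ?s z powr (q - 1) * ?H z)"
      by (rule int, intro bm_intros bm) simp
    have i2: "integrable ?M (\<lambda>z. ?s z powr q)" by (rule int, intro bm)
    have "?L \<le> (LINT z|?M. ?w z powr 2 * ?s z powr (q - 1) * ?H z + ?s z powr q)"
    proof (rule integral_mono)
      fix z assume "z \<in> space ?M"
      then have w: "0 < ?w z" by (simp add: disc_weight_pos)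
      have s0: "0 < ?s z" by (rule energy_pos[OF \<epsilon>])
      define t where "t = (?w z)\<^sup>2 * ((ax z)\<^sup>2 + (cx z)\<^sup>2)"
      have t0: "0 \<le> t" by (simp add: t_def)
      have "(?w z * sqrt ((ax z)\<^sup>2 + (cx z)\<^sup>2)) = sqrt t"
        using w by (simp add: t_def real_sqrt_mult)
      then have "(?w z * sqrt ((ax z)\<^sup>2 + (cx z)\<^sup>2)) powr p = t powr q"
        using sqrt_powr[OF t0] by (simp add: q_def)
      also have "\<dots> \<le> t * ?s z powr (q - 1) + ?s z powr q"
      proof (cases "t \<le> ?s z")
        case True
        then have "t powr q \<le> ?s z powr q" using q t0 by (intro powr_mono2) auto
        then show ?thesis using t0 by (simp add: add_increasing)
      next
        case False
        then have "t powr q = t * t powr (q - 1)" using s0 powr_add[of t 1 "q - 1"] by simp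
        also have "\<dots> \<le> t * ?s z powr (q - 1)"
          using False s0 q t0 by (intro mult_left_mono powr_mono2') auto
        finally show ?thesis by (simp add: add_increasing2)
      qed
      also have "t * ?s z powr (q - 1) \<le> ?w z powr 2 * ?s z powr (q - 1) * ?H z"
        using w mult_right_mono[OF hessian_sq_ge[OF lam, of ax z cx c], of "(?w z)\<^sup>2 * ?s z powr (q - 1)"]
        by (simp add: t_def mult_ac)
      finally show "(?w z * sqrt ((ax z)\<^sup>2 + (cx z)\<^sup>2)) powr p
        \<le> ?w z powr 2 * ?s z powr (q - 1) * ?H z + ?s z powr q" by simp
    qed (use i1 i2 iL in auto)
    also have "\<dots> = (LINT z|?M. ?w z powr 2 * ?s z powr (q - 1) * ?H z) + (LINT z|?M. ?s z powr q)"
      using i1 i2 by simp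
    also have "(LINT z|?M. ?w z powr 2 * ?s z powr (q - 1) * ?H z)
        \<le> 4 * 2\<^sup>2 * (2 + 2 * lam)\<^sup>2 * (LINT z|?M. ?w z powr (2 - 2) * ?s z powr q)"
      by (rule caccioppoli[OF P1 P2 \<rho> lam \<epsilon> _ q(1)]) simp
    also have "(LINT z|?M. ?w z powr (2 - 2) * ?s z powr q) = (LINT z|?M. ?s z powr q)"
      by (rule Bochner_Integration.integral_cong) (auto dest: disc_weight_pos)
    finally show ?thesis by (simp add: algebra_simps)
  qed
  have "(\<lambda>n. ?C * (LINT z|?M. energy a c (1 / Suc n) z powr q))
     \<longlonglongrightarrow> ?C * (LINT z|?M. ((a z)\<^sup>2 + (c z)\<^sup>2) powr q)"
    using q by (intro tendsto_mult_left integral_energy_powr_tendsto[OF P1 \<rho>(2) lam]) auto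
  then have "?L \<le> ?C * (LINT z|?M. ((a z)\<^sup>2 + (c z)\<^sup>2) powr q)"
    by (rule LIMSEQ_le_const) (use bound in auto)
  then show ?thesis by (simp add: q_def)
qed

text \<open>In the application \<open>F = |f|\<close>, and \<open>t\<close> and \<open>g\<close> are \<open>w |\<partial>\<^sub>x f|\<close> and \<open>w\<^sup>2 |\<partial>\<^sub>x\<^sup>2 f|\<close>. Each of
  the two products uses a quarter of \<open>t\<^sup>p\<close>; the second one in addition uses \<open>\<eta>\<close> times the quantity that
  the Caccioppoli inequality controls.\<close>
lemma absorb_pointwise:
  fixes t g F p \<eta> :: real
  assumes p: "2 < p" and nonneg: "0 \<le> t" "0 \<le> g" "0 \<le> F" and \<eta>: "0 < \<eta>"
  defines "K \<equiv> (p - 1)\<^sup>2 / (4 * \<eta>)"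
  shows "2 * p * (t powr (p - 1) * F) + (p - 1) * (t powr (p - 2) * (g * F))
    \<le> 1 / 2 * t powr p + \<eta> * (t powr (p - 2) * g\<^sup>2)
      + (2 * p * (1 / (8 * p)) powr (1 - p) + K * (1 / (4 * K)) powr (- (p - 2) / 2)) * F powr p"
proof -
  have K: "0 < K" using p \<eta> by (simp add: K_def)
  have "t powr (p - 1) * F powr 1 \<le> (1 / (8 * p)) * t powr (p - 1 + 1) + (1 / (8 * p)) powr (- (p - 1) / 1) * F powr (p - 1 + 1)"
    using p nonneg by (intro young_powr) auto
  then have "2 * p * (t powr (p - 1) * F) \<le> 2 * p * ((1 / (8 * p)) * t powr p + (1 / (8 * p)) powr (1 - p) * F powr p)"
    using p nonneg by (intro mult_left_mono) auto
  also have "\<dots> = 1 / 4 * t powr p + 2 * p * (1 / (8 * p)) powr (1 - p) * F powr p"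
    using p by (simp add: algebra_simps)
  finally have 1: "2 * p * (t powr (p - 1) * F) \<le> 1 / 4 * t powr p + 2 * p * (1 / (8 * p)) powr (1 - p) * F powr p" .
  have "(p - 1) * (g * F) \<le> \<eta> * g\<^sup>2 + K * F\<^sup>2"
  proof -
    have "0 \<le> (2 * \<eta> * g - (p - 1) * F)\<^sup>2 / (4 * \<eta>)" using \<eta> by simp
    also have "\<dots> = \<eta> * g\<^sup>2 + K * F\<^sup>2 - (p - 1) * (g * F)"
      using \<eta> by (simp add: K_def field_simps power2_eq_square)
    finally show ?thesis by simp
  qed
  then have "t powr (p - 2) * ((p - 1) * (g * F)) \<le> t powr (p - 2) * (\<eta> * g\<^sup>2 + K * F\<^sup>2)"
    by (intro mult_left_mono) auto
  then have 2: "(p - 1) * (t powr (p - 2) * (g * F)) \<le> \<eta> * (t powr (p - 2) * g\<^sup>2) + K * (t powr (p - 2) * F powr 2)"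
    using nonneg by (simp add: algebra_simps)
  have "t powr (p - 2) * F powr 2 \<le> (1 / (4 * K)) * t powr (p - 2 + 2) + (1 / (4 * K)) powr (- (p - 2) / 2) * F powr (p - 2 + 2)"
    using p nonneg K by (intro young_powr) auto
  then have "K * (t powr (p - 2) * F powr 2) \<le> K * ((1 / (4 * K)) * t powr p + (1 / (4 * K)) powr (- (p - 2) / 2) * F powr p)"
    using K by (intro mult_left_mono) auto
  also have "\<dots> = 1 / 4 * t powr p + K * (1 / (4 * K)) powr (- (p - 2) / 2) * F powr p"
    using K by (simp add: algebra_simps)
  finally have "K * (t powr (p - 2) * F powr 2) \<le> 1 / 4 * t powr p + K * (1 / (4 * K)) powr (- (p - 2) / 2) * F powr p" .
  with 1 2 show ?thesis by (simp add: algebra_simps)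
qed

text \<open>Integrates \<open>\<partial>\<^sub>x (w\<^sup>p s\<^sup>q\<^sup>-\<^sup>1 (a ax + c cx))\<close>, where \<open>s\<close> is the energy of the derivative. This moves
  one derivative from a factor \<open>(ax, cx)\<close> to the other factors.\<close>
lemma second_derivative_identity:
  assumes P1: "axial_pair lam R a c ax cx" and P2: "axial_pair lam R ax cx axx cxx"
    and \<rho>: "0 < \<rho>" "\<rho> < R" and lam: "0 \<le> lam" and \<epsilon>: "0 < \<epsilon>" and p: "1 < p"
  defines "s \<equiv> energy ax cx \<epsilon>" and "w \<equiv> disc_weight \<rho>" and "q \<equiv> p / 2"
  defines "I \<equiv> \<lambda>z. w z powr p * s z powr (q - 1) * ((ax z)\<^sup>2 + (cx z)\<^sup>2 + a z * axx z + c z * cxx z)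
      + 2 * (q - 1) * (w z powr p * s z powr (q - 2) * energy_x ax cx axx cxx z * energy_x a c ax cx z)
      - 2 * p * (Re z * (w z powr (p - 1) * s z powr (q - 1) * energy_x a c ax cx z))"
  shows "(LINT z|axial_measure lam \<rho>. I z) = 0" "integrable (axial_measure lam \<rho>) I"
proof -
  note bm = axial_pair_bounded_measurable[OF P1 \<rho>(2)] axial_pair_bounded_measurable[OF P2 \<rho>(2)]
    bounded_measurable_weight_powr bounded_measurable_energy_powr[OF P2 \<rho>(2) \<epsilon>]
  have w0: "0 < w z" if "norm z < \<rho>" for z unfolding w_def using that by (rule disc_weight_pos)
  have s0: "0 < s z" for z unfolding s_def using \<epsilon> by (rule energy_pos)
  have bI: "bounded_measurable \<rho> I"
    unfolding I_def s_def w_def by (intro bm_intros bm) (use p in auto)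
  then show "integrable (axial_measure lam \<rho>) I" by (rule bounded_measurable_integrable[OF lam])
  define P where "P = (\<lambda>z. w z powr p * (s z powr (q - 1) * energy_x a c ax cx z))"
  have "(LINT z|axial_measure lam \<rho>. I z + 0) = 0"
  proof (rule divergence_theorem_disc[where P=P and Q="\<lambda>z. 0"])
    have cw: "continuous_on (cball 0 \<rho>) (\<lambda>z. w z powr p)"
      using p disc_weight_nonneg unfolding w_def by (intro continuous_on_powr' continuous_intros) auto
    have cs: "continuous_on (cball 0 \<rho>) (\<lambda>z. s z powr (q - 1))"
      unfolding s_def using energy_pos[OF \<epsilon>]
      by (intro continuous_on_powr continuous_intros axial_pair_continuous_cball[OF P2 \<rho>(2)])
        (auto simp: less_imp_neq[symmetric])
    show "continuous_on (cball 0 \<rho>) P" unfolding P_def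
      by (intro continuous_on_mult cw cs axial_pair_continuous_cball[OF P1 \<rho>(2)])
    show "P z = 0 \<and> 0 = (0::real)" if "norm z = \<rho>" for z
      using p disc_weight_sphere[OF that] by (simp add: P_def w_def)
    fix z :: complex assume z: "norm z < \<rho>" and y: "Im z \<noteq> 0"
    have zR: "norm z < R" using z \<rho> by simp
    have s2: "s z powr (q - 1 - 1) = s z powr (q - 2)" by (simp add: diff_diff_eq)
    have d: "((\<lambda>t. w (Complex t (Im z)) powr p) has_real_derivative
         p * w z powr (p - 1) * (- 2 * Re z)) (at (Re z))"
      using DERIV_fun_powr[OF disc_weight_x, of \<rho> z p] w0[OF z] by (simp add: w_def)
    have e: "((\<lambda>t. s (Complex t (Im z)) powr (q - 1)) has_real_derivative
         (q - 1) * s z powr (q - 1 - 1) * (2 * energy_x ax cx axx cxx z)) (at (Re z))"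
      using DERIV_fun_powr[OF energy_derivative_x[OF P2 zR], of \<epsilon> "q - 1"] s0[of z] by (simp add: s_def)
    show "((\<lambda>t. P (Complex t (Im z))) has_real_derivative I z) (at (Re z))"
      unfolding P_def I_def
      by (rule DERIV_cong[OF DERIV_mult[OF d DERIV_mult[OF e energy_x_derivative[OF P1 P2 zR]]]])
        (simp add: s2 algebra_simps)
  qed (use \<rho> lam bI in \<open>auto intro: bm_intros\<close>)
  then show "(LINT z|axial_measure lam \<rho>. I z) = 0" by simp
qed


text \<open>\<open>K\<close> is the constant of \<open>absorb_pointwise\<close> for \<open>\<eta> = 1 / (4 C)\<close>, where \<open>C\<close> is the constant of
  \<open>caccioppoli\<close> for the exponent \<open>p + 2\<close>.\<close>
definition large_p_constant :: "real \<Rightarrow> real \<Rightarrow> real" where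
  "large_p_constant lam p =
     (let K = (p - 1)\<^sup>2 * (4 * (p + 2)\<^sup>2 * (2 + 2 * lam)\<^sup>2)
      in 2 * p * (1 / (8 * p)) powr (1 - p) + K * (1 / (4 * K)) powr (- (p - 2) / 2))"

text \<open>Let \<open>Y\<close> be the integral of \<open>w\<^sup>p s\<^sup>p\<^sup>/\<^sup>2\<close> for the energy \<open>s\<close> of \<open>(ax, cx)\<close>. By
  \<open>second_derivative_identity\<close> and \<open>absorb_pointwise\<close> it is at most \<open>Y / 2\<close>, plus a small multiple of a
  second-order integral, plus a multiple of the integral of \<open>|f|\<^sup>p\<close>. The Caccioppoli inequality for
  \<open>(ax, cx)\<close> turns the second-order integral into at most \<open>Y / 4\<close>, and a quarter of \<open>Y\<close> is left.\<close>
lemma derivative_estimate_large_p: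
  assumes P1: "axial_pair lam R a c ax cx" and P2: "axial_pair lam R ax cx axx cxx"
    and P3: "axial_pair lam R axx cxx axxx cxxx"
    and \<rho>: "0 < \<rho>" "\<rho> < R" "\<rho> \<le> 1" and lam: "0 \<le> lam" and p: "2 < p"
  shows "(LINT z|axial_measure lam \<rho>. (disc_weight \<rho> z * sqrt ((ax z)\<^sup>2 + (cx z)\<^sup>2)) powr p)
    \<le> 4 * large_p_constant lam p * (LINT z|axial_measure lam \<rho>. ((a z)\<^sup>2 + (c z)\<^sup>2) powr (p / 2))"
proof (rule le_if_le_add_small)
  let ?M = "axial_measure lam \<rho>" and ?w = "disc_weight \<rho>" and ?H = "hessian_sq lam cx axx cxx"
  let ?C\<^sub>2 = "large_p_constant lam p"
  define q where "q = p / 2"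
  define C\<^sub>0 where "C\<^sub>0 = 4 * (p + 2)\<^sup>2 * (2 + 2 * lam)\<^sup>2"
  have C0: "0 < C\<^sub>0" using p lam by (simp add: C\<^sub>0_def)
  define K where "K = (LINT z|?M. energy ax cx 1 z powr (q - 1))"
  fix e :: real assume e: "0 < e" "e \<le> 1"
  define s where "s = energy ax cx e"
  have s0: "0 < s z" for z unfolding s_def using e by (simp add: energy_pos)
  note bm = axial_pair_bounded_measurable[OF P1 \<rho>(2)] axial_pair_bounded_measurable[OF P2 \<rho>(2)]
    bounded_measurable_weight_powr bounded_measurable_energy_powr[OF P2 \<rho>(2) e(1)]
    bounded_measurable_energy_powr[OF P2 \<rho>(2) zero_less_one]
  note int = bounded_measurable_integrable[OF lam]
  define I where "I = (\<lambda>z. ?w z powr p * s z powr (q - 1) * ((ax z)\<^sup>2 + (cx z)\<^sup>2 + a z * axx z + c z * cxx z)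
      + 2 * (q - 1) * (?w z powr p * s z powr (q - 2) * energy_x ax cx axx cxx z * energy_x a c ax cx z)
      - 2 * p * (Re z * (?w z powr (p - 1) * s z powr (q - 1) * energy_x a c ax cx z)))"
  have I: "(LINT z|?M. I z) = 0" "integrable ?M I"
    using second_derivative_identity[OF P1 P2 \<rho>(1,2) lam e(1), of p] p
    unfolding I_def s_def q_def by auto
  let ?Y = "\<lambda>z. ?w z powr p * s z powr q"
  let ?F = "\<lambda>z. ((a z)\<^sup>2 + (c z)\<^sup>2) powr q"
  let ?T = "\<lambda>z. ?w z powr (p + 2) * s z powr (q - 1) * ?H z"
  let ?E = "\<lambda>z. energy ax cx 1 z powr (q - 1)"
  have iY: "integrable ?M ?Y" unfolding s_def by (rule int, intro bm_intros bm) (use p in auto)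
  have iT: "integrable ?M ?T" unfolding s_def by (rule int, intro bm_intros bm) (use p in auto)
  have iE: "integrable ?M ?E" by (rule int, intro bm)
  have iF: "integrable ?M ?F"
    using p axial_pair_continuous_cball[OF P1 \<rho>(2)]
    by (intro int bounded_measurable_powr continuous_intros) (auto simp: q_def)
  have caccio: "(LINT z|?M. ?T z) \<le> C\<^sub>0 * (LINT z|?M. ?Y z)"
    using caccioppoli[OF P2 P3 \<rho> lam e(1), of "p + 2" q] p by (simp add: s_def C\<^sub>0_def q_def)
  have "(LINT z|?M. ?Y z) \<le> (LINT z|?M. I z + e * ?E z + 1 / 2 * ?Y z + 1 / (4 * C\<^sub>0) * ?T z + ?C\<^sub>2 * ?F z)"
  proof (rule integral_mono)
    fix z assume "z \<in> space ?M"
    then have z: "norm z < \<rho>" by simp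
    have w: "0 < ?w z" "?w z \<le> 1" using disc_weight_pos[OF z] disc_weight_le_1 \<rho> by auto
    define t where "t = ?w z * sqrt (s z)"
    define G where "G = sqrt ((axx z)\<^sup>2 + (cxx z)\<^sup>2)"
    define F where "F = sqrt ((a z)\<^sup>2 + (c z)\<^sup>2)"
    have t0: "0 < t" using w s0[of z] by (simp add: t_def)
    have G0: "0 \<le> G" and F0: "0 \<le> F" by (auto simp: G_def F_def)
    have sle: "sqrt ((ax z)\<^sup>2 + (cx z)\<^sup>2) \<le> sqrt (s z)" using e by (simp add: s_def energy_def)
    have s1: "s z powr (q - 1) = sqrt (s z) powr (p - 2)"
      using s0[of z] by (simp add: sqrt_powr q_def diff_divide_distrib)
    have s2: "s z powr (q - 2) * (sqrt (s z) * sqrt (s z)) = s z powr (q - 1)"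
      using s0[of z] powr_add[of "s z" "q - 2" 1] by simp
    have s3: "s z powr q = s z powr (q - 1) * s z"
      using s0[of z] powr_add[of "s z" "q - 1" 1] by simp
    define \<alpha> where "\<alpha> = ?w z powr p * s z powr (q - 1)"
    define \<beta> where "\<beta> = ?w z powr (p - 1) * s z powr (q - 1)"
    have \<alpha>\<beta>: "0 \<le> \<alpha>" "0 \<le> \<beta>" by (auto simp: \<alpha>_def \<beta>_def)
    \<comment> \<open>The three terms of \<open>I\<close> other than \<open>\<alpha> (ax\<^sup>2 + cx\<^sup>2)\<close> are bounded in turn.\<close>
    have m1: "- (\<alpha> * (a z * axx z + c z * cxx z)) \<le> \<alpha> * (G * F)"
    proof -
      have "- (a z * axx z + c z * cxx z) \<le> G * F"
        using inner_le_sqrt(2)[of "a z" "axx z" "c z" "cxx z"] by (simp add: G_def F_def mult.commute)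
      then show ?thesis using mult_left_mono[OF _ \<alpha>\<beta>(1)] by (metis mult_minus_right)
    qed
    have E0: "\<bar>energy_x a c ax cx z\<bar> \<le> F * sqrt (s z)"
    proof -
      have "\<bar>energy_x a c ax cx z\<bar> \<le> F * sqrt ((ax z)\<^sup>2 + (cx z)\<^sup>2)"
        unfolding energy_x_def F_def by (rule inner_le_sqrt)
      also have "\<dots> \<le> F * sqrt (s z)" using sle F0 by (rule mult_left_mono)
      finally show ?thesis .
    qed
    have E1: "\<bar>energy_x ax cx axx cxx z\<bar> \<le> sqrt (s z) * G"
    proof -
      have "\<bar>energy_x ax cx axx cxx z\<bar> \<le> sqrt ((ax z)\<^sup>2 + (cx z)\<^sup>2) * G"
        unfolding energy_x_def G_def by (rule inner_le_sqrt)
      also have "\<dots> \<le> sqrt (s z) * G" using sle G0 by (rule mult_right_mono)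
      finally show ?thesis .
    qed
    have m2: "- (2 * (q - 1) * (?w z powr p * s z powr (q - 2) * energy_x ax cx axx cxx z * energy_x a c ax cx z))
       \<le> (p - 2) * (\<alpha> * (G * F))"
    proof -
      let ?e = "energy_x ax cx axx cxx z * energy_x a c ax cx z"
      have "\<bar>?e\<bar> \<le> (sqrt (s z) * G) * (F * sqrt (s z))"
        unfolding abs_mult using E0 E1 G0 s0[of z] by (intro mult_mono) auto
      then have "- ?e \<le> (sqrt (s z) * sqrt (s z)) * (G * F)" by (simp add: mult_ac)
      then have "(p - 2) * (?w z powr p * s z powr (q - 2)) * (- ?e)
         \<le> (p - 2) * (?w z powr p * s z powr (q - 2)) * ((sqrt (s z) * sqrt (s z)) * (G * F))"
        using p by (intro mult_left_mono) auto
      also have "\<dots> = (p - 2) * (?w z powr p * (s z powr (q - 2) * (sqrt (s z) * sqrt (s z))) * (G * F))"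
        by (simp only: mult.assoc)
      also have "\<dots> = (p - 2) * (\<alpha> * (G * F))" unfolding s2 \<alpha>_def ..
      finally show ?thesis by (simp add: q_def mult.assoc field_simps)
    qed
    have m3: "2 * p * (Re z * (?w z powr (p - 1) * s z powr (q - 1) * energy_x a c ax cx z))
       \<le> 2 * p * (\<beta> * (F * sqrt (s z)))"
    proof -
      have "\<bar>Re z\<bar> \<le> 1" using abs_Re_le_cmod[of z] z \<rho> by linarith
      then have "\<bar>Re z * energy_x a c ax cx z\<bar> \<le> 1 * (F * sqrt (s z))"
        unfolding abs_mult using E0 by (intro mult_mono) auto
      then have "Re z * energy_x a c ax cx z \<le> F * sqrt (s z)" by linarith
      then have "2 * p * \<beta> * (Re z * energy_x a c ax cx z) \<le> 2 * p * \<beta> * (F * sqrt (s z))"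
        using p \<alpha>\<beta> by (intro mult_left_mono) auto
      then show ?thesis by (simp add: \<beta>_def mult_ac)
    qed
    have \<alpha>e: "\<alpha> * e \<le> e * ?E z"
    proof -
      have "?w z powr p \<le> 1" using w p powr_mono2[of p "?w z" 1] by simp
      moreover have "s z powr (q - 1) \<le> ?E z"
        using p e by (intro powr_mono2) (auto simp: s_def energy_def q_def)
      ultimately have "\<alpha> \<le> 1 * ?E z" unfolding \<alpha>_def by (intro mult_mono) auto
      then show ?thesis using e by (simp add: mult.commute)
    qed
    have "?Y z = \<alpha> * ((ax z)\<^sup>2 + (cx z)\<^sup>2) + \<alpha> * e"
      unfolding s3 \<alpha>_def by (simp add: s_def energy_def algebra_simps)
    also have "\<alpha> * ((ax z)\<^sup>2 + (cx z)\<^sup>2) = I z - \<alpha> * (a z * axx z + c z * cxx z)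
        - 2 * (q - 1) * (?w z powr p * s z powr (q - 2) * energy_x ax cx axx cxx z * energy_x a c ax cx z)
        + 2 * p * (Re z * (?w z powr (p - 1) * s z powr (q - 1) * energy_x a c ax cx z))"
      unfolding I_def \<alpha>_def by (simp add: algebra_simps)
    finally have "?Y z \<le> I z + e * ?E z + (2 * p * (\<beta> * (F * sqrt (s z))) + (p - 1) * (\<alpha> * (G * F)))"
      using m1 m2 m3 \<alpha>e by (simp add: algebra_simps)
    also have "\<beta> * (F * sqrt (s z)) = t powr (p - 1) * F"
      using w s0[of z] powr_add[of "sqrt (s z)" "p - 2" 1] by (simp add: \<beta>_def t_def s1 powr_mult mult_ac)
    also have "\<alpha> * (G * F) = t powr (p - 2) * (((?w z)\<^sup>2 * G) * F)"
      using w s0[of z] powr_add[of "?w z" "p - 2" 2] by (simp add: \<alpha>_def t_def s1 powr_mult mult_ac)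
    also have "2 * p * (t powr (p - 1) * F) + (p - 1) * (t powr (p - 2) * (((?w z)\<^sup>2 * G) * F))
        \<le> 1 / 2 * t powr p + 1 / (4 * C\<^sub>0) * (t powr (p - 2) * ((?w z)\<^sup>2 * G)\<^sup>2) + ?C\<^sub>2 * F powr p"
      using absorb_pointwise[OF p, of t "(?w z)\<^sup>2 * G" F "1 / (4 * C\<^sub>0)"] t0 G0 F0 C0
      unfolding large_p_constant_def Let_def C\<^sub>0_def[symmetric] by simp
    also have "t powr p = ?Y z"
      using w s0[of z] by (simp add: t_def powr_mult sqrt_powr q_def)
    also have "F powr p = ?F z" unfolding F_def q_def by (rule sqrt_powr) simp
    also have "t powr (p - 2) * ((?w z)\<^sup>2 * G)\<^sup>2 \<le> ?T z"
    proof -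
      have "t powr (p - 2) * ((?w z)\<^sup>2 * G)\<^sup>2 = ?w z powr (p + 2) * s z powr (q - 1) * G\<^sup>2"
      proof -
        have "?w z powr (p + 2) = ?w z powr (p - 2) * (?w z) ^ 4"
          using w powr_add[of "?w z" "p - 2" 4] by (simp add: add.commute)
        then show ?thesis using w s0[of z] by (simp add: t_def s1 powr_mult power_mult_distrib mult_ac)
      qed
      also have "\<dots> \<le> ?T z" using hessian_sq_ge[OF lam, of axx z cxx cx]
        by (intro mult_left_mono) (auto simp: G_def)
      finally show ?thesis .
    qed
    finally show "?Y z \<le> I z + e * ?E z + 1 / 2 * ?Y z + 1 / (4 * C\<^sub>0) * ?T z + ?C\<^sub>2 * ?F z"
      using C0 by (simp add: divide_right_mono)
  qed (use I iY iT iE iF in auto)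
  also have "\<dots> = e * K + 1 / 2 * (LINT z|?M. ?Y z) + 1 / (4 * C\<^sub>0) * (LINT z|?M. ?T z) + ?C\<^sub>2 * (LINT z|?M. ?F z)"
    using I iY iT iE iF by (simp add: K_def)
  also have "1 / (4 * C\<^sub>0) * (LINT z|?M. ?T z) \<le> 1 / (4 * C\<^sub>0) * (C\<^sub>0 * (LINT z|?M. ?Y z))"
    using C0 by (intro mult_left_mono caccio) auto
  finally have Y: "(LINT z|?M. ?Y z) \<le> 4 * ?C\<^sub>2 * (LINT z|?M. ?F z) + (4 * K) * e"
    using C0 by (simp add: algebra_simps)
  have "(LINT z|?M. (?w z * sqrt ((ax z)\<^sup>2 + (cx z)\<^sup>2)) powr p) \<le> (LINT z|?M. ?Y z)"
  proof (rule integral_mono)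
    show "integrable ?M (\<lambda>z. (?w z * sqrt ((ax z)\<^sup>2 + (cx z)\<^sup>2)) powr p)"
      using p by (intro integrable_weighted_powr lam continuous_intros axial_pair_continuous_cball[OF P1 \<rho>(2)]) auto
    fix z assume "z \<in> space ?M"
    then have w: "0 < ?w z" by (simp add: disc_weight_pos)
    have "(?w z * sqrt ((ax z)\<^sup>2 + (cx z)\<^sup>2)) powr p \<le> (?w z * sqrt (s z)) powr p"
      using w p e by (intro powr_mono2 mult_left_mono) (auto simp: s_def energy_def)
    also have "\<dots> = ?Y z" using w s0[of z] by (simp add: powr_mult sqrt_powr q_def)
    finally show "(?w z * sqrt ((ax z)\<^sup>2 + (cx z)\<^sup>2)) powr p \<le> ?Y z" .
  qed (rule iY)
  with Y show "(LINT z|?M. (?w z * sqrt ((ax z)\<^sup>2 + (cx z)\<^sup>2)) powr p)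
    \<le> 4 * ?C\<^sub>2 * (LINT z|?M. ((a z)\<^sup>2 + (c z)\<^sup>2) powr (p / 2)) + (4 * K) * e"
    by (simp add: q_def)
qed

section \<open>Smoothing along the axis\<close>

text \<open>The coefficients of the system do not depend on \<open>x\<close>, so averages and differences along horizontal segments
  of solutions are solutions. An average gains a derivative: its \<open>x\<close>-derivative is a difference quotient.\<close>
definition x_average :: "real \<Rightarrow> (complex \<Rightarrow> real) \<Rightarrow> complex \<Rightarrow> real" where
  "x_average h F z = integral {0..h} (\<lambda>s. F (z + of_real s)) / h"

definition x_difference :: "real \<Rightarrow> (complex \<Rightarrow> real) \<Rightarrow> complex \<Rightarrow> real" where
  "x_difference h F z = (F (z + of_real h) - F z) / h"

lemma norm_add_of_real_less: "norm (z::complex) < R - h \<Longrightarrow> 0 \<le> s \<Longrightarrow> s \<le> h \<Longrightarrow> norm (z + of_real s) < R"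
  using norm_triangle_ineq[of z "of_real s"] by (simp del: of_real_add)

lemma continuous_on_shift:
  fixes z :: complex
  assumes "continuous_on (ball 0 R) F" "norm z < R - h"
  shows "continuous_on {0..h} (\<lambda>s. F (z + of_real s))"
  by (rule continuous_on_compose2[OF assms(1)])
    (use norm_add_of_real_less[OF assms(2)] in \<open>auto intro!: continuous_intros\<close>)

lemma continuous_on_x_average:
  assumes F: "continuous_on (ball 0 R) F"
  shows "continuous_on (ball 0 (R - h)) (x_average h F)"
proof -
  have "continuous_on (ball 0 (R - h) \<times> cbox 0 h) (\<lambda>(z, s). F (z + of_real s))"
    unfolding case_prod_unfold
    by (rule continuous_on_compose2[OF F])
      (use norm_add_of_real_less in \<open>auto intro!: continuous_intros\<close>)
  then have "continuous_on (ball 0 (R - h)) (\<lambda>z. integral (cbox 0 h) (\<lambda>s. F (z + of_real s)))"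
    by (rule integral_continuous_on_param)
  then show ?thesis unfolding x_average_def[abs_def] cbox_interval divide_inverse
    by (intro continuous_intros)
qed

lemma x_average_linear:
  assumes "continuous_on {0..h} (\<lambda>s. F (z + of_real s))" "continuous_on {0..h} (\<lambda>s. G (z + of_real s))"
  shows "x_average h (\<lambda>z. F z - k * G z) z = x_average h F z - k * x_average h G z"
  using integrable_continuous_real[OF assms(1)] integrable_continuous_real[OF assms(2)]
  unfolding x_average_def
  by (subst integral_diff) (auto simp: diff_divide_distrib intro: integrable_on_mult_right)

lemma x_average_close:
  assumes h: "0 < h" and cont: "continuous_on {0..h} (\<lambda>s. F (z + of_real s))"
    and bd: "\<And>s. 0 \<le> s \<Longrightarrow> s \<le> h \<Longrightarrow> \<bar>F (z + of_real s) - v\<bar> \<le> \<epsilon>"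
  shows "\<bar>x_average h F z - v\<bar> \<le> \<epsilon>"
proof -
  have "norm (integral {0..h} (\<lambda>s. F (z + of_real s) - v)) \<le> \<epsilon> * (h - 0)"
    using h bd by (intro integral_bound continuous_intros cont) auto
  also have "integral {0..h} (\<lambda>s. F (z + of_real s) - v) = integral {0..h} (\<lambda>s. F (z + of_real s)) - h * v"
    using h by (subst integral_diff) (auto intro!: integrable_continuous_real cont)
  finally have "norm (integral {0..h} (\<lambda>s. F (z + of_real s)) - h * v) \<le> \<epsilon> * (h - 0)" .
  then have "\<bar>(x_average h F z - v) * h\<bar> \<le> \<epsilon> * h" using h by (simp add: x_average_def algebra_simps)
  then show ?thesis using h by (simp add: abs_mult)
qed

text \<open>Differentiation under the integral sign along a curve \<open>\<gamma>\<close>. The set \<open>S\<close> is the whole disc for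
  horizontal lines, but has to avoid the axis for vertical ones.\<close>
lemma x_average_derivative_along:
  fixes \<gamma> :: "real \<Rightarrow> complex"
  assumes W: "open W" "t\<^sub>0 \<in> W" and \<gamma>: "continuous_on W \<gamma>"
    and F: "continuous_on S F" "continuous_on S F'"
    and in_S: "\<And>t s. t \<in> W \<Longrightarrow> 0 \<le> s \<Longrightarrow> s \<le> h \<Longrightarrow> \<gamma> t + of_real s \<in> S"
    and der: "\<And>t s. t \<in> W \<Longrightarrow> 0 \<le> s \<Longrightarrow> s \<le> h \<Longrightarrow>
      ((\<lambda>t. F (\<gamma> t + of_real s)) has_real_derivative F' (\<gamma> t + of_real s)) (at t)"
  shows "((\<lambda>t. x_average h F (\<gamma> t)) has_real_derivative x_average h F' (\<gamma> t\<^sub>0)) (at t\<^sub>0)"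
proof -
  obtain e where e: "0 < e" "ball t\<^sub>0 e \<subseteq> W" using W by (meson openE)
  have U: "t\<^sub>0 \<in> ball t\<^sub>0 e" using e by simp
  have "((\<lambda>t. integral (cbox 0 h) (\<lambda>s. F (\<gamma> t + of_real s))) has_field_derivative
      integral (cbox 0 h) (\<lambda>s. F' (\<gamma> t\<^sub>0 + of_real s))) (at t\<^sub>0 within ball t\<^sub>0 e)"
  proof (rule leibniz_rule_field_derivative[OF _ _ _ U convex_ball])
    fix t assume t: "t \<in> ball t\<^sub>0 e"
    show "((\<lambda>t. F (\<gamma> t + of_real s)) has_real_derivative F' (\<gamma> t + of_real s)) (at t within ball t\<^sub>0 e)"
      if "s \<in> cbox 0 h" for s
      by (rule has_field_derivative_at_within[OF der]) (use t that e(2) in auto)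
    show "(\<lambda>s. F (\<gamma> t + of_real s)) integrable_on cbox 0 h"
      using in_S[of t] t e by (intro integrable_continuous continuous_on_compose2[OF F(1)] continuous_intros) auto
  next
    show "continuous_on (ball t\<^sub>0 e \<times> cbox 0 h) (\<lambda>(t, s). F' (\<gamma> t + of_real s))"
      unfolding case_prod_unfold using in_S e
      by (intro continuous_on_compose2[OF F(2)] continuous_on_add continuous_on_compose2[OF \<gamma>] continuous_intros)
        (auto simp: subset_eq)
  qed
  then have "((\<lambda>t. integral {0..h} (\<lambda>s. F (\<gamma> t + of_real s)) / h) has_field_derivative
      integral {0..h} (\<lambda>s. F' (\<gamma> t\<^sub>0 + of_real s)) / h) (at t\<^sub>0)"
    using at_within_open[OF U open_ball] by (intro DERIV_cdivide) (simp add: cbox_interval)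
  then show ?thesis by (simp add: x_average_def)
qed

lemma x_average_derivative_x:
  assumes z: "norm z < R - h"
    and F: "continuous_on (ball 0 R) F" "continuous_on (ball 0 R) F'"
    and der: "\<And>z. norm z < R \<Longrightarrow> ((\<lambda>t. F (Complex t (Im z))) has_real_derivative F' z) (at (Re z))"
  shows "((\<lambda>t. x_average h F (Complex t (Im z))) has_real_derivative x_average h F' z) (at (Re z))"
proof -
  have eq: "Complex t (Im z) + of_real s = Complex (t + s) (Im z)" for t s by (simp add: complex_eq_iff)
  let ?W = "{t. norm (Complex t (Im z)) < R - h}"
  have "((\<lambda>t. x_average h F (Complex t (Im z))) has_real_derivative
      x_average h F' (Complex (Re z) (Im z))) (at (Re z))"
  proof (rule x_average_derivative_along[where W="?W", OF _ _ _ F])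
    show "open ?W" by (intro open_Collect_less continuous_intros)
    fix t s assume ts: "t \<in> ?W" "0 \<le> s" "s \<le> h"
    then show ball: "Complex t (Im z) + of_real s \<in> ball 0 R"
      using norm_add_of_real_less[of "Complex t (Im z)" R h s] by simp
    show "((\<lambda>t. F (Complex t (Im z) + of_real s)) has_real_derivative F' (Complex t (Im z) + of_real s)) (at t)"
      using der[of "Complex (t + s) (Im z)"] ball DERIV_shift[of "\<lambda>t. F (Complex t (Im z))" _ t s] by (simp add: eq)
  qed (use z in \<open>auto intro!: continuous_intros\<close>)
  then show ?thesis by simp
qed

lemma x_average_derivative_y:
  assumes z: "norm z < R - h" "Im z \<noteq> 0"
    and F: "continuous_on (ball 0 R \<inter> {z. Im z \<noteq> 0}) F" "continuous_on (ball 0 R \<inter> {z. Im z \<noteq> 0}) F'"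
    and der: "\<And>z. norm z < R \<Longrightarrow> Im z \<noteq> 0 \<Longrightarrow>
                ((\<lambda>t. F (Complex (Re z) t)) has_real_derivative F' z) (at (Im z))"
  shows "((\<lambda>t. x_average h F (Complex (Re z) t)) has_real_derivative x_average h F' z) (at (Im z))"
proof -
  have eq: "Complex (Re z) t + of_real s = Complex (Re z + s) t" for t s by (simp add: complex_eq_iff)
  let ?W = "{t. norm (Complex (Re z) t) < R - h} \<inter> {t. t \<noteq> 0}"
  have "((\<lambda>t. x_average h F (Complex (Re z) t)) has_real_derivative
      x_average h F' (Complex (Re z) (Im z))) (at (Im z))"
  proof (rule x_average_derivative_along[where W="?W", OF _ _ _ F])
    show "open ?W" by (intro open_Int open_Collect_less open_Collect_neq continuous_intros)
    fix t s assume ts: "t \<in> ?W" "0 \<le> s" "s \<le> h"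
    then show ball: "Complex (Re z) t + of_real s \<in> ball 0 R \<inter> {z. Im z \<noteq> 0}"
      using norm_add_of_real_less[of "Complex (Re z) t" R h s] by simp
    then show "((\<lambda>t. F (Complex (Re z) t + of_real s)) has_real_derivative F' (Complex (Re z) t + of_real s)) (at t)"
      using der[of "Complex (Re z + s) t"] by (simp add: eq)
  qed (use z in \<open>auto intro!: continuous_intros\<close>)
  then show ?thesis by simp
qed

lemma x_average_derivative_eq_difference:
  assumes h: "0 < h" and z: "norm z < R - h"
    and der: "\<And>z. norm z < R \<Longrightarrow> ((\<lambda>t. F (Complex t (Im z))) has_real_derivative F' z) (at (Re z))"
  shows "x_average h F' z = x_difference h F z"
proof -
  have eq: "z + of_real s = Complex (Re z + s) (Im z)" for s by (simp add: complex_eq_iff)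
  have "((\<lambda>s. F' (z + of_real s)) has_integral (F (z + of_real h) - F (z + of_real 0))) {0..h}"
  proof (rule fundamental_theorem_of_calculus)
    fix s assume s: "s \<in> {0..h}"
    have "((\<lambda>t. F (Complex t (Im z))) has_real_derivative F' (z + of_real s)) (at (s + Re z))"
      using der[of "z + of_real s"] norm_add_of_real_less[OF z] s by (simp add: add.commute)
    then have "((\<lambda>t. F (Complex (t + Re z) (Im z))) has_real_derivative F' (z + of_real s)) (at s)"
      using DERIV_shift[of "\<lambda>t. F (Complex t (Im z))" _ s "Re z"] by simp
    then show "((\<lambda>s. F (z + of_real s)) has_vector_derivative F' (z + of_real s)) (at s within {0..h})"
      by (simp add: eq add.commute has_real_derivative_iff_has_vector_derivative[symmetric]
          has_field_derivative_at_within)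
  qed (use h in auto)
  then show ?thesis by (simp add: x_average_def x_difference_def integral_unique)
qed

lemma axial_pair_cong:
  assumes P: "axial_pair lam R a c ax cx"
    and eq: "\<And>z. norm z < R \<Longrightarrow> a' z = a z \<and> c' z = c z \<and> ax' z = ax z \<and> cx' z = cx z"
  shows "axial_pair lam R a' c' ax' cx'"
proof -
  have op: "open {t. norm (Complex t y) < R}" "open {t. norm (Complex y t) < R}" for y
    by (auto intro!: open_Collect_less continuous_intros)
  show ?thesis unfolding axial_pair_def
  proof (intro conjI ballI allI impI)
    show "continuous_on (ball 0 R) a'" "continuous_on (ball 0 R) c'"
      "continuous_on (ball 0 R) ax'" "continuous_on (ball 0 R) cx'"
      by (rule continuous_on_eq[OF axial_pairD(1)[OF P]] continuous_on_eq[OF axial_pairD(2)[OF P]]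
          continuous_on_eq[OF axial_pairD(3)[OF P]] continuous_on_eq[OF axial_pairD(4)[OF P]]; simp add: eq)+
    fix z :: complex assume "z \<in> ball 0 R"
    then have z: "norm z < R" by simp
    show "((\<lambda>t. a' (Complex t (Im z))) has_real_derivative ax' z) (at (Re z))"
      using axial_pairD(5)[OF P z] unfolding eq[OF z, THEN conjunct2, THEN conjunct2, THEN conjunct1]
      by (rule has_field_derivative_transform_within_open[OF _ op(1)[of "Im z"]]) (auto simp: eq z)
    show "((\<lambda>t. c' (Complex t (Im z))) has_real_derivative cx' z) (at (Re z))"
      using axial_pairD(6)[OF P z] unfolding eq[OF z, THEN conjunct2, THEN conjunct2, THEN conjunct2]
      by (rule has_field_derivative_transform_within_open[OF _ op(1)[of "Im z"]]) (auto simp: eq z)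
    show "c' z = 0" if "Im z = 0" using axial_pairD(9)[OF P z that] eq[OF z] by simp
    assume y: "Im z \<noteq> 0"
    have e: "- cx' z = - cx z" "ax' z - 2 * lam * (c' z / Im z) = ax z - 2 * lam * (c z / Im z)"
      using eq[OF z] by auto
    show "((\<lambda>t. a' (Complex (Re z) t)) has_real_derivative - cx' z) (at (Im z))"
      using axial_pairD(7)[OF P z y] unfolding e
      by (rule has_field_derivative_transform_within_open[OF _ op(2)[of "Re z"]]) (auto simp: eq z)
    show "((\<lambda>t. c' (Complex (Re z) t)) has_real_derivative ax' z - 2 * lam * (c' z / Im z)) (at (Im z))"
      using axial_pairD(8)[OF P z y] unfolding e
      by (rule has_field_derivative_transform_within_open[OF _ op(2)[of "Re z"]]) (auto simp: eq z)
  next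
    fix r assume "r < R"
    then obtain K where "\<forall>z\<in>ball 0 r. \<bar>c z\<bar> \<le> K * \<bar>Im z\<bar>" using axial_pairD(10)[OF P] by auto
    then show "\<exists>K. \<forall>z\<in>ball 0 r. \<bar>c' z\<bar> \<le> K * \<bar>Im z\<bar>" using eq \<open>r < R\<close> by (intro exI[of _ K]) auto
  qed
qed

lemma axial_pair_x_average:
  assumes P: "axial_pair lam R a c ax cx" and h: "0 < h"
  shows "axial_pair lam (R - h) (x_average h a) (x_average h c) (x_average h ax) (x_average h cx)"
  unfolding axial_pair_def
proof (intro conjI ballI allI impI)
  note D = axial_pairD[OF P]
  show "continuous_on (ball 0 (R - h)) (x_average h a)" "continuous_on (ball 0 (R - h)) (x_average h c)"
    "continuous_on (ball 0 (R - h)) (x_average h ax)" "continuous_on (ball 0 (R - h)) (x_average h cx)"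
    by (intro continuous_on_x_average D(1-4))+
  fix z :: complex assume "z \<in> ball 0 (R - h)"
  then have z: "norm z < R - h" by simp
  show "((\<lambda>t. x_average h a (Complex t (Im z))) has_real_derivative x_average h ax z) (at (Re z))"
    by (rule x_average_derivative_x[OF z D(1,3,5)])
  show "((\<lambda>t. x_average h c (Complex t (Im z))) has_real_derivative x_average h cx z) (at (Re z))"
    by (rule x_average_derivative_x[OF z D(2,4,6)])
  show "x_average h c z = 0" if "Im z = 0"
  proof -
    have "integral {0..h} (\<lambda>s. c (z + of_real s)) = integral {0..h} (\<lambda>s. 0)"
      using norm_add_of_real_less[OF z] D(9) that by (intro integral_cong) auto
    then show ?thesis by (simp add: x_average_def)
  qed
  assume y: "Im z \<noteq> 0"
  have neg: "x_average h (\<lambda>z. - F z) z = - x_average h F z" for F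
    by (simp add: x_average_def)
  have "((\<lambda>t. x_average h a (Complex (Re z) t)) has_real_derivative x_average h (\<lambda>z. - cx z) z) (at (Im z))"
    by (rule x_average_derivative_y[OF z y _ _ D(7)])
      (auto intro!: continuous_intros continuous_on_subset[OF D(1)] continuous_on_subset[OF D(4)])
  then show "((\<lambda>t. x_average h a (Complex (Re z) t)) has_real_derivative - x_average h cx z) (at (Im z))"
    unfolding neg .
  have "((\<lambda>t. x_average h c (Complex (Re z) t)) has_real_derivative
      x_average h (\<lambda>z. ax z - 2 * lam * (c z / Im z)) z) (at (Im z))"
    by (rule x_average_derivative_y[OF z y _ _ D(8)])
      (auto intro!: continuous_intros continuous_on_subset[OF D(3)] continuous_on_subset[OF D(2)])
  also have "x_average h (\<lambda>z. ax z - 2 * lam * (c z / Im z)) z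
      = x_average h ax z - 2 * lam * x_average h (\<lambda>z. c z / Im z) z"
    using y by (intro x_average_linear continuous_on_shift[OF D(3) z] continuous_on_divide
        continuous_on_shift[OF D(2) z] continuous_intros) auto
  also have "x_average h (\<lambda>z. c z / Im z) z = x_average h c z / Im z"
    by (simp add: x_average_def)
  finally show "((\<lambda>t. x_average h c (Complex (Re z) t)) has_real_derivative
      x_average h ax z - 2 * lam * (x_average h c z / Im z)) (at (Im z))" .
next
  note D = axial_pairD[OF P]
  fix r assume "r < R - h"
  then obtain K where K: "\<forall>z\<in>ball 0 (r + h). \<bar>c z\<bar> \<le> K * \<bar>Im z\<bar>" using D(10)[of "r + h"] by auto
  have "\<bar>x_average h c z\<bar> \<le> K * \<bar>Im z\<bar>" if "z \<in> ball 0 r" for z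
  proof -
    have "\<bar>x_average h c z - 0\<bar> \<le> K * \<bar>Im z\<bar>"
    proof (rule x_average_close[OF h])
      show "continuous_on {0..h} (\<lambda>s. c (z + of_real s))"
        by (rule continuous_on_shift[OF D(2)]) (use that \<open>r < R - h\<close> in auto)
      fix s assume "0 \<le> s" "s \<le> h"
      then have "z + of_real s \<in> ball 0 (r + h)"
        using norm_add_of_real_less[of z "r + h" h s] that by auto
      then show "\<bar>c (z + of_real s) - 0\<bar> \<le> K * \<bar>Im z\<bar>" using K by fastforce
    qed
    then show ?thesis by simp
  qed
  then show "\<exists>K. \<forall>z\<in>ball 0 r. \<bar>x_average h c z\<bar> \<le> K * \<bar>Im z\<bar>" by blast
qed

lemma axial_pair_x_difference:
  assumes P: "axial_pair lam R a c ax cx" and h: "0 < h"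
  shows "axial_pair lam (R - h) (x_difference h a) (x_difference h c) (x_difference h ax) (x_difference h cx)"
  unfolding axial_pair_def
proof (intro conjI ballI allI impI)
  note D = axial_pairD[OF P]
  have cont: "continuous_on (ball 0 (R - h)) (x_difference h F)" if F: "continuous_on (ball 0 R) F" for F
    unfolding x_difference_def[abs_def] divide_inverse
    using norm_add_of_real_less[of _ R h h] h
    by (intro continuous_intros continuous_on_compose2[OF F] continuous_on_subset[OF F]) auto
  show "continuous_on (ball 0 (R - h)) (x_difference h a)" "continuous_on (ball 0 (R - h)) (x_difference h c)"
    "continuous_on (ball 0 (R - h)) (x_difference h ax)" "continuous_on (ball 0 (R - h)) (x_difference h cx)"
    by (intro cont D(1-4))+
  fix z :: complex assume "z \<in> ball 0 (R - h)"
  then have z: "norm z < R" "norm (z + of_real h) < R"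
    using norm_add_of_real_less[of z R h h] h by auto
  have eq: "Complex t (Im z) + of_real h = Complex (t + h) (Im z)"
    "Complex (Re z) t + of_real h = Complex (Re (z + of_real h)) t" for t by (auto simp: complex_eq_iff)
  have dx: "((\<lambda>t. x_difference h F (Complex t (Im z))) has_real_derivative x_difference h F' z) (at (Re z))"
    if "\<And>z. norm z < R \<Longrightarrow> ((\<lambda>t. F (Complex t (Im z))) has_real_derivative F' z) (at (Re z))" for F F'
  proof -
    have "((\<lambda>t. F (Complex (t + h) (Im z))) has_real_derivative F' (z + of_real h)) (at (Re z))"
      using that[OF z(2)] DERIV_shift[of "\<lambda>t. F (Complex t (Im z))" _ "Re z" h] by simp
    then show ?thesis unfolding x_difference_def eq
      by (intro DERIV_cdivide DERIV_diff that[OF z(1)])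
  qed
  show "((\<lambda>t. x_difference h a (Complex t (Im z))) has_real_derivative x_difference h ax z) (at (Re z))"
    "((\<lambda>t. x_difference h c (Complex t (Im z))) has_real_derivative x_difference h cx z) (at (Re z))"
    by (intro dx D(5,6); assumption)+
  show "x_difference h c z = 0" if "Im z = 0"
    using D(9)[OF z(1)] D(9)[OF z(2)] that by (simp add: x_difference_def)
  assume y: "Im z \<noteq> 0"
  then have y': "Im (z + of_real h) \<noteq> 0" by simp
  show "((\<lambda>t. x_difference h a (Complex (Re z) t)) has_real_derivative - x_difference h cx z) (at (Im z))"
    unfolding x_difference_def eq using D(7)[OF z(2) y'] 
    by (intro DERIV_cong[OF DERIV_cdivide[OF DERIV_diff[OF _ D(7)[OF z(1) y]]]]) (auto simp: diff_divide_distrib)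
  show "((\<lambda>t. x_difference h c (Complex (Re z) t)) has_real_derivative
      x_difference h ax z - 2 * lam * (x_difference h c z / Im z)) (at (Im z))"
    unfolding x_difference_def eq using D(8)[OF z(2) y'] h y
    by (intro DERIV_cong[OF DERIV_cdivide[OF DERIV_diff[OF _ D(8)[OF z(1) y]]]]) (auto simp: field_simps)
next
  note D = axial_pairD[OF P]
  fix r assume "r < R - h"
  then obtain K where K: "\<forall>z\<in>ball 0 (r + h). \<bar>c z\<bar> \<le> K * \<bar>Im z\<bar>" using D(10)[of "r + h"] by auto
  have "\<bar>x_difference h c z\<bar> \<le> (2 * K / h) * \<bar>Im z\<bar>" if "z \<in> ball 0 r" for z
  proof -
    have "z + of_real h \<in> ball 0 (r + h)" "z \<in> ball 0 (r + h)"
      using norm_add_of_real_less[of z "r + h" h h] that h by auto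
    then have "\<bar>c (z + of_real h)\<bar> \<le> K * \<bar>Im z\<bar>" "\<bar>c z\<bar> \<le> K * \<bar>Im z\<bar>"
      using K by fastforce+
    then have "\<bar>c (z + of_real h) - c z\<bar> \<le> 2 * K * \<bar>Im z\<bar>" by linarith
    then show ?thesis using h by (simp add: x_difference_def divide_right_mono)
  qed
  then show "\<exists>K. \<forall>z\<in>ball 0 r. \<bar>x_difference h c z\<bar> \<le> K * \<bar>Im z\<bar>" by blast
qed

text \<open>Two averages \<open>S\<close> suffice for three derivatives: the \<open>x\<close>-derivatives of \<open>S F\<close> are an average of a
  difference, then the second difference quotient \<open>D F\<close>, and finally that of the derivative of \<open>F\<close>.\<close>
lemma axial_pair_smoothing:
  assumes P: "axial_pair lam R a c ax cx" and h: "0 < h"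
  defines "S \<equiv> \<lambda>F. x_average h (x_average h F)" and "D \<equiv> \<lambda>F. x_difference h (x_difference h F)"
  shows "axial_pair lam (R - 2 * h) (S a) (S c) (S ax) (S cx)"
    "axial_pair lam (R - 2 * h) (S ax) (S cx) (D a) (D c)"
    "axial_pair lam (R - 2 * h) (D a) (D c) (D ax) (D cx)"
proof -
  have R: "R - h - h = R - 2 * h" by simp
  note A = axial_pair_x_average[OF P h]
  show "axial_pair lam (R - 2 * h) (S a) (S c) (S ax) (S cx)"
    using axial_pair_x_average[OF A h] by (simp add: S_def R)
  show "axial_pair lam (R - 2 * h) (D a) (D c) (D ax) (D cx)"
    using axial_pair_x_difference[OF axial_pair_x_difference[OF P h] h] by (simp add: D_def R)
  have "axial_pair lam (R - h) (x_average h a) (x_average h c) (x_difference h a) (x_difference h c)"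
    by (rule axial_pair_cong[OF A]) 
      (simp add: x_average_derivative_eq_difference[OF h _ axial_pairD(5)[OF P]]
        x_average_derivative_eq_difference[OF h _ axial_pairD(6)[OF P]])
  from axial_pair_x_difference[OF this h]
  show "axial_pair lam (R - 2 * h) (S ax) (S cx) (D a) (D c)"
    unfolding R
  proof (rule axial_pair_cong)
    fix z :: complex assume "norm z < R - 2 * h"
    then have z: "norm z < R - h - h" by simp
    show "S ax z = x_difference h (x_average h a) z \<and> S cx z = x_difference h (x_average h c) z \<and>
        D a z = x_difference h (x_difference h a) z \<and> D c z = x_difference h (x_difference h c) z"
      unfolding S_def D_def
      using x_average_derivative_eq_difference[OF h z axial_pairD(5)[OF A]]
        x_average_derivative_eq_difference[OF h z axial_pairD(6)[OF A]] by simp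
  qed
qed

section \<open>Estimates on the unit disk\<close>

lemma x_average_twice_close:
  fixes z :: complex
  assumes h: "0 < h" and z: "norm z < R - 2 * h" and F: "continuous_on (ball 0 R) F"
    and bd: "\<And>s. 0 \<le> s \<Longrightarrow> s \<le> 2 * h \<Longrightarrow> \<bar>F (z + of_real s) - v\<bar> \<le> \<epsilon>"
  shows "\<bar>x_average h (x_average h F) z - v\<bar> \<le> \<epsilon>"
proof (rule x_average_close[OF h])
  show "continuous_on {0..h} (\<lambda>s. x_average h F (z + of_real s))"
    by (rule continuous_on_shift[OF continuous_on_x_average[OF F]]) (use z in simp)
  fix s assume s: "0 \<le> s" "s \<le> h"
  show "\<bar>x_average h F (z + of_real s) - v\<bar> \<le> \<epsilon>"
  proof (rule x_average_close[OF h])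
    show "continuous_on {0..h} (\<lambda>t. F (z + of_real s + of_real t))"
      using norm_add_of_real_less[of z "R - h" h s] z s by (intro continuous_on_shift[OF F]) auto
    show "\<bar>F (z + of_real s + of_real t) - v\<bar> \<le> \<epsilon>" if "0 \<le> t" "t \<le> h" for t
      using bd[of "s + t"] s that by (simp add: add.assoc)
  qed
qed

text \<open>The step lengths are small enough for all averages to stay in the disc of radius \<open>(R + \<rho>) / 2\<close>, on which
  \<open>F\<close> is bounded.\<close>
lemma smoothing_bounded_convergent:
  assumes F: "continuous_on (ball 0 R) F" and \<rho>: "\<rho> < R"
  defines "h \<equiv> \<lambda>n. (R - \<rho>) / (4 * real (Suc n))"
  shows "\<exists>K. \<forall>n. \<forall>z\<in>cball 0 \<rho>. \<bar>x_average (h n) (x_average (h n) F) z\<bar> \<le> K"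
    and "\<And>z. z \<in> cball 0 \<rho> \<Longrightarrow> (\<lambda>n. x_average (h n) (x_average (h n) F) z) \<longlonglongrightarrow> F z"
proof -
  have h: "0 < h n" "2 * h n \<le> (R - \<rho>) / 2" for n
  proof -
    show "0 < h n" using \<rho> by (simp add: h_def)
    have "h n \<le> (R - \<rho>) / 4" unfolding h_def using \<rho> by (intro divide_left_mono) auto
    then show "2 * h n \<le> (R - \<rho>) / 2" by simp
  qed
  have zh: "norm z < R - 2 * h n" if "z \<in> cball 0 \<rho>" for z n
  proof -
    have "norm z \<le> \<rho>" using that by simp
    then show ?thesis using h(2)[of n] \<rho> by argo
  qed
  define r where "r = (R + \<rho>) / 2"
  have r: "r < R" using \<rho> by (simp add: r_def)
  have "bounded (F ` cball 0 r)"
    by (intro compact_imp_bounded compact_continuous_image compact_cball continuous_on_subset[OF F]) (use r in auto)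
  then obtain K where K: "\<forall>z\<in>cball 0 r. \<bar>F z\<bar> \<le> K" by (auto simp: bounded_iff)
  show "\<exists>K. \<forall>n. \<forall>z\<in>cball 0 \<rho>. \<bar>x_average (h n) (x_average (h n) F) z\<bar> \<le> K"
  proof (intro exI[of _ K] allI ballI)
    fix n and z :: complex assume z: "z \<in> cball 0 \<rho>"
    have "\<bar>x_average (h n) (x_average (h n) F) z - 0\<bar> \<le> K"
    proof (rule x_average_twice_close[OF h(1) zh[OF z] F])
      fix s assume s: "0 \<le> s" "s \<le> 2 * h n"
      have "norm (z + of_real s) \<le> norm z + s" using norm_triangle_ineq[of z "of_real s"] s by simp
      also have "\<dots> \<le> r" using z s(2) h(2)[of n] by (simp add: r_def)
      finally show "\<bar>F (z + of_real s) - 0\<bar> \<le> K" using K by simp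
    qed
    then show "\<bar>x_average (h n) (x_average (h n) F) z\<bar> \<le> K" by simp
  qed
  fix z :: complex assume z: "z \<in> cball 0 \<rho>"
  then have "isCont F z" using F \<rho> by (auto simp: continuous_on_eq_continuous_at)
  have h0: "h \<longlonglongrightarrow> 0"
    using tendsto_mult_right_zero[OF LIMSEQ_inverse_real_of_nat, of "(R - \<rho>) / 4"]
    by (simp add: h_def[abs_def] field_simps)
  show "(\<lambda>n. x_average (h n) (x_average (h n) F) z) \<longlonglongrightarrow> F z"
  proof (rule tendstoI)
    fix e :: real assume e: "0 < e"
    obtain d where d: "0 < d" "\<And>x. dist x z < d \<Longrightarrow> dist (F x) (F z) < e / 2"
      using \<open>isCont F z\<close> e unfolding continuous_at_eps_delta by (metis half_gt_zero)
    have "\<forall>\<^sub>F n in sequentially. h n < d / 2"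
      using order_tendstoD(2)[OF h0, of "d / 2"] d by simp
    then show "\<forall>\<^sub>F n in sequentially. dist (x_average (h n) (x_average (h n) F) z) (F z) < e"
    proof eventually_elim
      case (elim n)
      have "\<bar>x_average (h n) (x_average (h n) F) z - F z\<bar> \<le> e / 2"
      proof (rule x_average_twice_close[OF h(1) zh[OF z] F])
        fix s assume "0 \<le> s" "s \<le> 2 * h n"
        then have "dist (z + of_real s) z < d" using elim by (simp add: dist_norm)
        from d(2)[OF this] show "\<bar>F (z + of_real s) - F z\<bar> \<le> e / 2" by (simp add: dist_real_def)
      qed
      then show ?case using e by (simp add: dist_real_def)
    qed
  qed
qed

lemma integral_smoothing_tendsto:
  fixes \<Phi> :: "complex \<times> real \<times> real \<times> real \<times> real \<Rightarrow> real"
  assumes \<Phi>: "continuous_on (cball 0 \<rho> \<times> UNIV) \<Phi>" and P: "axial_pair lam R a c ax cx"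
    and \<rho>: "\<rho> < R" and lam: "0 \<le> lam"
  defines "S \<equiv> \<lambda>n F. x_average ((R - \<rho>) / (4 * real (Suc n))) (x_average ((R - \<rho>) / (4 * real (Suc n))) F)"
  shows "(\<lambda>n. LINT z|axial_measure lam \<rho>. \<Phi> (z, S n a z, S n c z, S n ax z, S n cx z))
     \<longlonglongrightarrow> (LINT z|axial_measure lam \<rho>. \<Phi> (z, a z, c z, ax z, cx z))"
proof -
  note sc = smoothing_bounded_convergent[OF _ \<rho>, folded S_def]
  note D = axial_pairD(1-4)[OF P]
  obtain K1 where K1: "\<forall>n. \<forall>z\<in>cball 0 \<rho>. \<bar>S n a z\<bar> \<le> K1" using sc(1)[OF D(1)] unfolding S_def by auto
  obtain K2 where K2: "\<forall>n. \<forall>z\<in>cball 0 \<rho>. \<bar>S n c z\<bar> \<le> K2" using sc(1)[OF D(2)] unfolding S_def by auto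
  obtain K3 where K3: "\<forall>n. \<forall>z\<in>cball 0 \<rho>. \<bar>S n ax z\<bar> \<le> K3" using sc(1)[OF D(3)] unfolding S_def by auto
  obtain K4 where K4: "\<forall>n. \<forall>z\<in>cball 0 \<rho>. \<bar>S n cx z\<bar> \<le> K4" using sc(1)[OF D(4)] unfolding S_def by auto
  let ?B = "cball (0::complex) \<rho> \<times> {-K1..K1} \<times> {-K2..K2} \<times> {-K3..K3} \<times> {-K4..K4}"
  have "compact ?B" by (intro compact_Times compact_cball compact_Icc)
  moreover have "continuous_on ?B \<Phi>" by (rule continuous_on_subset[OF \<Phi>]) auto
  ultimately have "bounded (\<Phi> ` ?B)" by (intro compact_imp_bounded compact_continuous_image)
  then obtain K where K: "\<forall>u\<in>?B. \<bar>\<Phi> u\<bar> \<le> K" by (auto simp: bounded_iff)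
  have meas: "(\<lambda>z. \<Phi> (z, a' z, c' z, x' z, y' z)) \<in> borel_measurable (axial_measure lam \<rho>)"
    if "continuous_on (ball 0 \<rho>) a'" "continuous_on (ball 0 \<rho>) c'" "continuous_on (ball 0 \<rho>) x'" "continuous_on (ball 0 \<rho>) y'"
    for a' c' x' y'
    by (intro borel_measurable_axial_continuous continuous_on_compose2[OF \<Phi>] continuous_intros that) auto
  have contS: "continuous_on (ball 0 \<rho>) (S n F)" if "continuous_on (ball 0 R) F" for n F
  proof -
    let ?h = "(R - \<rho>) / (4 * real (Suc n))"
    have "?h \<le> (R - \<rho>) / 4" using \<rho> by (intro divide_left_mono) auto
    then have "\<rho> \<le> R - ?h - ?h" using \<rho> by argo
    then have "ball 0 \<rho> \<subseteq> ball (0::complex) (R - ?h - ?h)" by (rule subset_ball)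
    then show ?thesis unfolding S_def
      by (rule continuous_on_subset[OF continuous_on_x_average[OF continuous_on_x_average[OF that]]])
  qed
  have sub: "continuous_on (ball 0 \<rho>) F" if "continuous_on (ball 0 R) F" for F :: "complex \<Rightarrow> real"
    by (rule continuous_on_subset[OF that]) (use \<rho> in auto)
  interpret finite_measure "axial_measure lam \<rho>" by (rule finite_measure_axial[OF lam])
  show ?thesis
  proof (rule integral_dominated_convergence[where w="\<lambda>_. K"])
    show "(\<lambda>z. \<Phi> (z, a z, c z, ax z, cx z)) \<in> borel_measurable (axial_measure lam \<rho>)"
      by (intro meas sub D)
    show "(\<lambda>z. \<Phi> (z, S n a z, S n c z, S n ax z, S n cx z)) \<in> borel_measurable (axial_measure lam \<rho>)" for n
      by (intro meas contS D)
    show "AE z in axial_measure lam \<rho>. norm (\<Phi> (z, S n a z, S n c z, S n ax z, S n cx z)) \<le> K" for n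
    proof (rule AE_I2)
      fix z assume "z \<in> space (axial_measure lam \<rho>)"
      then have z: "z \<in> cball 0 \<rho>" by simp
      have "(z, S n a z, S n c z, S n ax z, S n cx z) \<in> ?B"
        using z K1 K2 K3 K4 by (auto simp: abs_le_iff minus_le_iff)
      then show "norm (\<Phi> (z, S n a z, S n c z, S n ax z, S n cx z)) \<le> K" using K by fastforce
    qed
    show "AE z in axial_measure lam \<rho>. (\<lambda>n. \<Phi> (z, S n a z, S n c z, S n ax z, S n cx z))
        \<longlonglongrightarrow> \<Phi> (z, a z, c z, ax z, cx z)"
    proof (rule AE_I2)
      fix z assume "z \<in> space (axial_measure lam \<rho>)"
      then have z: "z \<in> cball 0 \<rho>" by simp
      have "(\<lambda>n. (z, S n a z, S n c z, S n ax z, S n cx z)) \<longlonglongrightarrow> (z, a z, c z, ax z, cx z)"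
        using sc(2)[OF D(1) z] sc(2)[OF D(2) z] sc(2)[OF D(3) z] sc(2)[OF D(4) z]
        unfolding S_def by (intro tendsto_intros)
      then show "(\<lambda>n. \<Phi> (z, S n a z, S n c z, S n ax z, S n cx z)) \<longlonglongrightarrow> \<Phi> (z, a z, c z, ax z, cx z)"
        by (rule continuous_on_tendsto_compose[OF \<Phi>]) (use z in auto)
    qed
  qed simp
qed

definition derivative_constant :: "real \<Rightarrow> real \<Rightarrow> real" where
  "derivative_constant lam p =
     (if p \<le> 2 then 16 * (2 + 2 * lam)\<^sup>2 + 1 else 4 * large_p_constant lam p)"

text \<open>An inequality between integrals of continuous expressions in \<open>z\<close>, a pair and its \<open>x\<close>-derivatives only
  has to be shown for pairs that can be differentiated three times.\<close>
lemma estimate_by_smoothing: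
  fixes \<Phi> \<Psi> :: "complex \<times> real \<times> real \<times> real \<times> real \<Rightarrow> real"
  assumes cont: "continuous_on (cball 0 \<rho> \<times> UNIV) \<Phi>" "continuous_on (cball 0 \<rho> \<times> UNIV) \<Psi>"
    and P: "axial_pair lam R a c ax cx" and \<rho>: "\<rho> < R" and lam: "0 \<le> lam"
    and le: "\<And>R a c ax cx axx cxx axxx cxxx. \<rho> < R \<Longrightarrow> axial_pair lam R a c ax cx \<Longrightarrow>
      axial_pair lam R ax cx axx cxx \<Longrightarrow> axial_pair lam R axx cxx axxx cxxx \<Longrightarrow>
      (LINT z|axial_measure lam \<rho>. \<Phi> (z, a z, c z, ax z, cx z))
        \<le> C * (LINT z|axial_measure lam \<rho>. \<Psi> (z, a z, c z, ax z, cx z))"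
  shows "(LINT z|axial_measure lam \<rho>. \<Phi> (z, a z, c z, ax z, cx z))
      \<le> C * (LINT z|axial_measure lam \<rho>. \<Psi> (z, a z, c z, ax z, cx z))"
proof (rule LIMSEQ_le[OF integral_smoothing_tendsto[OF cont(1) P \<rho> lam]
      tendsto_mult_left[OF integral_smoothing_tendsto[OF cont(2) P \<rho> lam]]], intro exI allI impI)
  fix n :: nat
  let ?h = "(R - \<rho>) / (4 * real (Suc n))"
  have "?h \<le> (R - \<rho>) / 4" using \<rho> by (intro divide_left_mono) auto
  then have "\<rho> < R - 2 * ?h" using \<rho> by argo
  moreover have "0 < ?h" using \<rho> by simp
  ultimately show "(LINT z|axial_measure lam \<rho>. \<Phi> (z, x_average ?h (x_average ?h a) z, x_average ?h (x_average ?h c) z,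
      x_average ?h (x_average ?h ax) z, x_average ?h (x_average ?h cx) z))
    \<le> C * (LINT z|axial_measure lam \<rho>. \<Psi> (z, x_average ?h (x_average ?h a) z, x_average ?h (x_average ?h c) z,
      x_average ?h (x_average ?h ax) z, x_average ?h (x_average ?h cx) z))"
    using le[OF _ axial_pair_smoothing[OF P]] by blast
qed

lemma derivative_estimate:
  assumes P: "axial_pair lam R a c ax cx"
    and \<rho>: "0 < \<rho>" "\<rho> < R" "\<rho> \<le> 1" and lam: "0 \<le> lam" and p: "1 \<le> p"
  shows "(LINT z|axial_measure lam \<rho>. (disc_weight \<rho> z * sqrt ((ax z)\<^sup>2 + (cx z)\<^sup>2)) powr p)
    \<le> derivative_constant lam p * (LINT z|axial_measure lam \<rho>. sqrt ((a z)\<^sup>2 + (c z)\<^sup>2) powr p)"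
proof -
  have c1: "continuous_on (cball 0 \<rho> \<times> UNIV)
      (\<lambda>u::complex \<times> real \<times> real \<times> real \<times> real. case u of (z, a, c, x, y) \<Rightarrow> (disc_weight \<rho> z * sqrt (x\<^sup>2 + y\<^sup>2)) powr p)"
    and c2: "continuous_on (cball 0 \<rho> \<times> UNIV)
      (\<lambda>u::complex \<times> real \<times> real \<times> real \<times> real. case u of (z, a, c, x, y) \<Rightarrow> sqrt (a\<^sup>2 + c\<^sup>2) powr p)"
    unfolding case_prod_unfold using p disc_weight_nonneg
    by (intro continuous_on_powr' continuous_intros continuous_on_compose2[OF continuous_on_disc_weight]; auto)+
  show ?thesis
  proof (rule estimate_by_smoothing[OF c1 c2 P \<rho>(2) lam, unfolded prod.case])
    fix R a c ax cx axx cxx axxx cxxx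
    assume R: "\<rho> < R" and P: "axial_pair lam R a c ax cx" "axial_pair lam R ax cx axx cxx"
      "axial_pair lam R axx cxx axxx cxxx"
    show "(LINT z|axial_measure lam \<rho>. (disc_weight \<rho> z * sqrt ((ax z)\<^sup>2 + (cx z)\<^sup>2)) powr p)
      \<le> derivative_constant lam p * (LINT z|axial_measure lam \<rho>. sqrt ((a z)\<^sup>2 + (c z)\<^sup>2) powr p)"
      using derivative_estimate_small_p[OF P(1,2) \<rho>(1) R \<rho>(3) lam p]
        derivative_estimate_large_p[OF P \<rho>(1) R \<rho>(3) lam, of p]
      by (cases "p \<le> 2") (simp_all add: derivative_constant_def sqrt_powr)
  qed
qed

lemma hardy_estimate_limit:
  assumes P: "axial_pair lam R a c ax cx"
    and \<rho>: "1 / 2 \<le> \<rho>" "\<rho> < R" "\<rho> \<le> 1" and lam: "0 \<le> lam" and p: "1 \<le> p"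
  shows "(LINT z|axial_measure lam \<rho>. sqrt ((a z)\<^sup>2 + (c z)\<^sup>2) powr p)
    \<le> 20 * p * (20 * p) powr (p - 1) * (LINT z|axial_measure lam \<rho>.
         (disc_weight \<rho> z * sqrt ((euler_re lam a ax cx z)\<^sup>2 + (euler_im lam c ax cx z)\<^sup>2)) powr p)"
proof -
  have c1: "continuous_on (cball 0 \<rho> \<times> UNIV)
      (\<lambda>u::complex \<times> real \<times> real \<times> real \<times> real. case u of (z, a, c, x, y) \<Rightarrow>
        (disc_weight \<rho> z * sqrt ((Re z * x - Im z * y + (1 + lam) * a)\<^sup>2 + (Re z * y + Im z * x + (1 - lam) * c)\<^sup>2)) powr p)"
    and c2: "continuous_on (cball 0 \<rho> \<times> UNIV)
      (\<lambda>u::complex \<times> real \<times> real \<times> real \<times> real. case u of (z, a, c, x, y) \<Rightarrow> sqrt (a\<^sup>2 + c\<^sup>2) powr p)"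
    unfolding case_prod_unfold using p disc_weight_nonneg
    by (intro continuous_on_powr' continuous_intros continuous_on_compose2[OF continuous_on_disc_weight]; auto)+
  show ?thesis unfolding euler_re_def euler_im_def
    by (rule estimate_by_smoothing[OF c2 c1 P \<rho>(2) lam, unfolded prod.case])
      (use hardy_estimate[OF _ _ \<rho>(1) _ \<rho>(3) lam p] in \<open>simp add: euler_re_def euler_im_def sqrt_powr\<close>)
qed

lemma nn_integral_axial_mono_radius:
  assumes "\<rho> \<le> 1" and f: "f \<in> borel_measurable (axial_measure lam 1)"
  shows "nn_integral (axial_measure lam \<rho>) f = (\<integral>\<^sup>+z. f z * indicator (ball 0 \<rho>) z \<partial>axial_measure lam 1)"
    and "f \<in> borel_measurable (axial_measure lam \<rho>)"
proof -
  have sub: "ball 0 \<rho> \<subseteq> ball (0::complex) 1" using assms by auto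
  show f': "f \<in> borel_measurable (axial_measure lam \<rho>)"
    using f measurable_restrict_mono[OF _ sub] unfolding measurable_axial_measure by blast
  have [measurable]: "ball 0 \<rho> \<in> sets (axial_measure lam 1)"
    unfolding sets_axial_measure by (auto simp: sets_restrict_space intro!: image_eqI[of _ _ "ball 0 \<rho>"] sub Int_absorb1[symmetric])
  have "(\<lambda>z. f z * indicator (ball 0 \<rho>) z) \<in> borel_measurable (axial_measure lam 1)"
    using f by measurable
  then have "(\<integral>\<^sup>+z. f z * indicator (ball 0 \<rho>) z \<partial>axial_measure lam 1)
    = (\<integral>\<^sup>+z. ennreal (\<bar>Im z\<bar> powr (2 * lam)) * (f z * indicator (ball 0 \<rho>) z) * indicator (ball 0 1) z \<partial>lborel)"
    by (rule nn_integral_axial_measure)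
  also have "\<dots> = (\<integral>\<^sup>+z. ennreal (\<bar>Im z\<bar> powr (2 * lam)) * f z * indicator (ball 0 \<rho>) z \<partial>lborel)"
    by (rule nn_integral_cong) (use sub in \<open>auto simp: indicator_def\<close>)
  also have "\<dots> = nn_integral (axial_measure lam \<rho>) f"
    by (rule nn_integral_axial_measure[OF f', symmetric])
  finally show "nn_integral (axial_measure lam \<rho>) f = (\<integral>\<^sup>+z. f z * indicator (ball 0 \<rho>) z \<partial>axial_measure lam 1)" ..
qed

text \<open>Lets \<open>\<rho>\<close> tend to \<open>1\<close> by Fatou's lemma. The cut-off in \<open>G \<rho>\<close> depends on \<open>\<rho>\<close>, so the integrands
  change with the domain; \<open>H'\<close> dominates all those on the right. Integrals become extended nonnegative ones,
  since those over the unit disk may be infinite.\<close>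
lemma exhaustion_inequality:
  assumes C: "0 \<le> C"
    and G: "\<And>\<rho>. G \<rho> \<in> borel_measurable (axial_measure lam 1)" "\<And>\<rho> z. norm z < \<rho> \<Longrightarrow> 0 \<le> G \<rho> z"
      "\<And>\<rho>. 1 / 2 \<le> \<rho> \<Longrightarrow> \<rho> < 1 \<Longrightarrow> integrable (axial_measure lam \<rho>) (G \<rho>)"
    and H: "\<And>\<rho> z. norm z < \<rho> \<Longrightarrow> 0 \<le> H \<rho> z"
      "\<And>\<rho>. 1 / 2 \<le> \<rho> \<Longrightarrow> \<rho> < 1 \<Longrightarrow> integrable (axial_measure lam \<rho>) (H \<rho>)"
    and H': "H' \<in> borel_measurable (axial_measure lam 1)" 
      "\<And>\<rho> z. norm z < \<rho> \<Longrightarrow> \<rho> < 1 \<Longrightarrow> H \<rho> z \<le> H' z"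
    and le: "\<And>\<rho>. 1 / 2 \<le> \<rho> \<Longrightarrow> \<rho> < 1 \<Longrightarrow>
       (LINT z|axial_measure lam \<rho>. G \<rho> z) \<le> C * (LINT z|axial_measure lam \<rho>. H \<rho> z)"
    and lim: "\<And>z. norm z < 1 \<Longrightarrow> (\<lambda>n. G (1 - 1 / real (n + 2)) z) \<longlonglongrightarrow> G' z"
  shows "(\<integral>\<^sup>+z. ennreal (G' z) \<partial>axial_measure lam 1) \<le> ennreal C * (\<integral>\<^sup>+z. ennreal (H' z) \<partial>axial_measure lam 1)"
proof -
  let ?M = "axial_measure lam"
  define \<rho> where "\<rho> n = 1 - 1 / real (n + 2)" for n
  have \<rho>: "1 / 2 \<le> \<rho> n" "\<rho> n < 1" for n by (auto simp: \<rho>_def field_simps)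
  have \<rho>lim: "\<rho> \<longlonglongrightarrow> 1"
  proof -
    have "(\<lambda>n. 1 / real (n + 2)) \<longlonglongrightarrow> 0"
      by (rule LIMSEQ_ignore_initial_segment[OF lim_1_over_n])
    from tendsto_diff[OF tendsto_const[of "1::real"] this] show ?thesis by (simp add: \<rho>_def[abs_def])
  qed
  define u where "u n z = ennreal (G (\<rho> n) z) * indicator (ball 0 (\<rho> n)) z" for n z
  have Gm: "(\<lambda>z. ennreal (G (\<rho> n) z)) \<in> borel_measurable (?M 1)" for n
    using G(1) by measurable
  have u_meas: "u n \<in> borel_measurable (?M 1)" for n
  proof -
    have "ball 0 (\<rho> n) \<in> sets (?M 1)"
      unfolding sets_axial_measure using \<rho>(2)[of n]
      by (auto simp: sets_restrict_space intro!: image_eqI[of _ _ "ball 0 (\<rho> n)"] Int_absorb1[symmetric])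
    then show ?thesis unfolding u_def[abs_def] using Gm[of n] by measurable
  qed
  have u_le: "(\<integral>\<^sup>+z. u n z \<partial>?M 1) \<le> ennreal C * (\<integral>\<^sup>+z. ennreal (H' z) \<partial>?M 1)" for n
  proof -
    have "(\<integral>\<^sup>+z. u n z \<partial>?M 1) = (\<integral>\<^sup>+z. ennreal (G (\<rho> n) z) \<partial>?M (\<rho> n))"
      unfolding u_def using nn_integral_axial_mono_radius(1)[OF less_imp_le[OF \<rho>(2)] Gm] by simp
    also have "\<dots> = ennreal (LINT z|?M (\<rho> n). G (\<rho> n) z)"
      by (intro nn_integral_eq_integral G(3) \<rho> AE_I2 G(2)) simp
    also have "\<dots> \<le> ennreal (C * (LINT z|?M (\<rho> n). H (\<rho> n) z))"
      by (intro ennreal_leI le \<rho>)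
    also have "\<dots> = ennreal C * ennreal (LINT z|?M (\<rho> n). H (\<rho> n) z)"
      using C by (rule ennreal_mult') 
    also have "ennreal (LINT z|?M (\<rho> n). H (\<rho> n) z) = (\<integral>\<^sup>+z. ennreal (H (\<rho> n) z) \<partial>?M (\<rho> n))"
      by (rule nn_integral_eq_integral[symmetric], rule H(2)[OF \<rho>], rule AE_I2, rule H(1), simp)
    also have "\<dots> \<le> (\<integral>\<^sup>+z. ennreal (H' z) \<partial>?M (\<rho> n))"
      by (intro nn_integral_mono ennreal_leI H'(2) \<rho>) simp
    also have "\<dots> = (\<integral>\<^sup>+z. ennreal (H' z) * indicator (ball 0 (\<rho> n)) z \<partial>?M 1)"
      by (rule nn_integral_axial_mono_radius(1)) (use \<rho>[of n] H'(1) in auto)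
    also have "\<dots> \<le> (\<integral>\<^sup>+z. ennreal (H' z) \<partial>?M 1)"
      by (intro nn_integral_mono) (auto simp: indicator_def)
    finally show ?thesis by (simp add: mult_left_mono)
  qed
  have "(\<integral>\<^sup>+z. ennreal (G' z) \<partial>?M 1) = (\<integral>\<^sup>+z. liminf (\<lambda>n. u n z) \<partial>?M 1)"
  proof (rule nn_integral_cong)
    fix z assume "z \<in> space (?M 1)"
    then have z: "norm z < 1" by simp
    have "eventually (\<lambda>n. norm z < \<rho> n) sequentially" by (rule order_tendstoD(1)[OF \<rho>lim z])
    then have ev: "eventually (\<lambda>n. ennreal (G (\<rho> n) z) = u n z) sequentially"
      by eventually_elim (simp add: u_def)
    have "(\<lambda>n. ennreal (G (\<rho> n) z)) \<longlonglongrightarrow> ennreal (G' z)"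
      using lim[OF z] by (intro tendsto_ennrealI) (simp add: \<rho>_def)
    then have "(\<lambda>n. u n z) \<longlonglongrightarrow> ennreal (G' z)"
      using ev by (simp add: tendsto_cong)
    then show "ennreal (G' z) = liminf (\<lambda>n. u n z)" by (intro lim_imp_Liminf[symmetric]) auto
  qed
  also have "\<dots> \<le> liminf (\<lambda>n. \<integral>\<^sup>+z. u n z \<partial>?M 1)"
    by (rule nn_integral_liminf[OF u_meas])
  also have "\<dots> \<le> liminf (\<lambda>n::nat. ennreal C * (\<integral>\<^sup>+z. ennreal (H' z) \<partial>?M 1))"
    by (intro Liminf_mono always_eventually allI u_le)
  also have "\<dots> = ennreal C * (\<integral>\<^sup>+z. ennreal (H' z) \<partial>?M 1)" by (intro Liminf_const) simp
  finally show ?thesis .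
qed

lemma measurable_weighted_powr:
  assumes "continuous_on (ball 0 R) g"
  shows "(\<lambda>z. (disc_weight \<rho> z * g z) powr p) \<in> borel_measurable (axial_measure lam R)"
proof -
  have [measurable]: "(\<lambda>z. disc_weight \<rho> z * g z) \<in> borel_measurable (axial_measure lam R)"
    by (intro borel_measurable_axial_continuous continuous_intros assms)
  show ?thesis by measurable
qed

lemma weighted_powr_tendsto:
  "1 \<le> p \<Longrightarrow> norm z < 1 \<Longrightarrow> 0 \<le> g z \<Longrightarrow>
    (\<lambda>n. (disc_weight (1 - 1 / real (n + 2)) z * g z) powr p) \<longlonglongrightarrow> (disc_weight 1 z * g z) powr p"
proof -
  assume p: "1 \<le> p" and z: "norm z < 1" and g: "0 \<le> g z"
  have "(\<lambda>n. 1 / real (n + 2)) \<longlonglongrightarrow> 0"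
    by (rule LIMSEQ_ignore_initial_segment[OF lim_1_over_n])
  from tendsto_diff[OF tendsto_const[of "1::real"] this]
  have \<rho>: "(\<lambda>n. 1 - 1 / real (n + 2)) \<longlonglongrightarrow> 1" by simp
  have "(\<lambda>n. disc_weight (1 - 1 / real (n + 2)) z * g z) \<longlonglongrightarrow> disc_weight 1 z * g z"
    unfolding disc_weight_eq by (intro tendsto_intros \<rho>)
  moreover have "eventually (\<lambda>n. 0 \<le> disc_weight (1 - 1 / real (n + 2)) z * g z) sequentially"
    by (rule eventually_mono[OF order_tendstoD(1)[OF \<rho> z]])
      (intro mult_nonneg_nonneg disc_weight_nonneg g less_imp_le)
  ultimately show ?thesis
    using p by (intro tendsto_powr') auto
qed

lemma disc_weight_mono: "0 \<le> \<rho> \<Longrightarrow> \<rho> \<le> R \<Longrightarrow> disc_weight \<rho> z \<le> disc_weight R z"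
  unfolding disc_weight_eq by (simp add: power_mono)

lemma derivative_constant_nonneg: "0 \<le> lam \<Longrightarrow> 1 \<le> p \<Longrightarrow> 0 \<le> derivative_constant lam p"
  unfolding derivative_constant_def large_p_constant_def Let_def by auto

lemma derivative_estimate_disc:
  assumes P: "axial_pair lam 1 a c ax cx" and lam: "0 \<le> lam" and p: "1 \<le> p"
  shows "(\<integral>\<^sup>+z. ennreal ((disc_weight 1 z * sqrt ((ax z)\<^sup>2 + (cx z)\<^sup>2)) powr p) \<partial>axial_measure lam 1)
    \<le> ennreal (derivative_constant lam p) * (\<integral>\<^sup>+z. ennreal (sqrt ((a z)\<^sup>2 + (c z)\<^sup>2) powr p) \<partial>axial_measure lam 1)"
proof -
  note D = axial_pairD[OF P]
  have c1: "continuous_on (ball 0 1) (\<lambda>z. sqrt ((ax z)\<^sup>2 + (cx z)\<^sup>2))" by (intro continuous_intros D(3,4))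
  have c2: "continuous_on (ball 0 1) (\<lambda>z. sqrt ((a z)\<^sup>2 + (c z)\<^sup>2))" by (intro continuous_intros D(1,2))
  show ?thesis
  proof (rule exhaustion_inequality[where
        G="\<lambda>\<rho> z. (disc_weight \<rho> z * sqrt ((ax z)\<^sup>2 + (cx z)\<^sup>2)) powr p" and
        H="\<lambda>\<rho> z. sqrt ((a z)\<^sup>2 + (c z)\<^sup>2) powr p"])
    show "integrable (axial_measure lam \<rho>) (\<lambda>z. sqrt ((a z)\<^sup>2 + (c z)\<^sup>2) powr p)" if "\<rho> < 1" for \<rho>
      using p by (intro bounded_measurable_integrable[OF lam] bounded_measurable_powr continuous_on_subset[OF c2])
        (use that in auto)
    show "(\<lambda>z. sqrt ((a z)\<^sup>2 + (c z)\<^sup>2) powr p) \<in> borel_measurable (axial_measure lam 1)"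
      using borel_measurable_axial_continuous[OF c2] by measurable
    show "(LINT z|axial_measure lam \<rho>. (disc_weight \<rho> z * sqrt ((ax z)\<^sup>2 + (cx z)\<^sup>2)) powr p)
       \<le> derivative_constant lam p * (LINT z|axial_measure lam \<rho>. sqrt ((a z)\<^sup>2 + (c z)\<^sup>2) powr p)"
      if "1 / 2 \<le> \<rho>" "\<rho> < 1" for \<rho>
      using that by (intro derivative_estimate[OF P] lam p) auto
    show "(\<lambda>n. (disc_weight (1 - 1 / real (n + 2)) z * sqrt ((ax z)\<^sup>2 + (cx z)\<^sup>2)) powr p)
        \<longlonglongrightarrow> (disc_weight 1 z * sqrt ((ax z)\<^sup>2 + (cx z)\<^sup>2)) powr p" if "norm z < 1" for z
      by (rule weighted_powr_tendsto[OF p that]) simp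
  qed (use lam p c1 in \<open>auto intro!: measurable_weighted_powr integrable_weighted_powr derivative_constant_nonneg
    intro: continuous_on_subset\<close>)
qed

lemma hardy_estimate_disc:
  assumes P: "axial_pair lam 1 a c ax cx" and lam: "0 \<le> lam" and p: "1 \<le> p"
  shows "(\<integral>\<^sup>+z. ennreal (sqrt ((a z)\<^sup>2 + (c z)\<^sup>2) powr p) \<partial>axial_measure lam 1)
    \<le> ennreal (20 * p * (20 * p) powr (p - 1)) * (\<integral>\<^sup>+z. ennreal ((disc_weight 1 z *
        sqrt ((euler_re lam a ax cx z)\<^sup>2 + (euler_im lam c ax cx z)\<^sup>2)) powr p) \<partial>axial_measure lam 1)"
proof -
  note D = axial_pairD[OF P]
  let ?g = "\<lambda>z. sqrt ((euler_re lam a ax cx z)\<^sup>2 + (euler_im lam c ax cx z)\<^sup>2)"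
  have c1: "continuous_on (ball 0 1) ?g"
    unfolding euler_re_def euler_im_def by (intro continuous_intros D(1-4))
  have c2: "continuous_on (ball 0 1) (\<lambda>z. sqrt ((a z)\<^sup>2 + (c z)\<^sup>2))" by (intro continuous_intros D(1,2))
  show ?thesis
  proof (rule exhaustion_inequality[where
        H="\<lambda>\<rho> z. (disc_weight \<rho> z * ?g z) powr p" and
        G="\<lambda>\<rho> z. sqrt ((a z)\<^sup>2 + (c z)\<^sup>2) powr p"])
    show "integrable (axial_measure lam \<rho>) (\<lambda>z. sqrt ((a z)\<^sup>2 + (c z)\<^sup>2) powr p)" if "\<rho> < 1" for \<rho>
      using p by (intro bounded_measurable_integrable[OF lam] bounded_measurable_powr continuous_on_subset[OF c2])
        (use that in auto)
    show "(\<lambda>z. sqrt ((a z)\<^sup>2 + (c z)\<^sup>2) powr p) \<in> borel_measurable (axial_measure lam 1)"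
      using borel_measurable_axial_continuous[OF c2] by measurable
    show "(disc_weight \<rho> z * ?g z) powr p \<le> (disc_weight 1 z * ?g z) powr p" if "norm z < \<rho>" "\<rho> < 1" for \<rho> z
    proof -
      have "0 < \<rho>" using that(1) norm_ge_zero[of z] by linarith
      then show ?thesis
        using p that disc_weight_nonneg[of z \<rho>] by (intro powr_mono2 mult_right_mono mult_nonneg_nonneg disc_weight_mono) auto
    qed
    show "(LINT z|axial_measure lam \<rho>. sqrt ((a z)\<^sup>2 + (c z)\<^sup>2) powr p)
       \<le> (20 * p * (20 * p) powr (p - 1)) * (LINT z|axial_measure lam \<rho>. (disc_weight \<rho> z * ?g z) powr p)"
      if "1 / 2 \<le> \<rho>" "\<rho> < 1" for \<rho>
      using hardy_estimate_limit[OF P that(1,2) _ lam p] that by simp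
  qed (use lam p c1 in \<open>auto intro!: measurable_weighted_powr integrable_weighted_powr intro: continuous_on_subset\<close>)
qed

section \<open>Reduction of lambda-analytic functions to axial pairs\<close>

text \<open>The part of a function with real values on the axis, analogous to taking the real parts of all Taylor
  coefficients. Its real part is even and its imaginary part odd in \<open>y\<close>.\<close>
definition symmetrization :: "(complex \<Rightarrow> complex) \<Rightarrow> complex \<Rightarrow> complex" where
  "symmetrization g z = (g z + cnj (g (cnj z))) / 2"

abbreviation sym_Re :: "(complex \<Rightarrow> complex) \<Rightarrow> complex \<Rightarrow> real" where
  "sym_Re g z \<equiv> Re (symmetrization g z)"

abbreviation sym_Im :: "(complex \<Rightarrow> complex) \<Rightarrow> complex \<Rightarrow> real" where
  "sym_Im g z \<equiv> Im (symmetrization g z)"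

lemma norm_symmetrization: "norm (symmetrization g z) \<le> (norm (g z) + norm (g (cnj z))) / 2"
  unfolding symmetrization_def using norm_triangle_ineq[of "g z" "cnj (g (cnj z))"] by (simp add: norm_divide)

text \<open>The two symmetrizations correspond to the real and the imaginary parts of the coefficients.\<close>
lemma symmetrization_split:
  "g z = symmetrization g z + \<i> * symmetrization (\<lambda>z. - \<i> * g z) z"
  unfolding symmetrization_def by (simp add: complex_eq_iff field_simps)

lemma norm_le_symmetrization:
  "norm (g z) \<le> norm (symmetrization g z) + norm (symmetrization (\<lambda>z. - \<i> * g z) z)"
  using norm_triangle_ineq[of "symmetrization g z" "\<i> * symmetrization (\<lambda>z. - \<i> * g z) z"]
  unfolding symmetrization_split[of g z, symmetric] by (simp add: norm_mult)

lemma line_derivatives: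
  assumes "f differentiable_on unit_disk" "z \<in> unit_disk"
  shows "((\<lambda>t. f (Complex t (Im z))) has_vector_derivative partial_x f z) (at (Re z))"
    "((\<lambda>t. f (Complex (Re z) t)) has_vector_derivative partial_y f z) (at (Im z))"
proof -
  have d: "f differentiable (at z)"
    using assms by (simp add: differentiable_on_eq_differentiable_at)
  have cx: "((\<lambda>t. Complex t (Im z)) has_vector_derivative 1) (at (Re z))"
    unfolding Complex_eq by (auto intro!: derivative_eq_intros)
  have cy: "((\<lambda>t. Complex (Re z) t) has_vector_derivative \<i>) (at (Im z))"
    unfolding Complex_eq by (auto intro!: derivative_eq_intros)
  have "(f \<circ> (\<lambda>t. Complex t (Im z))) differentiable (at (Re z))"
    by (rule differentiable_chain_at) (use d differentiableI_vector[OF cx] in auto)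
  then show "((\<lambda>t. f (Complex t (Im z))) has_vector_derivative partial_x f z) (at (Re z))"
    unfolding partial_x_def o_def by (simp add: vector_derivative_works)
  have "(f \<circ> (\<lambda>t. Complex (Re z) t)) differentiable (at (Im z))"
    by (rule differentiable_chain_at) (use d differentiableI_vector[OF cy] in auto)
  then show "((\<lambda>t. f (Complex (Re z) t)) has_vector_derivative partial_y f z) (at (Im z))"
    unfolding partial_y_def o_def by (simp add: vector_derivative_works)
qed

lemma lambda_analyticD:
  assumes "lambda_analytic lam f"
  shows "f differentiable_on unit_disk" "continuous_on unit_disk f"
    "continuous_on unit_disk (partial_x f)" "continuous_on unit_disk (partial_y f)"
    "\<And>z. z \<in> unit_disk \<Longrightarrow> D_zbar lam f z = 0"
  using assms differentiable_imp_continuous_on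
  unfolding lambda_analytic_def C2_on_def C1_on_def by auto

lemma lambda_analytic_partial_y:
  assumes "lambda_analytic lam f" "z \<in> unit_disk" "Im z \<noteq> 0"
  shows "partial_y f z = \<i> * partial_x f z - of_real lam * (f z - f (cnj z)) / of_real (Im z)"
proof -
  have zc: "z - cnj z = 2 * \<i> * of_real (Im z)" by (simp add: complex_eq_iff)
  have "partial_x f z + \<i> * partial_y f z = of_real lam * (f z - f (cnj z)) / (\<i> * of_real (Im z))"
  proof -
    let ?X = "partial_x f z + \<i> * partial_y f z" and ?d = "f z - f (cnj z)"
    have "?X / 2 = of_real lam * (?d / (2 * \<i> * of_real (Im z)))"
      using lambda_analyticD(5)[OF assms(1,2)] assms(3)
      unfolding D_zbar_def wirtinger_zbar_def conj_quotient_def zc by simp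
    also have "\<dots> = (of_real lam * ?d / (\<i> * of_real (Im z))) / 2"
      using assms(3) by (simp add: field_simps)
    finally have "?X / 2 = (of_real lam * ?d / (\<i> * of_real (Im z))) / 2" .
    moreover have "X = Y" if "X / 2 = Y / 2" for X Y :: complex using that by simp
    ultimately show ?thesis by blast
  qed
  then have e: "- \<i> * (partial_x f z + \<i> * partial_y f z)
      = - \<i> * (of_real lam * (f z - f (cnj z)) / (\<i> * of_real (Im z)))"
    by simp
  have "partial_y f z = \<i> * partial_x f z + (- \<i> * (partial_x f z + \<i> * partial_y f z))"
    by (simp add: algebra_simps)
  also have "\<dots> = \<i> * partial_x f z - of_real lam * (f z - f (cnj z)) / of_real (Im z)"
    unfolding e by simp
  finally show ?thesis .
qed

text \<open>By the product rule \<open>D\<^sub>z (z f) = f(z) + \<lambda> f(cnj z) + z D\<^sub>z f\<close>, and \<open>D\<^sub>z f = \<partial>\<^sub>x f\<close> as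
  \<open>D\<^sub>z + D\<^sub>z\<^sub>b\<^sub>a\<^sub>r = \<partial>\<^sub>x\<close>. On the real axis the quotient in the definitions is a derivative, and the same
  formula results.\<close>
lemma D_z_times_identity:
  assumes f: "lambda_analytic lam f" and z: "z \<in> unit_disk"
  shows "D_z lam (\<lambda>w. w * f w) z = f z + of_real lam * f (cnj z) + z * partial_x f z"
proof -
  note L = line_derivatives[OF lambda_analyticD(1)[OF f] z]
  have cx: "((\<lambda>t. Complex t (Im z)) has_vector_derivative 1) (at (Re z))"
    unfolding Complex_eq by (auto intro!: derivative_eq_intros)
  have cy: "((\<lambda>t. Complex (Re z) t) has_vector_derivative \<i>) (at (Im z))"
    unfolding Complex_eq by (auto intro!: derivative_eq_intros)
  have px: "partial_x (\<lambda>w. w * f w) z = f z + z * partial_x f z"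
    unfolding partial_x_def[of "\<lambda>w. w * f w"]
    using vector_derivative_at[OF has_vector_derivative_mult[OF cx L(1)]] by (simp add: add.commute)
  have py: "partial_y (\<lambda>w. w * f w) z = \<i> * f z + z * partial_y f z"
    unfolding partial_y_def[of "\<lambda>w. w * f w"]
    using vector_derivative_at[OF has_vector_derivative_mult[OF cy L(2)]] by (simp add: add.commute)
  show ?thesis
  proof (cases "Im z = 0")
    case True
    then have zz: "cnj z = z" by (simp add: complex_eq_iff)
    have zero: "(partial_x f z + \<i> * partial_y f z) / 2 + of_real lam * (\<i> * partial_y f z) = 0"
      using lambda_analyticD(5)[OF f z] True unfolding D_zbar_def wirtinger_zbar_def conj_quotient_def by simp
    have "D_z lam (\<lambda>w. w * f w) z = (f z + z * partial_x f z - \<i> * (\<i> * f z + z * partial_y f z)) / 2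
        + of_real lam * (- \<i> * (\<i> * f z + z * partial_y f z))"
      using True unfolding D_z_def wirtinger_z_def conj_quotient_def px py by simp
    also have "\<dots> = f z + of_real lam * f z + z * partial_x f z
        - z * ((partial_x f z + \<i> * partial_y f z) / 2 + of_real lam * (\<i> * partial_y f z))"
    proof -
      have iF: "\<i> * (\<i> * f z + z * partial_y f z) = - f z + z * (\<i> * partial_y f z)" by (simp add: distrib_left)
      have "(F + Z * P - (- F + Z * W)) / 2 + L * - (- F + Z * W) = F + L * F + Z * P - Z * ((P + W) / 2 + L * W)"
        for F Z P W L :: complex by (simp add: field_simps)
      then show ?thesis unfolding mult_minus_left iF .
    qed
    finally show ?thesis unfolding zero zz by simp
  next
    case False
    have y: "of_real (Im z) \<noteq> (0::complex)" using False by simp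
    have zc: "z - cnj z = 2 * \<i> * of_real (Im z)" by (simp add: complex_eq_iff)
    have q: "z * f z - cnj z * f (cnj z) = z * (f z - f (cnj z)) + (z - cnj z) * f (cnj z)"
      by (simp add: algebra_simps)
    show ?thesis
      using False unfolding D_z_def wirtinger_z_def conj_quotient_def px py lambda_analytic_partial_y[OF f z False]
      unfolding q unfolding zc by (simp add: field_simps)
  qed
qed

text \<open>The equation at \<open>z\<close> involves \<open>f (cnj z)\<close>; combining it with the equation at \<open>cnj z\<close> decouples into
  the system for the symmetrization. The bound for the imaginary part near the axis comes from the mean value
  theorem on a vertical segment starting on the axis, where it vanishes.\<close>
lemma axial_pair_symmetrization:
  assumes cont: "continuous_on unit_disk f" "continuous_on unit_disk fx" "continuous_on unit_disk fy"
    and dx: "\<And>z. z \<in> unit_disk \<Longrightarrow> ((\<lambda>t. f (Complex t (Im z))) has_vector_derivative fx z) (at (Re z))"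
    and dy: "\<And>z. z \<in> unit_disk \<Longrightarrow> ((\<lambda>t. f (Complex (Re z) t)) has_vector_derivative fy z) (at (Im z))"
    and eq: "\<And>z. z \<in> unit_disk \<Longrightarrow> Im z \<noteq> 0 \<Longrightarrow>
      fy z = \<i> * fx z - of_real lam * (f z - f (cnj z)) / of_real (Im z)"
  shows "axial_pair lam 1 (sym_Re f) (sym_Im f) (sym_Re fx) (sym_Im fx)"
proof -
  have cnj_in: "cnj z \<in> unit_disk" if "z \<in> unit_disk" for z using that by simp
  have csym: "continuous_on unit_disk (symmetrization g)" if "continuous_on unit_disk g" for g
    unfolding symmetrization_def[abs_def]
    by (intro continuous_intros that continuous_on_compose2[OF that]) auto
  have symx: "((\<lambda>t. symmetrization f (Complex t (Im z))) has_vector_derivative symmetrization fx z) (at (Re z))"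
    if z: "z \<in> unit_disk" for z
  proof -
    have "((\<lambda>t. f (cnj (Complex t (Im z)))) has_vector_derivative fx (cnj z)) (at (Re z))"
      using dx[OF cnj_in[OF z]] by (simp add: complex_cnj)
    from bounded_linear.has_vector_derivative[OF bounded_linear_cnj this] dx[OF z]
    show ?thesis unfolding symmetrization_def
      by (intro has_vector_derivative_divide has_vector_derivative_add)
  qed
  have symy: "((\<lambda>t. symmetrization f (Complex (Re z) t)) has_vector_derivative (fy z - cnj (fy (cnj z))) / 2) (at (Im z))"
    if z: "z \<in> unit_disk" for z
  proof -
    have "((\<lambda>t. f (Complex (Re z) t)) has_vector_derivative fy (cnj z)) (at (- Im z))"
      using dy[OF cnj_in[OF z]] by simp
    then have "((\<lambda>t. f (Complex (Re z) t)) \<circ> uminus has_vector_derivative (- 1) *\<^sub>R fy (cnj z)) (at (Im z))"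
      by (intro vector_diff_chain_at) (auto intro!: derivative_eq_intros)
    then have "((\<lambda>t. f (cnj (Complex (Re z) t))) has_vector_derivative - fy (cnj z)) (at (Im z))"
      by (simp add: o_def complex_cnj)
    from bounded_linear.has_vector_derivative[OF bounded_linear_cnj this]
    have "((\<lambda>t. cnj (f (cnj (Complex (Re z) t)))) has_vector_derivative - cnj (fy (cnj z))) (at (Im z))" by simp
    from has_vector_derivative_divide[OF has_vector_derivative_add[OF dy[OF z] this], of 2]
    show ?thesis unfolding symmetrization_def by simp
  qed
  note Re_der = bounded_linear.has_vector_derivative[OF bounded_linear_Re]
  note Im_der = bounded_linear.has_vector_derivative[OF bounded_linear_Im]
  have symy_eq: "Re ((fy z - cnj (fy (cnj z))) / 2) = - sym_Im fx z"
    "Im ((fy z - cnj (fy (cnj z))) / 2) = sym_Re fx z - 2 * lam * (sym_Im f z / Im z)"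
    if z: "z \<in> unit_disk" "Im z \<noteq> 0" for z
  proof -
    have z': "Im (cnj z) \<noteq> 0" using z by simp
    have e: "Re (fy z) = - Im (fx z) - lam * (Re (f z) - Re (f (cnj z))) / Im z"
      "Im (fy z) = Re (fx z) - lam * (Im (f z) - Im (f (cnj z))) / Im z"
      "Re (fy (cnj z)) = - Im (fx (cnj z)) + lam * (Re (f (cnj z)) - Re (f z)) / Im z"
      "Im (fy (cnj z)) = Re (fx (cnj z)) + lam * (Im (f (cnj z)) - Im (f z)) / Im z"
      unfolding eq[OF z] eq[OF cnj_in[OF z(1)] z'] by simp_all
    show "Re ((fy z - cnj (fy (cnj z))) / 2) = - sym_Im fx z"
      "Im ((fy z - cnj (fy (cnj z))) / 2) = sym_Re fx z - 2 * lam * (sym_Im f z / Im z)"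
      using z(2) by (simp_all add: symmetrization_def e field_simps)
  qed
  show ?thesis unfolding axial_pair_def
  proof (intro conjI ballI allI impI)
    show "continuous_on unit_disk (sym_Re f)" "continuous_on unit_disk (sym_Im f)"
      "continuous_on unit_disk (sym_Re fx)" "continuous_on unit_disk (sym_Im fx)"
      by (intro continuous_intros csym cont)+
    fix z assume z: "z \<in> unit_disk"
    show "((\<lambda>t. sym_Re f (Complex t (Im z))) has_real_derivative sym_Re fx z) (at (Re z))"
      "((\<lambda>t. sym_Im f (Complex t (Im z))) has_real_derivative sym_Im fx z) (at (Re z))"
      using Re_der[OF symx[OF z]] Im_der[OF symx[OF z]]
      by (simp_all add: has_real_derivative_iff_has_vector_derivative)
    show "sym_Im f z = 0" if "Im z = 0"
    proof -
      have "cnj z = z" using that by (simp add: complex_eq_iff)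
      then show ?thesis by (simp add: symmetrization_def)
    qed
    assume y: "Im z \<noteq> 0"
    show "((\<lambda>t. sym_Re f (Complex (Re z) t)) has_real_derivative - sym_Im fx z) (at (Im z))"
      "((\<lambda>t. sym_Im f (Complex (Re z) t)) has_real_derivative sym_Re fx z - 2 * lam * (sym_Im f z / Im z)) (at (Im z))"
      using Re_der[OF symy[OF z]] Im_der[OF symy[OF z]]
      unfolding symy_eq[OF z y] has_real_derivative_iff_has_vector_derivative by simp_all
  next
    fix r :: real assume r: "r < 1"
    define d where "d z = Im ((fy z - cnj (fy (cnj z))) / 2)" for z
    have dc: "continuous_on unit_disk d" unfolding d_def
      by (intro continuous_intros cont continuous_on_compose2[OF cont(3)]) auto
    have "bounded (d ` cball 0 r)"
      by (intro compact_imp_bounded compact_continuous_image compact_cball continuous_on_subset[OF dc]) (use r in auto)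
    then obtain K where K: "\<forall>z\<in>cball 0 r. \<bar>d z\<bar> \<le> K" by (auto simp: bounded_iff)
    have "\<bar>sym_Im f z\<bar> \<le> K * \<bar>Im z\<bar>" if z: "z \<in> ball 0 r" for z
    proof -
      have in_ball: "Complex (Re z) t \<in> cball 0 r" if "t \<in> closed_segment 0 (Im z)" for t
      proof -
        have "\<bar>t\<bar> \<le> \<bar>Im z\<bar>" using that by (auto simp: closed_segment_eq_real_ivl split: if_splits)
        then have "t\<^sup>2 \<le> (Im z)\<^sup>2" by (simp add: abs_le_square_iff)
        then have "norm (Complex (Re z) t) \<le> norm z" by (simp add: cmod_def)
        then show ?thesis using z by simp
      qed
      have "norm (sym_Im f (Complex (Re z) (Im z)) - sym_Im f (Complex (Re z) 0)) \<le> K * norm (Im z - 0)"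
      proof (rule field_differentiable_bound[of "closed_segment 0 (Im z)" _ "\<lambda>t. d (Complex (Re z) t)"])
        fix t assume t: "t \<in> closed_segment 0 (Im z)"
        have "Complex (Re z) t \<in> unit_disk" using in_ball[OF t] r by auto
        from Im_der[OF symy[OF this]]
        show "((\<lambda>t. sym_Im f (Complex (Re z) t)) has_real_derivative d (Complex (Re z) t)) (at t within closed_segment 0 (Im z))"
          unfolding has_real_derivative_iff_has_vector_derivative d_def complex.sel
          by (rule has_vector_derivative_at_within)
        show "norm (d (Complex (Re z) t)) \<le> K" using bspec[OF K in_ball[OF t]] unfolding real_norm_def .
      qed auto
      moreover have "sym_Im f (Complex (Re z) 0) = 0" by (simp add: symmetrization_def complex_cnj)
      ultimately show ?thesis by simp
    qed
    then show "\<exists>K. \<forall>z\<in>ball 0 r. \<bar>sym_Im f z\<bar> \<le> K * \<bar>Im z\<bar>" by blast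
  qed
qed

lemma lambda_analytic_axial_pairs:
  assumes f: "lambda_analytic lam f"
  shows "axial_pair lam 1 (sym_Re f) (sym_Im f) (sym_Re (partial_x f)) (sym_Im (partial_x f))"
    and "axial_pair lam 1 (sym_Re (\<lambda>z. - \<i> * f z)) (sym_Im (\<lambda>z. - \<i> * f z))
      (sym_Re (\<lambda>z. - \<i> * partial_x f z)) (sym_Im (\<lambda>z. - \<i> * partial_x f z))"
proof -
  note D = lambda_analyticD[OF f] and L = line_derivatives[OF lambda_analyticD(1)[OF f]]
  note E = lambda_analytic_partial_y[OF f]
  show "axial_pair lam 1 (sym_Re f) (sym_Im f) (sym_Re (partial_x f)) (sym_Im (partial_x f))"
  proof (rule axial_pair_symmetrization[where fy="partial_y f"])
    fix z assume z: "z \<in> unit_disk"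
    show "((\<lambda>t. f (Complex t (Im z))) has_vector_derivative partial_x f z) (at (Re z))" by (rule L(1)[OF z])
    show "((\<lambda>t. f (Complex (Re z) t)) has_vector_derivative partial_y f z) (at (Im z))" by (rule L(2)[OF z])
    show "partial_y f z = \<i> * partial_x f z - of_real lam * (f z - f (cnj z)) / of_real (Im z)"
      if "Im z \<noteq> 0" by (rule E[OF z that])
  qed (rule D)+
  show "axial_pair lam 1 (sym_Re (\<lambda>z. - \<i> * f z)) (sym_Im (\<lambda>z. - \<i> * f z))
      (sym_Re (\<lambda>z. - \<i> * partial_x f z)) (sym_Im (\<lambda>z. - \<i> * partial_x f z))"
  proof (rule axial_pair_symmetrization[where fy="\<lambda>z. - \<i> * partial_y f z"])
    fix z assume z: "z \<in> unit_disk"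
    show "((\<lambda>t. - \<i> * f (Complex t (Im z))) has_vector_derivative - \<i> * partial_x f z) (at (Re z))"
      "((\<lambda>t. - \<i> * f (Complex (Re z) t)) has_vector_derivative - \<i> * partial_y f z) (at (Im z))"
      by (rule has_vector_derivative_mult_right[OF L(1)[OF z]] has_vector_derivative_mult_right[OF L(2)[OF z]])+
    show "- \<i> * partial_y f z = \<i> * (- \<i> * partial_x f z) - of_real lam * (- \<i> * f z - - \<i> * f (cnj z)) / of_real (Im z)"
      if "Im z \<noteq> 0" using that unfolding E[OF z that] by (simp add: field_simps)
  qed (intro continuous_on_mult continuous_on_const D)+
qed

text \<open>Identifies the quantity in the Hardy estimate for the symmetrization of \<open>f\<close> with the symmetrization of
  \<open>D\<^sub>z (z f)\<close>.\<close>
lemma euler_symmetrization: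
  assumes "\<And>z. G z = f z + of_real lam * f (cnj z) + z * fx z"
  shows "euler_re lam (sym_Re f) (sym_Re fx) (sym_Im fx) z = sym_Re G z"
    "euler_im lam (sym_Im f) (sym_Re fx) (sym_Im fx) z = sym_Im G z"
  unfolding euler_re_def euler_im_def symmetrization_def assms by (simp_all add: field_simps)

section \<open>Integrals of p-th powers and the norm equivalence\<close>

text \<open>Norms of a symmetrization involve values at \<open>z\<close> and at \<open>cnj z\<close>; the measure does not distinguish them.\<close>
lemma lborel_complex_cnj: "(lborel :: complex measure) = distr lborel borel cnj"
proof (rule lborel_eqI)
  have [measurable]: "cnj \<in> borel_measurable borel"
    by (intro borel_measurable_continuous_onI continuous_intros)
  fix l u :: complex
  assume le: "\<And>b. b \<in> Basis \<Longrightarrow> l \<bullet> b \<le> u \<bullet> b"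
  have le': "Re l \<le> Re u" "Im l \<le> Im u"
    using le[of 1] le[of \<i>] by (auto simp: Basis_complex_def inner_complex_def)
  have "cnj -` box l u \<inter> space lborel = box (Complex (Re l) (- Im u)) (Complex (Re u) (- Im l))"
    by (auto simp: in_box_complex_iff)
  then have "emeasure (distr lborel borel cnj) (box l u)
      = emeasure lborel (box (Complex (Re l) (- Im u)) (Complex (Re u) (- Im l)))"
    by (simp add: emeasure_distr)
  also have "\<dots> = (\<Prod>b\<in>Basis. (u - l) \<bullet> b)"
    using le' by (subst emeasure_lborel_box) (auto simp: Basis_complex_def inner_complex_def complex_eq_iff)
  finally show "emeasure (distr lborel borel cnj) (box l u) = (\<Prod>b\<in>Basis. (u - l) \<bullet> b)" .
qed simp

lemma nn_integral_axial_cnj: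
  assumes cont: "continuous_on (ball 0 1) F"
  shows "(\<integral>\<^sup>+z. ennreal (F (cnj z)) \<partial>axial_measure lam 1) = (\<integral>\<^sup>+z. ennreal (F z) \<partial>axial_measure lam 1)"
proof -
  have cont': "continuous_on (ball 0 1) (\<lambda>z. F (cnj z))"
    by (intro continuous_on_compose2[OF cont] continuous_intros) auto
  have [measurable]: "cnj \<in> borel_measurable borel"
    by (intro borel_measurable_continuous_onI continuous_intros)
  have m: "(\<lambda>z. ennreal (g z)) \<in> borel_measurable (axial_measure lam 1)" if "continuous_on (ball 0 1) g" for g
    using borel_measurable_axial_continuous[OF that] by measurable
  let ?I = "\<lambda>z. ennreal (\<bar>Im z\<bar> powr (2 * lam)) * ennreal (F z) * indicator (ball 0 1) z"
  have "(\<lambda>z. ennreal (F z)) \<in> borel_measurable (restrict_space borel (ball 0 1))"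
    using m[OF cont] unfolding measurable_axial_measure .
  then have "(\<lambda>z. ennreal (F z) * indicator (ball 0 1) z) \<in> borel_measurable borel"
    by (subst (asm) borel_measurable_restrict_space_iff_ennreal) auto
  then have "(\<lambda>z. ennreal (\<bar>Im z\<bar> powr (2 * lam)) * (ennreal (F z) * indicator (ball 0 1) z)) \<in> borel_measurable borel"
    by measurable
  then have I[measurable]: "?I \<in> borel_measurable borel" by (simp add: mult.assoc)
  have "(\<integral>\<^sup>+z. ennreal (F z) \<partial>axial_measure lam 1) = (\<integral>\<^sup>+z. ?I z \<partial>lborel)"
    by (rule nn_integral_axial_measure[OF m[OF cont]])
  also have "\<dots> = (\<integral>\<^sup>+z. ?I (cnj z) \<partial>lborel)"
    by (subst lborel_complex_cnj, subst nn_integral_distr) auto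
  also have "\<dots> = (\<integral>\<^sup>+z. ennreal (\<bar>Im z\<bar> powr (2 * lam)) * ennreal (F (cnj z)) * indicator (ball 0 1) z \<partial>lborel)"
    by (intro nn_integral_cong) (auto simp: indicator_def)
  also have "\<dots> = (\<integral>\<^sup>+z. ennreal (F (cnj z)) \<partial>axial_measure lam 1)"
    by (rule nn_integral_axial_measure[OF m[OF cont'], symmetric])
  finally show ?thesis ..
qed

lemma powr_sum_le:
  fixes s t p :: real
  assumes "0 \<le> s" "0 \<le> t" "0 \<le> p"
  shows "(s + t) powr p \<le> 2 powr p * (s powr p + t powr p)" "((s + t) / 2) powr p \<le> s powr p + t powr p"
proof -
  have *: "((s + t) / 2) powr p \<le> max s t powr p" using assms by (intro powr_mono2) auto
  also have "max s t powr p \<le> s powr p + t powr p" by (cases "s \<le> t") (auto simp: max_def)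
  finally show **: "((s + t) / 2) powr p \<le> s powr p + t powr p" .
  have "2 * ((s + t) / 2) = s + t" by (simp add: field_simps)
  then have "(s + t) powr p = 2 powr p * ((s + t) / 2) powr p"
    using powr_mult[of 2 "(s + t) / 2" p] assms by metis
  also have "\<dots> \<le> 2 powr p * (s powr p + t powr p)" using ** by (intro mult_left_mono) auto
  finally show "(s + t) powr p \<le> 2 powr p * (s powr p + t powr p)" .
qed

definition pth_power_integral :: "real \<Rightarrow> real \<Rightarrow> (complex \<Rightarrow> complex) \<Rightarrow> ennreal" where
  "pth_power_integral lam p F = (\<integral>\<^sup>+z. ennreal (norm (F z) powr p) \<partial>axial_measure lam 1)"

lemma measurable_norm_powr:
  assumes "continuous_on unit_disk F"
  shows "(\<lambda>z. ennreal (norm (F z) powr p)) \<in> borel_measurable (axial_measure lam 1)"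
  using borel_measurable_axial_continuous[of 1 F lam] assms by measurable

lemma pth_power_integral_cong:
  "(\<And>z. z \<in> unit_disk \<Longrightarrow> F z = G z) \<Longrightarrow> pth_power_integral lam p F = pth_power_integral lam p G"
  unfolding pth_power_integral_def by (intro nn_integral_cong) auto

lemma pth_power_integral_cnj:
  assumes "continuous_on unit_disk F" "0 < p"
  shows "pth_power_integral lam p (\<lambda>z. F (cnj z)) = pth_power_integral lam p F"
  unfolding pth_power_integral_def
  using assms by (intro nn_integral_axial_cnj continuous_on_powr' continuous_intros) auto

lemma pth_power_integral_add:
  assumes "continuous_on unit_disk F" "continuous_on unit_disk G" "0 \<le> p"
    and le: "\<And>z. z \<in> unit_disk \<Longrightarrow> norm (H z) \<le> norm (F z) + norm (G z)"
  shows "pth_power_integral lam p H \<le> ennreal (2 powr p) * (pth_power_integral lam p F + pth_power_integral lam p G)"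
proof -
  have "pth_power_integral lam p H \<le>
     (\<integral>\<^sup>+z. ennreal (2 powr p) * (ennreal (norm (F z) powr p) + ennreal (norm (G z) powr p)) \<partial>axial_measure lam 1)"
    unfolding pth_power_integral_def
  proof (rule nn_integral_mono)
    fix z assume "z \<in> space (axial_measure lam 1)"
    then have "norm (H z) powr p \<le> (norm (F z) + norm (G z)) powr p"
      using le[of z] assms(3) by (intro powr_mono2) auto
    also have "\<dots> \<le> 2 powr p * (norm (F z) powr p + norm (G z) powr p)"
      using assms(3) by (intro powr_sum_le) auto
    finally show "ennreal (norm (H z) powr p) \<le>
        ennreal (2 powr p) * (ennreal (norm (F z) powr p) + ennreal (norm (G z) powr p))"
      by (simp add: ennreal_plus[symmetric] ennreal_mult'[symmetric] ennreal_leI del: ennreal_plus)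
  qed
  also have "\<dots> = ennreal (2 powr p) * (pth_power_integral lam p F + pth_power_integral lam p G)"
    using measurable_norm_powr[OF assms(1), of p lam] measurable_norm_powr[OF assms(2), of p lam]
    unfolding pth_power_integral_def by (subst nn_integral_cmult) (auto simp: nn_integral_add)
  finally show ?thesis .
qed

lemma continuous_on_symmetrization:
  "continuous_on unit_disk g \<Longrightarrow> continuous_on unit_disk (symmetrization g)"
  unfolding symmetrization_def[abs_def]
  by (intro continuous_intros, assumption, rule continuous_on_compose2[of unit_disk g]) (auto intro!: continuous_intros)

lemma pth_power_integral_symmetrization:
  assumes F: "continuous_on unit_disk F" and p: "0 < p"
  shows "pth_power_integral lam p (symmetrization F) \<le> 2 * pth_power_integral lam p F"
proof -
  have F': "continuous_on unit_disk (\<lambda>z. F (cnj z))"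
    by (intro continuous_on_compose2[OF F] continuous_intros) auto
  have "pth_power_integral lam p (symmetrization F)
     \<le> (\<integral>\<^sup>+z. ennreal (norm (F z) powr p) + ennreal (norm (F (cnj z)) powr p) \<partial>axial_measure lam 1)"
    unfolding pth_power_integral_def
  proof (rule nn_integral_mono)
    fix z
    have "norm (symmetrization F z) powr p \<le> ((norm (F z) + norm (F (cnj z))) / 2) powr p"
      using p by (intro powr_mono2 norm_symmetrization) auto
    also have "\<dots> \<le> norm (F z) powr p + norm (F (cnj z)) powr p"
      using p by (intro powr_sum_le) auto
    finally show "ennreal (norm (symmetrization F z) powr p) \<le> ennreal (norm (F z) powr p) + ennreal (norm (F (cnj z)) powr p)"
      by (simp add: ennreal_plus[symmetric] ennreal_leI del: ennreal_plus)
  qed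
  also have "\<dots> = pth_power_integral lam p F + pth_power_integral lam p (\<lambda>z. F (cnj z))"
    unfolding pth_power_integral_def by (intro nn_integral_add measurable_norm_powr F F')
  also have "\<dots> = 2 * pth_power_integral lam p F"
    unfolding pth_power_integral_cnj[OF F p] by (simp add: mult_2)
  finally show ?thesis .
qed

definition weighted :: "(complex \<Rightarrow> complex) \<Rightarrow> complex \<Rightarrow> complex" where
  "weighted F z = of_real (1 - (norm z)\<^sup>2) * F z"

lemma norm_weighted: "norm z < 1 \<Longrightarrow> norm (weighted F z) = disc_weight 1 z * norm (F z)"
  using disc_weight_nonneg[of z 1]
  by (simp add: weighted_def norm_mult disc_weight_eq del: of_real_diff)

lemma continuous_on_weighted_fun: "continuous_on S F \<Longrightarrow> continuous_on S (weighted F)"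
  unfolding weighted_def[abs_def] by (intro continuous_intros)

lemma weighted_symmetrization: "weighted (symmetrization F) = symmetrization (weighted F)"
  by (simp add: weighted_def symmetrization_def fun_eq_iff field_simps)

lemma weighted_rotate: "weighted (\<lambda>z. - \<i> * F z) = (\<lambda>z. - \<i> * weighted F z)"
  by (simp add: weighted_def fun_eq_iff)

lemma pth_power_integral_rotate: "pth_power_integral lam p (\<lambda>z. - \<i> * F z) = pth_power_integral lam p F"
  by (simp add: pth_power_integral_def norm_mult)

lemma pth_power_integral_Re_Im:
  "pth_power_integral lam p F = (\<integral>\<^sup>+z. ennreal (sqrt ((Re (F z))\<^sup>2 + (Im (F z))\<^sup>2) powr p) \<partial>axial_measure lam 1)"
  by (simp add: pth_power_integral_def cmod_def)

lemma pth_power_integral_weighted_Re_Im: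
  "pth_power_integral lam p (weighted F) =
    (\<integral>\<^sup>+z. ennreal ((disc_weight 1 z * sqrt ((Re (F z))\<^sup>2 + (Im (F z))\<^sup>2)) powr p) \<partial>axial_measure lam 1)"
  unfolding pth_power_integral_def by (intro nn_integral_cong) (simp add: norm_weighted cmod_def[symmetric] norm_complex_def[symmetric])

lemma collect_constants:
  "0 \<le> P \<Longrightarrow> 0 \<le> C \<Longrightarrow> ennreal (P * (4 * C)) * X = ennreal P * (ennreal C * (4 * X))"
  by (simp add: ennreal_mult' mult_ac)

text \<open>The estimate for axial pairs, applied to the symmetrizations of \<open>f\<close> and \<open>- i f\<close>. Symmetrization
  commutes with the map from \<open>f\<close> to \<open>G\<close> and with multiplication by radial weights.\<close>
lemma hardy_pth_power:
  assumes f: "lambda_analytic lam f" and lam: "0 \<le> lam" and p: "1 \<le> p"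
  defines "G \<equiv> \<lambda>z. f z + of_real lam * f (cnj z) + z * partial_x f z"
  shows "pth_power_integral lam p f
    \<le> ennreal (2 powr p * (4 * (20 * p * (20 * p) powr (p - 1)))) * pth_power_integral lam p (weighted G)"
proof -
  note D = lambda_analyticD[OF f] and A = lambda_analytic_axial_pairs[OF f]
  let ?N = "pth_power_integral lam p" and ?C = "20 * p * (20 * p) powr (p - 1)"
  let ?f = "\<lambda>z. - \<i> * f z" and ?G = "\<lambda>z. - \<i> * G z"
  have cG: "continuous_on unit_disk G" unfolding G_def
    by (intro continuous_intros D(2,3) continuous_on_compose2[OF D(2)]) auto
  have cf: "continuous_on unit_disk ?f" by (intro continuous_on_mult continuous_on_const D(2))
  have e1: "euler_re lam (sym_Re f) (sym_Re (partial_x f)) (sym_Im (partial_x f)) z = sym_Re G z"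
    "euler_im lam (sym_Im f) (sym_Re (partial_x f)) (sym_Im (partial_x f)) z = sym_Im G z" for z
    by (rule euler_symmetrization, simp add: G_def)+
  have e2: "euler_re lam (sym_Re ?f) (sym_Re (\<lambda>z. - \<i> * partial_x f z)) (sym_Im (\<lambda>z. - \<i> * partial_x f z)) z = sym_Re ?G z"
    "euler_im lam (sym_Im ?f) (sym_Re (\<lambda>z. - \<i> * partial_x f z)) (sym_Im (\<lambda>z. - \<i> * partial_x f z)) z = sym_Im ?G z" for z
    by (rule euler_symmetrization, simp add: G_def algebra_simps)+
  have sG: "?N (weighted (symmetrization G)) \<le> 2 * ?N (weighted G)"
    unfolding weighted_symmetrization using p
    by (intro pth_power_integral_symmetrization continuous_on_weighted_fun cG) auto
  have sG': "?N (weighted (symmetrization ?G)) \<le> 2 * ?N (weighted G)"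
    unfolding weighted_symmetrization weighted_rotate
  proof -
    have "continuous_on unit_disk (\<lambda>z. - \<i> * weighted G z)"
      by (intro continuous_on_mult continuous_on_const continuous_on_weighted_fun cG)
    from pth_power_integral_symmetrization[OF this, of p lam] p
    show "?N (symmetrization (\<lambda>z. - \<i> * weighted G z)) \<le> 2 * ?N (weighted G)"
      unfolding pth_power_integral_rotate by linarith
  qed
  have "?N f \<le> ennreal (2 powr p) * (?N (symmetrization f) + ?N (symmetrization ?f))"
    using p by (intro pth_power_integral_add continuous_on_symmetrization D(2) cf norm_le_symmetrization) auto
  also have "\<dots> \<le> ennreal (2 powr p) * (ennreal ?C * ?N (weighted (symmetrization G)) + ennreal ?C * ?N (weighted (symmetrization ?G)))"
    unfolding pth_power_integral_Re_Im[of _ _ "symmetrization _"] pth_power_integral_weighted_Re_Im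
    by (intro mult_left_mono add_mono hardy_estimate_disc[OF A(1) lam p, unfolded e1] hardy_estimate_disc[OF A(2) lam p, unfolded e2]) auto
  also have "\<dots> \<le> ennreal (2 powr p) * (ennreal ?C * (2 * ?N (weighted G)) + ennreal ?C * (2 * ?N (weighted G)))"
    by (intro mult_left_mono add_mono sG sG') auto
  also have "\<dots> = ennreal (2 powr p) * (ennreal ?C * (4 * ?N (weighted G)))"
  proof -
    have "C * (2 * X) + C * (2 * X) = C * (4 * X)" for C X :: ennreal
      by (metis distrib_left distrib_right numeral_Bit0)
    then show ?thesis by simp
  qed
  also have "\<dots> = ennreal (2 powr p * (4 * ?C)) * ?N (weighted G)"
    using p by (intro collect_constants[symmetric]) auto
  finally show ?thesis .
qed

text \<open>The two terms of \<open>G\<close> without derivatives have the norm of \<open>f\<close> up to constants, so that only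
  \<open>\<partial>\<^sub>x f\<close> needs the weight.\<close>
lemma derivative_pth_power:
  assumes f: "lambda_analytic lam f" and lam: "0 \<le> lam" and p: "1 \<le> p"
  defines "G \<equiv> \<lambda>z. f z + of_real lam * f (cnj z) + z * partial_x f z"
  shows "pth_power_integral lam p (weighted G)
    \<le> ennreal (2 powr p * (2 powr p * (1 + lam powr p) + 2 powr p * (4 * derivative_constant lam p))) * pth_power_integral lam p f"
proof -
  note D = lambda_analyticD[OF f] and A = lambda_analytic_axial_pairs[OF f]
  let ?N = "pth_power_integral lam p" and ?C = "derivative_constant lam p"
  let ?f = "\<lambda>z. - \<i> * f z" and ?fx = "\<lambda>z. - \<i> * partial_x f z"
  have C: "0 \<le> ?C" by (rule derivative_constant_nonneg[OF lam p])
  have cf: "continuous_on unit_disk ?f" "continuous_on unit_disk ?fx"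
    by (intro continuous_on_mult continuous_on_const D)+
  have cf': "continuous_on unit_disk (\<lambda>z. f (cnj z))"
    by (intro continuous_on_compose2[OF D(2)] continuous_intros) auto
  define E where "E z = f z + of_real lam * f (cnj z)" for z
  have cE: "continuous_on unit_disk E" unfolding E_def by (intro continuous_intros D(2) cf')
  have "?N (weighted G) \<le> ennreal (2 powr p) * (?N E + ?N (weighted (partial_x f)))"
  proof (rule pth_power_integral_add[OF cE continuous_on_weighted_fun[OF D(3)]])
    fix z assume "z \<in> unit_disk"
    then have z: "norm z < 1" by simp
    have w: "0 \<le> disc_weight 1 z" "disc_weight 1 z \<le> 1" using z by (auto simp: disc_weight_nonneg disc_weight_le_1)
    have "norm (G z) \<le> norm (E z) + norm (z * partial_x f z)"
      unfolding G_def E_def by (rule norm_triangle_ineq)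
    also have "norm (z * partial_x f z) \<le> 1 * norm (partial_x f z)"
      unfolding norm_mult using z by (intro mult_right_mono) auto
    finally have "disc_weight 1 z * norm (G z) \<le> disc_weight 1 z * (norm (E z) + 1 * norm (partial_x f z))"
      using w(1) by (intro mult_left_mono) auto
    also have "\<dots> \<le> norm (E z) + disc_weight 1 z * norm (partial_x f z)"
      using mult_right_mono[OF w(2), of "norm (E z)"] by (simp add: algebra_simps)
    finally show "norm (weighted G z) \<le> norm (E z) + norm (weighted (partial_x f) z)"
      using z by (simp add: norm_weighted)
  qed (use p in auto)
  also have "\<dots> \<le> ennreal (2 powr p) * (ennreal (2 powr p * (1 + lam powr p)) * ?N f + ennreal (2 powr p * (4 * ?C)) * ?N f)"
  proof (intro mult_left_mono add_mono)
    have "?N E \<le> ennreal (2 powr p) * (?N f + ?N (\<lambda>z. of_real lam * f (cnj z)))"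
      using p by (intro pth_power_integral_add D(2) continuous_intros cf') (auto simp: E_def intro: norm_triangle_ineq)
    also have "?N (\<lambda>z. of_real lam * f (cnj z)) = ennreal (lam powr p) * ?N (\<lambda>z. f (cnj z))"
      unfolding pth_power_integral_def using lam
      by (subst nn_integral_cmult[OF measurable_norm_powr[OF cf'], symmetric])
        (auto simp: norm_mult powr_mult ennreal_mult' intro!: nn_integral_cong)
    also have "?N (\<lambda>z. f (cnj z)) = ?N f" using p by (intro pth_power_integral_cnj D(2)) auto
    also have "ennreal (2 powr p) * (?N f + ennreal (lam powr p) * ?N f) = ennreal (2 powr p * (1 + lam powr p)) * ?N f"
      by (simp add: ennreal_mult' distrib_left distrib_right mult.assoc)
    finally show "?N E \<le> ennreal (2 powr p * (1 + lam powr p)) * ?N f" .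
    have s: "?N (symmetrization f) \<le> 2 * ?N f"
      using p by (intro pth_power_integral_symmetrization D(2)) auto
    have s': "?N (symmetrization ?f) \<le> 2 * ?N f"
      using pth_power_integral_symmetrization[OF cf(1), of p lam] p unfolding pth_power_integral_rotate by simp
    have "?N (weighted (partial_x f)) \<le> ennreal (2 powr p) *
        (?N (weighted (symmetrization (partial_x f))) + ?N (weighted (symmetrization ?fx)))"
    proof (rule pth_power_integral_add)
      fix z assume "z \<in> unit_disk"
      then have z: "norm z < 1" by simp
      have "disc_weight 1 z * norm (partial_x f z)
          \<le> disc_weight 1 z * (norm (symmetrization (partial_x f) z) + norm (symmetrization ?fx z))"
        using z by (intro mult_left_mono norm_le_symmetrization disc_weight_nonneg) auto
      then show "norm (weighted (partial_x f) z)
          \<le> norm (weighted (symmetrization (partial_x f)) z) + norm (weighted (symmetrization ?fx) z)"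
        using z by (simp add: norm_weighted distrib_left)
    next
      show "continuous_on unit_disk (weighted (symmetrization (partial_x f)))"
        "continuous_on unit_disk (weighted (symmetrization ?fx))"
        by (intro continuous_on_weighted_fun continuous_on_symmetrization D(3) cf(2))+
    qed (use p in auto)
    also have "\<dots> \<le> ennreal (2 powr p) * (ennreal ?C * ?N (symmetrization f) + ennreal ?C * ?N (symmetrization ?f))"
      unfolding pth_power_integral_Re_Im[of _ _ "symmetrization _"] pth_power_integral_weighted_Re_Im
      by (intro mult_left_mono add_mono derivative_estimate_disc[OF A(1) lam p] derivative_estimate_disc[OF A(2) lam p]) auto
    also have "\<dots> \<le> ennreal (2 powr p) * (ennreal ?C * (2 * ?N f) + ennreal ?C * (2 * ?N f))"
      by (intro mult_left_mono add_mono s s') auto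
    also have "\<dots> = ennreal (2 powr p) * (ennreal ?C * (4 * ?N f))"
    proof -
      have "C * (2 * X) + C * (2 * X) = C * (4 * X)" for C X :: ennreal
        by (metis distrib_left distrib_right numeral_Bit0)
      then show ?thesis by simp
    qed
    also have "\<dots> = ennreal (2 powr p * (4 * ?C)) * ?N f"
      using C by (intro collect_constants[symmetric]) auto
    finally show "?N (weighted (partial_x f)) \<le> ennreal (2 powr p * (4 * ?C)) * ?N f" .
  qed auto
  also have "\<dots> = ennreal (2 powr p * (2 powr p * (1 + lam powr p) + 2 powr p * (4 * ?C))) * ?N f"
  proof -
    have "ennreal (P * (S + T)) * X = ennreal P * (ennreal S * X + ennreal T * X)"
      if "0 \<le> P" "0 \<le> S" "0 \<le> T" for P S T X
      using that by (simp add: ennreal_mult' ennreal_plus distrib_right mult.assoc)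
    from this[of "2 powr p" "2 powr p * (1 + lam powr p)" "2 powr p * (4 * ?C)" "?N f", symmetric]
    show ?thesis using C by auto
  qed
  finally show ?thesis .
qed

lemma c_const_pos: "0 \<le> lam \<Longrightarrow> 0 < c_const lam"
  unfolding c_const_def by (intro divide_pos_pos mult_pos_pos Gamma_real_pos) auto

lemma borel_measurable_sigma_continuous:
  assumes "continuous_on unit_disk F"
  shows "F \<in> borel_measurable (sigma_measure lam)"
proof -
  have "F \<in> borel_measurable (lebesgue_on unit_disk)"
    by (rule continuous_imp_measurable_on_sets_lebesgue[OF assms]) simp
  then show ?thesis by (simp add: sigma_measure_def)
qed

text \<open>A nonnegative integral does not change under completion, which links Lebesgue and Borel measure.\<close>
lemma nn_integral_sigma:
  assumes F: "continuous_on unit_disk F" and lam: "0 \<le> lam"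
  shows "(\<integral>\<^sup>+z. ennreal (norm (F z) powr p) \<partial>sigma_measure lam) = ennreal (c_const lam) * pth_power_integral lam p F"
proof -
  let ?P = "\<lambda>z. ennreal (norm (F z) powr p)"
  have F': "?P \<in> borel_measurable (lebesgue_on unit_disk)"
  proof -
    have [measurable]: "F \<in> borel_measurable (lebesgue_on unit_disk)"
      by (rule continuous_imp_measurable_on_sets_lebesgue[OF F]) simp
    show ?thesis by measurable
  qed
  have [measurable]: "(\<lambda>z. ennreal (c_const lam * \<bar>Im z\<bar> powr (2 * lam))) \<in> borel_measurable (lebesgue_on unit_disk)"
    by (rule measurable_restrict_space1, rule measurable_completion) measurable
  have "(\<integral>\<^sup>+z. ?P z \<partial>sigma_measure lam)
      = (\<integral>\<^sup>+z. ennreal (c_const lam * \<bar>Im z\<bar> powr (2 * lam)) * ?P z * indicator unit_disk z \<partial>lborel)"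
    unfolding sigma_measure_def using F'
    by (subst nn_integral_density) (auto simp: nn_integral_restrict_space nn_integral_completion)
  also have "\<dots> = (\<integral>\<^sup>+z. ennreal (\<bar>Im z\<bar> powr (2 * lam)) * (ennreal (c_const lam) * ?P z) * indicator (ball 0 1) z \<partial>lborel)"
    using c_const_pos[OF lam] by (intro nn_integral_cong) (simp add: ennreal_mult' mult_ac)
  also have "\<dots> = (\<integral>\<^sup>+z. ennreal (c_const lam) * ?P z \<partial>axial_measure lam 1)"
  proof (rule nn_integral_axial_measure[symmetric])
    have [measurable]: "F \<in> borel_measurable (axial_measure lam 1)"
      by (rule borel_measurable_axial_continuous[OF F])
    show "(\<lambda>z. ennreal (c_const lam) * ?P z) \<in> borel_measurable (axial_measure lam 1)" by measurable
  qed
  also have "\<dots> = ennreal (c_const lam) * pth_power_integral lam p F"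
    unfolding pth_power_integral_def by (rule nn_integral_cmult[OF measurable_norm_powr[OF F]])
  finally show ?thesis .
qed

lemma Lp_space_iff:
  assumes F: "continuous_on unit_disk F" and lam: "0 \<le> lam"
  shows "F \<in> Lp_space lam p \<longleftrightarrow> pth_power_integral lam p F < \<infinity>"
proof -
  have m: "F \<in> borel_measurable (sigma_measure lam)" by (rule borel_measurable_sigma_continuous[OF F])
  then have "(\<lambda>z. norm (F z) powr p) \<in> borel_measurable (sigma_measure lam)" by measurable
  then have "F \<in> Lp_space lam p \<longleftrightarrow> (\<integral>\<^sup>+z. ennreal (norm (F z) powr p) \<partial>sigma_measure lam) < \<infinity>"
    using m by (simp add: Lp_space_def integrable_iff_bounded)
  also have "\<dots> \<longleftrightarrow> pth_power_integral lam p F < \<infinity>"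
    unfolding nn_integral_sigma[OF F lam] using c_const_pos[OF lam] by (auto simp: ennreal_mult_less_top)
  finally show ?thesis .
qed

lemma Lp_norm_le:
  assumes F: "continuous_on unit_disk F" and G: "continuous_on unit_disk G" and lam: "0 \<le> lam" and p: "1 \<le> p"
    and C: "0 \<le> C" and G': "G \<in> Lp_space lam p" and F': "F \<in> Lp_space lam p"
    and le: "pth_power_integral lam p F \<le> ennreal C * pth_power_integral lam p G"
  shows "Lp_norm lam p F \<le> C powr (1 / p) * Lp_norm lam p G"
proof -
  let ?I = "\<lambda>F. LINT z|sigma_measure lam. norm (F z) powr p"
  have eq: "ennreal (?I F) = ennreal (c_const lam) * pth_power_integral lam p F"
    if "F \<in> Lp_space lam p" "continuous_on unit_disk F" for F
    using that nn_integral_sigma[OF that(2) lam, of p] nn_integral_eq_integral[of "sigma_measure lam" "\<lambda>z. norm (F z) powr p"]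
    by (simp add: Lp_space_def)
  have "ennreal (?I F) \<le> ennreal (c_const lam) * (ennreal C * pth_power_integral lam p G)"
    unfolding eq[OF F' F] by (intro mult_left_mono le) auto
  also have "\<dots> = ennreal C * ennreal (?I G)"
    unfolding eq[OF G' G] by (simp add: mult_ac)
  also have "\<dots> = ennreal (C * ?I G)" using C by (simp add: ennreal_mult')
  finally have "ennreal (?I F) \<le> ennreal (C * ?I G)" .
  moreover have "0 \<le> C * ?I G" using C by (intro mult_nonneg_nonneg integral_nonneg_AE) auto
  ultimately have "?I F \<le> C * ?I G" by (simp only: ennreal_le_iff)
  then have "?I F powr (1 / p) \<le> (C * ?I G) powr (1 / p)"
    using p by (intro powr_mono2) auto
  also have "\<dots> = C powr (1 / p) * ?I G powr (1 / p)"
    by (rule powr_mult)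
  finally show ?thesis unfolding Lp_norm_def .
qed

theorem theorem6p8:
  fixes lam p :: real
  assumes "lam \<ge> 0" and "1 \<le> p"
  shows "(\<forall>f. lambda_analytic lam f \<longrightarrow>
            (f \<in> Ap_space lam p \<longleftrightarrow>
             (\<lambda>z. of_real (1 - (norm z)\<^sup>2) * D_z lam (\<lambda>w. w * f w) z) \<in> Lp_space lam p))
       \<and> (\<exists>A>0. \<exists>B>0. \<forall>f\<in>Ap_space lam p.
            Lp_norm lam p f
              \<le> A * Lp_norm lam p (\<lambda>z. of_real (1 - (norm z)\<^sup>2) * D_z lam (\<lambda>w. w * f w) z)
          \<and> Lp_norm lam p (\<lambda>z. of_real (1 - (norm z)\<^sup>2) * D_z lam (\<lambda>w. w * f w) z)
              \<le> B * Lp_norm lam p f)"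
proof -
  define C\<^sub>1 where "C\<^sub>1 = 2 powr p * (4 * (20 * p * (20 * p) powr (p - 1)))"
  define C\<^sub>2 where "C\<^sub>2 = 2 powr p * (2 powr p * (1 + lam powr p) + 2 powr p * (4 * derivative_constant lam p))"
  have C1: "0 < C\<^sub>1" using assms by (simp add: C\<^sub>1_def)
  have C2: "0 < C\<^sub>2" unfolding C\<^sub>2_def
    using derivative_constant_nonneg[OF assms] by (intro mult_pos_pos add_pos_nonneg) (auto intro: add_pos_nonneg)
  let ?T = "\<lambda>f. weighted (D_z lam (\<lambda>w. w * f w))"
  have key: "continuous_on unit_disk f" "continuous_on unit_disk (?T f)"
    "pth_power_integral lam p f \<le> ennreal C\<^sub>1 * pth_power_integral lam p (?T f)"
    "pth_power_integral lam p (?T f) \<le> ennreal C\<^sub>2 * pth_power_integral lam p f"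
    if f: "lambda_analytic lam f" for f
  proof -
    note D = lambda_analyticD[OF f]
    let ?G = "\<lambda>z. f z + of_real lam * f (cnj z) + z * partial_x f z"
    show "continuous_on unit_disk f" by (rule D(2))
    have eq: "?T f z = weighted ?G z" if "z \<in> unit_disk" for z
      using D_z_times_identity[OF f that] by (simp add: weighted_def)
    have cong: "pth_power_integral lam p (?T f) = pth_power_integral lam p (weighted ?G)"
      by (rule pth_power_integral_cong) (rule eq)
    have "continuous_on unit_disk ?G"
      by (intro continuous_intros D(2,3) continuous_on_compose2[OF D(2)]) auto
    from continuous_on_weighted_fun[OF this] show "continuous_on unit_disk (?T f)"
      by (rule continuous_on_eq) (simp add: eq)
    show "pth_power_integral lam p f \<le> ennreal C\<^sub>1 * pth_power_integral lam p (?T f)"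
      "pth_power_integral lam p (?T f) \<le> ennreal C\<^sub>2 * pth_power_integral lam p f"
      unfolding cong C\<^sub>1_def C\<^sub>2_def
      by (rule hardy_pth_power[OF f assms] derivative_pth_power[OF f assms])+
  qed
  have fin: "ennreal C * X < \<infinity>" if "X < \<infinity>" for C X using that by (simp add: ennreal_mult_less_top)
  have iff: "f \<in> Lp_space lam p \<longleftrightarrow> ?T f \<in> Lp_space lam p" if f: "lambda_analytic lam f" for f
    unfolding Lp_space_iff[OF key(1)[OF f] assms(1)] Lp_space_iff[OF key(2)[OF f] assms(1)]
    using le_less_trans[OF key(3)[OF f] fin] le_less_trans[OF key(4)[OF f] fin] by blast
  have "\<forall>f. lambda_analytic lam f \<longrightarrow> (f \<in> Ap_space lam p \<longleftrightarrow> ?T f \<in> Lp_space lam p)"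
    using iff by (simp add: Ap_space_def)
  moreover have "Lp_norm lam p f \<le> C\<^sub>1 powr (1 / p) * Lp_norm lam p (?T f) \<and>
      Lp_norm lam p (?T f) \<le> C\<^sub>2 powr (1 / p) * Lp_norm lam p f" if "f \<in> Ap_space lam p" for f
  proof -
    have f: "lambda_analytic lam f" "f \<in> Lp_space lam p" using that by (auto simp: Ap_space_def)
    have Tf: "?T f \<in> Lp_space lam p" using iff[OF f(1)] f(2) by simp
    show ?thesis
      using Lp_norm_le[OF key(1,2)[OF f(1)] assms less_imp_le[OF C1] Tf f(2) key(3)[OF f(1)]]
        Lp_norm_le[OF key(2,1)[OF f(1)] assms less_imp_le[OF C2] f(2) Tf key(4)[OF f(1)]] by simp
  qed
  moreover have "0 < C\<^sub>1 powr (1 / p)" "0 < C\<^sub>2 powr (1 / p)" using C1 C2 by auto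
  ultimately show ?thesis unfolding weighted_def[abs_def] by blast
qed

end
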